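(* We have $H^2(P, V)=0$ except for the case $l_1=l_2$ and $N(\epsilon )^{l_1}=1$. If $l_1=l_2$ and $N(\epsilon )^{l_1}=1$, then we have $\dim H^2(P,V)=1$.
   Context: Let $F$ be a real quadratic field with ring of integers $\mathcal O_F=\mathbf Z+\mathbf Z\omega$, let $\epsilon$ be the fundamental unit of $F$ with norm $N(\epsilon)$, and for $x\in F$ let $x'$ denote its Galois conjugate. Let $\Gamma={\rm PSL}(2,\mathcal O_F)$ and $P=\{\begin{pmatrix} t & 0\\ u & t^{-1}\end{pmatrix} : t\in\mathcal O_F^{\times}, u\in\mathcal O_F\}/\{\pm 1_2\}$. Let $l_1\ge l_2\ge 0$ be integers with $l_1\equiv l_2 \bmod 2$. For $l\ge0$ let $\rho_l$ be the symmetric tensor representation of ${\rm GL}(2,\mathbf C)$ of degree $l$ on $\mathbf C^{l+1}$. Let $V=V_1\otimes V_2$ with $V_i=\mathbf C^{l_i+1}$, on which $\gamma\in\Gamma$ acts by $\rho_{l_1}(\gamma)\otimes\rho_{l_2}(\gamma')$, $\gamma'$ being the Galois conjugate matrix. *)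

theory Defs
  imports
    "Jordan_Normal_Form.VS_Connect"
    "HOL-Computational_Algebra.Squarefree"
    "HOL-Number_Theory.Cong"
    "HOL-Algebra.AbelCoset"
begin

hide_const (open) Multiset.mult Polynomial.smult Modules.module

section \<open>Real quadratic fields\<close>

text \<open>
  A real quadratic field is the subfield \<open>\<rat>(\<surd>d)\<close> of \<open>\<real>\<close> for a unique squarefree \<open>d > 1\<close>;
  the two real embeddings of the field are the inclusion and the conjugation below.
\<close>

definition quad_field :: "nat \<Rightarrow> real set" where
  "quad_field d = {of_rat a + of_rat b * sqrt (real d) | a b. True}"

definition galois_conj :: "nat \<Rightarrow> real \<Rightarrow> real" where
  "galois_conj d x = (THE y. \<exists>a b. x = of_rat a + of_rat b * sqrt (real d) \<and>
                                   y = of_rat a - of_rat b * sqrt (real d))"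

lemma galois_conj_eq:
  assumes "squarefree d" "d > 1"
  shows "galois_conj d (of_rat a + of_rat b * sqrt (real d)) = of_rat a - of_rat b * sqrt (real d)"
proof -
  have irrat: "sqrt (real d) \<notin> \<rat>"
  proof
    assume "sqrt (real d) \<in> \<rat>"
    moreover have "algebraic_int (sqrt (real d))"
      by (rule algebraic_int.intros[of "[:- real d, 0, 1:]"])
         (auto simp: coeff_pCons split: nat.splits)
    ultimately have "sqrt (real d) \<in> \<int>" by (rule rational_algebraic_int_is_int[rotated])
    then obtain k where k: "sqrt (real d) = of_int k" by (elim Ints_cases)
    hence "of_int (int d) = (of_int (k\<^sup>2) :: real)"
      by (metis of_int_of_nat_eq of_int_power of_nat_0_le_iff real_sqrt_pow2)
    hence "int d = k\<^sup>2" by (simp only: of_int_eq_iff)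
    hence "d = (nat \<bar>k\<bar>)\<^sup>2" by (metis nat_int nat_power_eq abs_ge_zero power2_abs)
    with assms show False unfolding squarefree_def by (metis dvd_refl is_unit_power_iff less_numeral_extra(4) nat_dvd_1_iff_1)
  qed
  have uniq: "a' = a \<and> b' = b"
    if "of_rat a' + of_rat b' * sqrt (real d) = of_rat a + of_rat b * sqrt (real d)" for a' b'
  proof (cases "b' = b")
    case False
    with that have "sqrt (real d) = of_rat ((a - a') / (b' - b))"
      by (simp add: of_rat_divide of_rat_diff field_simps)
    with irrat show ?thesis by simp
  qed (use that in simp)
  show ?thesis
    unfolding galois_conj_def by (rule the_equality) (use uniq in metis)+
qed

definition quad_norm :: "nat \<Rightarrow> real \<Rightarrow> real" where
  "quad_norm d x = x * galois_conj d x"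

definition ring_of_integers :: "nat \<Rightarrow> real set" where
  "ring_of_integers d = {x \<in> quad_field d. algebraic_int x}"

definition integer_units :: "nat \<Rightarrow> real set" where
  "integer_units d = {t \<in> ring_of_integers d. t \<noteq> 0 \<and> inverse t \<in> ring_of_integers d}"

definition fundamental_unit :: "nat \<Rightarrow> real \<Rightarrow> bool" where
  "fundamental_unit d \<epsilon> \<longleftrightarrow> \<epsilon> \<in> integer_units d \<and> \<epsilon> > 1 \<and>
     (\<forall>t \<in> integer_units d. \<exists>n::int. t = \<epsilon> powi n \<or> t = - (\<epsilon> powi n))"


section \<open>The groups \<open>\<Gamma> = PSL(2, O\<^sub>F)\<close> and \<open>P\<close>\<close>

definition SL2 :: "nat \<Rightarrow> real mat monoid" where
  "SL2 d = \<lparr>carrier = {A \<in> carrier_mat 2 2. elements_mat A \<subseteq> ring_of_integers d \<and> det A = 1},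
            mult = (*), one = 1\<^sub>m 2\<rparr>"

definition PSL2 :: "nat \<Rightarrow> real mat set monoid" where
  "PSL2 d = SL2 d Mod {1\<^sub>m 2, - 1\<^sub>m 2}"

definition lower_mat :: "real \<Rightarrow> real \<Rightarrow> real mat" where
  "lower_mat t u = mat_of_rows_list 2 [[t, 0], [u, inverse t]]"

definition parabolic :: "nat \<Rightarrow> real mat set monoid" where
  "parabolic d = (PSL2 d) \<lparr>carrier :=
     {{1\<^sub>m 2, - 1\<^sub>m 2} #>\<^bsub>SL2 d\<^esub> lower_mat t u | t u. t \<in> integer_units d \<and> u \<in> ring_of_integers d}\<rparr>"


section \<open>The representation \<open>V = V\<^sub>1 \<otimes> V\<^sub>2\<close>\<close>

text \<open>
  \<open>sym_rep l g\<close> is the matrix with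
  \<open>sym_rep l g (x\<^sup>l, x\<^sup>l\<^sup>-\<^sup>1y, \<dots>, y\<^sup>l)\<^sup>T = (X\<^sup>l, X\<^sup>l\<^sup>-\<^sup>1Y, \<dots>, Y\<^sup>l)\<^sup>T\<close> where
  \<open>(X, Y)\<^sup>T = g (x, y)\<^sup>T\<close>: its \<open>(i, j)\<close> entry is the coefficient of \<open>x\<^sup>l\<^sup>-\<^sup>jy\<^sup>j\<close> in
  \<open>X\<^sup>l\<^sup>-\<^sup>iY\<^sup>i\<close>, read off after setting \<open>x = 1\<close>.
\<close>

definition sym_rep :: "nat \<Rightarrow> complex mat \<Rightarrow> complex mat" where
  "sym_rep l g = mat (l + 1) (l + 1) (\<lambda>(i, j).
     coeff ([:g $$ (0,0), g $$ (0,1):] ^ (l - i) * [:g $$ (1,0), g $$ (1,1):] ^ i) j)"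

text \<open>
  \<open>\<complex>\<^sup>m \<otimes> \<complex>\<^sup>n\<close> is the space of \<open>m \<times> n\<close> matrices, with \<open>x \<otimes> y\<close> the matrix \<open>x y\<^sup>T\<close>.
\<close>

definition tensor_space :: "nat \<Rightarrow> nat \<Rightarrow> (complex, complex mat) module" where
  "tensor_space l1 l2 = module_mat TYPE(complex) (l1 + 1) (l2 + 1)"

definition tensor_vec :: "complex vec \<Rightarrow> complex vec \<Rightarrow> complex mat" where
  "tensor_vec x y = mat (dim_vec x) (dim_vec y) (\<lambda>(i, j). x $ i * y $ j)"

definition tensor_map :: "complex mat \<Rightarrow> complex mat \<Rightarrow> complex mat \<Rightarrow> complex mat" where
  "tensor_map A B v = A * v * transpose_mat B"

lemma tensor_map_tensor_vec:
  assumes "A \<in> carrier_mat k m" "B \<in> carrier_mat l n" "x \<in> carrier_vec m" "y \<in> carrier_vec n"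
  shows "tensor_map A B (tensor_vec x y) = tensor_vec (A *\<^sub>v x) (B *\<^sub>v y)"
proof (rule eq_matI, goal_cases)
  case (1 i j)
  hence ij: "i < k" "j < l" using assms by (auto simp: tensor_vec_def)
  have "tensor_map A B (tensor_vec x y) $$ (i, j) =
      (\<Sum>q<n. (\<Sum>p<m. A $$ (i, p) * (x $ p * y $ q)) * B $$ (j, q))"
    using assms ij
    by (simp add: tensor_map_def tensor_vec_def scalar_prod_def atLeast0LessThan)
  also have "\<dots> = (\<Sum>p<m. A $$ (i, p) * x $ p) * (\<Sum>q<n. B $$ (j, q) * y $ q)"
    by (simp add: sum_distrib_left sum_distrib_right mult_ac)
  also have "\<dots> = tensor_vec (A *\<^sub>v x) (B *\<^sub>v y) $$ (i, j)"
    using assms ij by (simp add: tensor_vec_def scalar_prod_def atLeast0LessThan)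
  finally show ?case .
qed (use assms in \<open>auto simp: tensor_map_def tensor_vec_def\<close>)

definition SL2_act :: "nat \<Rightarrow> nat \<Rightarrow> nat \<Rightarrow> real mat \<Rightarrow> complex mat \<Rightarrow> complex mat" where
  "SL2_act d l1 l2 A =
     tensor_map (sym_rep l1 (map_mat of_real A)) (sym_rep l2 (map_mat (of_real \<circ> galois_conj d) A))"

text \<open>
  The choice of a representative in \<open>PSL2_act\<close> is irrelevant by the next lemma.
\<close>

lemma SL2_act_uminus:
  assumes "squarefree d" "d > 1" "[l1 = l2] (mod 2)" "A \<in> carrier (SL2 d)"
    and "v \<in> carrier (tensor_space l1 l2)"
  shows "SL2_act d l1 l2 (- A) v = SL2_act d l1 l2 A v"
proof -
  have A: "A \<in> carrier_mat 2 2" "\<And>i j. i < 2 \<Longrightarrow> j < 2 \<Longrightarrow> A $$ (i, j) \<in> quad_field d"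
    using assms(4) by (auto simp: SL2_def ring_of_integers_def)
  have conj: "galois_conj d (- x) = - galois_conj d x" if x: "x \<in> quad_field d" for x
  proof -
    obtain a b where x: "x = of_rat a + of_rat b * sqrt (real d)"
      using x by (auto simp: quad_field_def)
    have "- x = of_rat (- a) + of_rat (- b) * sqrt (real d)" by (simp add: x of_rat_minus)
    thus ?thesis
      using galois_conj_eq[OF assms(1,2), of "- a" "- b"] galois_conj_eq[OF assms(1,2), of a b]
      by (simp add: x of_rat_minus)
  qed
  have rep: "sym_rep l (- g) = (- 1) ^ l \<cdot>\<^sub>m sym_rep l g" if "g \<in> carrier_mat 2 2" for l g
  proof (rule eq_matI, goal_cases)
    case (1 i j)
    have neg: "[:- a, - b:] ^ n = Polynomial.smult ((- 1) ^ n) ([:a, b:] ^ n)" for a b :: complex and n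
      using smult_power[of "- 1" "[:a, b:]" n] by simp
    have "(- 1 :: complex) ^ (l - i) * (- 1) ^ i = (- 1) ^ l"
      using 1 by (simp add: sym_rep_def flip: power_add)
    thus ?case using 1 that by (simp add: sym_rep_def neg mult_ac)
  qed (auto simp: sym_rep_def)
  have "SL2_act d l1 l2 (- A) v = tensor_map ((- 1) ^ l1 \<cdot>\<^sub>m sym_rep l1 (map_mat of_real A))
      ((- 1) ^ l2 \<cdot>\<^sub>m sym_rep l2 (map_mat (of_real \<circ> galois_conj d) A)) v"
  proof -
    have "map_mat of_real (- A) = - map_mat complex_of_real A"
      "map_mat (complex_of_real \<circ> galois_conj d) (- A) = - map_mat (of_real \<circ> galois_conj d) A"
      using A by (auto intro!: eq_matI simp: conj)
    thus ?thesis using A by (simp add: SL2_act_def rep)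
  qed
  also have "\<dots> = ((- 1) ^ l1 * (- 1) ^ l2) \<cdot>\<^sub>m SL2_act d l1 l2 A v"
  proof -
    have "(a \<cdot>\<^sub>m M) * v * transpose_mat (b \<cdot>\<^sub>m N) = (a * b) \<cdot>\<^sub>m (M * v * transpose_mat N)"
      if "M \<in> carrier_mat (l1 + 1) (l1 + 1)" "N \<in> carrier_mat (l2 + 1) (l2 + 1)"
      for M N and a b :: complex
    proof -
      have v: "v \<in> carrier_mat (l1 + 1) (l2 + 1)"
        using assms(5) by (simp add: tensor_space_def module_mat_simps)
      have "transpose_mat (b \<cdot>\<^sub>m N) = b \<cdot>\<^sub>m transpose_mat N" by (auto intro!: eq_matI)
      moreover have "(a \<cdot>\<^sub>m M) * v = a \<cdot>\<^sub>m (M * v)" using that v by auto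
      moreover have "(a \<cdot>\<^sub>m (M * v)) * (b \<cdot>\<^sub>m transpose_mat N)
          = a \<cdot>\<^sub>m ((M * v) * (b \<cdot>\<^sub>m transpose_mat N))"
        using that v by (intro mult_smult_assoc_mat) auto
      moreover have "(M * v) * (b \<cdot>\<^sub>m transpose_mat N) = b \<cdot>\<^sub>m (M * v * transpose_mat N)"
        using that v by (intro mult_smult_distrib) auto
      ultimately show ?thesis by (auto intro!: eq_matI)
    qed
    thus ?thesis by (simp add: SL2_act_def tensor_map_def sym_rep_def)
  qed
  also have "(- 1) ^ l1 * (- 1) ^ l2 = (1 :: complex)"
    using assms(3) by (auto simp: cong_def even_iff_mod_2_eq_zero minus_one_power_iff)
  also have "1 \<cdot>\<^sub>m SL2_act d l1 l2 A v = SL2_act d l1 l2 A v"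
    by (auto intro!: eq_matI)
  finally show ?thesis .
qed

definition PSL2_act :: "nat \<Rightarrow> nat \<Rightarrow> nat \<Rightarrow> real mat set \<Rightarrow> complex mat \<Rightarrow> complex mat" where
  "PSL2_act d l1 l2 \<gamma> = SL2_act d l1 l2 (SOME A. A \<in> \<gamma>)"


section \<open>Group cohomology in degree two\<close>

text \<open>
  The fields \<open>mult\<close> and \<open>one\<close> of a module record play no role.
\<close>

definition fun_module :: "'x set \<Rightarrow> ('k, 'm, 'c) module_scheme \<Rightarrow> ('k, 'x \<Rightarrow> 'm) module" where
  "fun_module X M = \<lparr>carrier = X \<rightarrow>\<^sub>E carrier M, mult = undefined, one = undefined,
     zero = (\<lambda>x\<in>X. \<zero>\<^bsub>M\<^esub>), add = (\<lambda>f g. \<lambda>x\<in>X. f x \<oplus>\<^bsub>M\<^esub> g x),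
     smult = (\<lambda>c f. \<lambda>x\<in>X. c \<odot>\<^bsub>M\<^esub> f x)\<rparr>"

definition quotient_module ::
    "('k, 'm, 'c) module_scheme \<Rightarrow> 'm set \<Rightarrow> ('k, 'm set) module" where
  "quotient_module M N = \<lparr>carrier = a_rcosets\<^bsub>M\<^esub> N, mult = undefined, one = undefined,
     zero = N, add = set_add M, smult = (\<lambda>c X. \<Union>x\<in>X. N +>\<^bsub>M\<^esub> (c \<odot>\<^bsub>M\<^esub> x))\<rparr>"

definition coboundary1 ::
    "('g, 'a) monoid_scheme \<Rightarrow> ('k, 'm, 'c) module_scheme \<Rightarrow> ('g \<Rightarrow> 'm \<Rightarrow> 'm) \<Rightarrow>
     ('g \<Rightarrow> 'm) \<Rightarrow> ('g \<times> 'g \<Rightarrow> 'm)" where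
  "coboundary1 G M act f = (\<lambda>(g, h) \<in> carrier G \<times> carrier G.
     act g (f h) \<ominus>\<^bsub>M\<^esub> f (g \<otimes>\<^bsub>G\<^esub> h) \<oplus>\<^bsub>M\<^esub> f g)"

definition coboundary2 ::
    "('g, 'a) monoid_scheme \<Rightarrow> ('k, 'm, 'c) module_scheme \<Rightarrow> ('g \<Rightarrow> 'm \<Rightarrow> 'm) \<Rightarrow>
     ('g \<times> 'g \<Rightarrow> 'm) \<Rightarrow> ('g \<times> 'g \<times> 'g \<Rightarrow> 'm)" where
  "coboundary2 G M act f = (\<lambda>(g, h, k) \<in> carrier G \<times> carrier G \<times> carrier G.
     act g (f (h, k)) \<ominus>\<^bsub>M\<^esub> f (g \<otimes>\<^bsub>G\<^esub> h, k) \<oplus>\<^bsub>M\<^esub> f (g, h \<otimes>\<^bsub>G\<^esub> k) \<ominus>\<^bsub>M\<^esub> f (g, h))"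

definition cocycles2 ::
    "('g, 'a) monoid_scheme \<Rightarrow> ('k, 'm, 'c) module_scheme \<Rightarrow> ('g \<Rightarrow> 'm \<Rightarrow> 'm) \<Rightarrow>
     ('g \<times> 'g \<Rightarrow> 'm) set" where
  "cocycles2 G M act = {f \<in> carrier G \<times> carrier G \<rightarrow>\<^sub>E carrier M.
     coboundary2 G M act f = (\<lambda>x \<in> carrier G \<times> carrier G \<times> carrier G. \<zero>\<^bsub>M\<^esub>)}"

definition coboundaries2 ::
    "('g, 'a) monoid_scheme \<Rightarrow> ('k, 'm, 'c) module_scheme \<Rightarrow> ('g \<Rightarrow> 'm \<Rightarrow> 'm) \<Rightarrow>
     ('g \<times> 'g \<Rightarrow> 'm) set" where
  "coboundaries2 G M act = coboundary1 G M act ` (carrier G \<rightarrow>\<^sub>E carrier M)"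

definition cohomology2 ::
    "('g, 'a) monoid_scheme \<Rightarrow> ('k, 'm, 'c) module_scheme \<Rightarrow> ('g \<Rightarrow> 'm \<Rightarrow> 'm) \<Rightarrow>
     ('k, ('g \<times> 'g \<Rightarrow> 'm) set) module" where
  "cohomology2 G M act =
     quotient_module
       ((fun_module (carrier G \<times> carrier G) M) \<lparr>carrier := cocycles2 G M act\<rparr>)
       (coboundaries2 G M act)"

definition H2_parabolic ::
    "nat \<Rightarrow> nat \<Rightarrow> nat \<Rightarrow> (complex, (real mat set \<times> real mat set \<Rightarrow> complex mat) set) module" where
  "H2_parabolic d l1 l2 = cohomology2 (parabolic d) (tensor_space l1 l2) (PSL2_act d l1 l2)"

end

theory Submission
  imports Defs "HOL-Computational_Algebra.Formal_Power_Series"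
begin

text \<open>
  The group \<open>P\<close> is \<open>O\<^sub>F \<rtimes> \<langle>\<epsilon>\<rangle>\<close> with \<open>\<epsilon>\<close> acting on \<open>O\<^sub>F\<close> by \<open>\<epsilon>\<^sup>-\<^sup>2\<close>. Dividing the matrix coordinates by
  factorials identifies \<open>V\<close> with \<open>\<complex>[X, Y]/(X\<^bsup>l\<^sub>1+1\<^esup>, Y\<^bsup>l\<^sub>2+1\<^esup>)\<close>, on which \<open>u \<in> O\<^sub>F\<close> acts as multiplication by
  \<open>exp(u X + u' Y)\<close>. Koszul cohomology of this ring shows that \<open>H\<^sup>2(O\<^sub>F, V)\<close> is one-dimensional, detected
  by the constant coefficient of \<open>f(1, \<omega>) - f(\<omega>, 1)\<close>, and that \<open>H\<^sup>1(O\<^sub>F, V)\<close> is spanned by two classes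
  on which \<open>\<epsilon>\<close> acts with eigenvalues of absolute value \<open>\<epsilon>\<^bsup>l\<^sub>1+l\<^sub>2+2\<^esup>\<close> and its inverse. Hence every cocycle of
  \<open>P\<close> with vanishing invariant splits: the extension it defines is split over \<open>O\<^sub>F\<close>, and the lift can be
  corrected to be normalised by a lift of \<open>\<epsilon>\<close>. The invariant is multiplied by \<open>\<epsilon>\<^bsup>l\<^sub>1\<^esup> \<epsilon>'\<^bsup>l\<^sub>2\<^esup>\<close> under
  conjugation by \<open>\<epsilon>\<close>, so it vanishes unless this number is \<open>1\<close>; if it is \<open>1\<close>, a cup product of two
  crossed homomorphisms has nonzero invariant.
\<close>

hide_const (open) Multiset.mult

section \<open>Power series in two variables\<close>

text \<open>In effect this is the spectral sequence of the extension of \<open_removed>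

  The fragment above is a slip; this is the complete reply.\<close>

abbreviation coeff2 :: "complex fps fps \<Rightarrow> nat \<Rightarrow> nat \<Rightarrow> complex" where
  "coeff2 v i j \<equiv> fps_nth (fps_nth v i) j"

lemma coeff2_eqI: "(\<And>i j. coeff2 v i j = coeff2 w i j) \<Longrightarrow> v = w"
  by (simp add: fps_eq_iff)

lemma coeff2_mult:
  "coeff2 (v * w) i j = (\<Sum>p\<le>i. \<Sum>q\<le>j. coeff2 v p q * coeff2 w (i - p) (j - q))"
  by (simp add: fps_mult_nth fps_sum_nth atLeast0AtMost)

text \<open>The outer variable is X, the inner one Y. A series in one variable becomes a series in X
  by \<open>lift_fps\<close> and a series in Y by \<open>fps_const\<close>.\<close>

definition lift_fps :: "complex fps \<Rightarrow> complex fps fps" where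
  "lift_fps f = Abs_fps (\<lambda>i. fps_const (fps_nth f i))"

lemma lift_fps_mult: "lift_fps (f * g) = lift_fps f * lift_fps g"
proof (rule fps_ext)
  fix n
  have "(\<Sum>i\<in>I. fps_const (h i)) = fps_const (\<Sum>i\<in>I. h i)" for I :: "nat set" and h :: "nat \<Rightarrow> complex"
    by (rule fps_ext) (simp add: fps_sum_nth fps_const_def if_distrib cong: if_cong)
  thus "fps_nth (lift_fps (f * g)) n = fps_nth (lift_fps f * lift_fps g) n"
    by (simp add: lift_fps_def fps_mult_nth)
qed

lemma lift_fps_add: "lift_fps (f + g) = lift_fps f + lift_fps g"
  by (rule fps_ext) (simp add: lift_fps_def)

lemma lift_fps_1: "lift_fps 1 = 1"
  by (rule coeff2_eqI) (simp add: lift_fps_def)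

lemma lift_fps_X: "lift_fps fps_X = fps_X"
  by (rule coeff2_eqI) (simp add: lift_fps_def fps_X_def)

lemma coeff2_lift_fps: "coeff2 (lift_fps f) i j = (if j = 0 then fps_nth f i else 0)"
  by (simp add: lift_fps_def)

lemma coeff2_lift_mult_const:
  "coeff2 (lift_fps f * fps_const g) i j = fps_nth f i * fps_nth g j"
  by (simp add: lift_fps_def)

text \<open>The constant term in X is a series in Y with nonzero constant term, hence a unit; a
  series over a commutative ring whose constant term is a unit is itself one.\<close>

lemma fps_fps_unit:
  fixes v :: "complex fps fps"
  assumes "coeff2 v 0 0 \<noteq> 0"
  obtains w where "v * w = 1"
proof -
  have "fps_nth v 0 * inverse (fps_nth v 0) = 1"
    using assms by (simp add: inverse_mult_eq_1')
  from fps_right_inverse[OF this] that show ?thesis by blast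
qed

text \<open>This is \<open>(exp (x T) - 1) / T\<close>, the integral of \<open>exp (s T)\<close> over \<open>0 \<le> s \<le> x\<close>.\<close>

definition fps_expint :: "complex \<Rightarrow> complex fps" where
  "fps_expint x = Abs_fps (\<lambda>i. x ^ Suc i / fact (Suc i))"

lemma fps_exp_expint: "fps_exp x = 1 + fps_X * fps_expint x"
proof (rule fps_ext)
  fix n show "fps_nth (fps_exp x) n = fps_nth (1 + fps_X * fps_expint x) n"
    by (cases n) (simp_all add: fps_expint_def algebra_simps)
qed

text \<open>The integral is split at x, which makes \<open>fps_expint\<close> a crossed homomorphism
  for multiplication by \<open>fps_exp\<close>. The factor \<open>fps_X\<close> is cancelled at the
  end, as only the untruncated ring allows.\<close>

lemma fps_expint_add: "fps_expint (x + y) = fps_expint x + fps_exp x * fps_expint y"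
proof -
  have "fps_X * fps_expint (x + y) = fps_exp x * fps_exp y - 1"
    using fps_exp_expint[of "x + y"] by (simp add: fps_exp_add_mult)
  also have "\<dots> = fps_exp x * (1 + fps_X * fps_expint y) - 1"
    by (subst (2) fps_exp_expint) simp
  also have "\<dots> = (fps_exp x - 1) + fps_X * (fps_exp x * fps_expint y)"
    by (simp add: algebra_simps)
  also have "fps_exp x - 1 = fps_X * fps_expint x"
    by (simp add: fps_exp_expint)
  finally have "fps_X * fps_expint (x + y) = fps_X * (fps_expint x + fps_exp x * fps_expint y)"
    by (simp add: algebra_simps)
  thus ?thesis by simp
qed

section \<open>Exponentials in X and Y and rescaling of the variables\<close>

definition exp2 :: "complex \<Rightarrow> complex \<Rightarrow> complex fps fps" where
  "exp2 x y = lift_fps (fps_exp x) * fps_const (fps_exp y)"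

lemma exp2_0: "exp2 0 0 = 1"
  by (simp add: exp2_def lift_fps_1)

lemma exp2_add: "exp2 (x + x') (y + y') = exp2 x y * exp2 x' y'"
  by (simp add: exp2_def fps_exp_add_mult lift_fps_mult fps_const_mult[symmetric] mult_ac
           del: fps_const_mult)

lemma coeff2_exp2: "coeff2 (exp2 x y) i j = x ^ i / fact i * (y ^ j / fact j)"
  unfolding exp2_def coeff2_lift_mult_const by simp

text \<open>The substitution of c X for X and d Y for Y; up to a scalar, diagonal matrices act in
  this way.\<close>

definition scale2 :: "complex \<Rightarrow> complex \<Rightarrow> complex fps fps \<Rightarrow> complex fps fps" where
  "scale2 c d v = Abs_fps (\<lambda>i. Abs_fps (\<lambda>j. c ^ i * d ^ j * coeff2 v i j))"

lemma coeff2_scale2: "coeff2 (scale2 c d v) i j = c ^ i * d ^ j * coeff2 v i j"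
  by (simp add: scale2_def)

lemma scale2_add: "scale2 c d (v + w) = scale2 c d v + scale2 c d w"
  by (rule coeff2_eqI) (simp add: coeff2_scale2 algebra_simps)

lemma scale2_mult: "scale2 c d (v * w) = scale2 c d v * scale2 c d w"
proof (rule coeff2_eqI)
  fix i j
  have "c ^ i * d ^ j * (coeff2 v p q * coeff2 w (i - p) (j - q)) =
      (c ^ p * d ^ q * coeff2 v p q) * (c ^ (i - p) * d ^ (j - q) * coeff2 w (i - p) (j - q))"
    if "p \<le> i" "q \<le> j" for p q
  proof -
    have "c ^ i = c ^ p * c ^ (i - p)" "d ^ j = d ^ q * d ^ (j - q)"
      using that by (simp_all flip: power_add)
    thus ?thesis by (simp add: mult_ac)
  qed
  thus "coeff2 (scale2 c d (v * w)) i j = coeff2 (scale2 c d v * scale2 c d w) i j"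
    unfolding coeff2_scale2 coeff2_mult sum_distrib_left by (intro sum.cong refl) simp
qed

lemma scale2_scale2: "scale2 c d (scale2 c' d' v) = scale2 (c * c') (d * d') v"
  by (rule coeff2_eqI) (simp add: coeff2_scale2 power_mult_distrib mult_ac)

lemma scale2_1: "scale2 1 1 v = v"
  by (rule coeff2_eqI) (simp add: coeff2_scale2)

lemma scale2_exp2: "scale2 c d (exp2 x y) = exp2 (c * x) (d * y)"
  by (rule coeff2_eqI) (simp add: coeff2_scale2 coeff2_exp2 power_mult_distrib)

abbreviation const2 :: "complex \<Rightarrow> complex fps fps" where
  "const2 k \<equiv> fps_const (fps_const k)"

lemma scale2_const2: "scale2 c d (const2 k) = const2 k"
  by (rule coeff2_eqI) (simp add: coeff2_scale2)

text \<open>The denominator X of (exp(x X) - 1) / X becomes c X, and the scalar in front compensates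
  for it. This is the source of the \<open>+ 1\<close> in the exponents of \<open>eigen1\<close> and
  \<open>eigen2\<close>.\<close>

lemma scale2_lift_expint:
  "const2 c * scale2 c d (lift_fps (fps_expint x)) = lift_fps (fps_expint (c * x))"
  by (rule coeff2_eqI)
     (simp add: coeff2_scale2 coeff2_lift_fps fps_expint_def power_mult_distrib mult_ac)

lemma scale2_const_expint:
  "const2 d * scale2 c d (fps_const (fps_expint x)) = fps_const (fps_expint (d * x))"
  by (rule coeff2_eqI) (simp add: coeff2_scale2 fps_expint_def power_mult_distrib mult_ac)

lemma scale2_X: "scale2 c d (fps_X ^ n) = const2 (c ^ n) * fps_X ^ n"
  by (rule coeff2_eqI) (simp add: coeff2_scale2 fps_X_power_nth)

lemma scale2_Y: "scale2 c d (fps_const (fps_X ^ n)) = const2 (d ^ n) * fps_const (fps_X ^ n)"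
  by (rule coeff2_eqI) (simp add: coeff2_scale2 fps_X_power_nth del: fps_const_mult)

subsection \<open>Truncation\<close>

text \<open>The quotient by the ideal generated by X^(m+1) and Y^(n+1) is handled through normal
  forms: \<open>trunc2\<close> computes them and \<open>box\<close> collects them.\<close>

definition trunc2 :: "nat \<Rightarrow> nat \<Rightarrow> complex fps fps \<Rightarrow> complex fps fps" where
  "trunc2 m n v = Abs_fps (\<lambda>i. Abs_fps (\<lambda>j. if i \<le> m \<and> j \<le> n then coeff2 v i j else 0))"

definition box :: "nat \<Rightarrow> nat \<Rightarrow> complex fps fps set" where
  "box m n = range (trunc2 m n)"

lemma coeff2_trunc2: "coeff2 (trunc2 m n v) i j = (if i \<le> m \<and> j \<le> n then coeff2 v i j else 0)"
  by (simp add: trunc2_def)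

lemma trunc2_in_box [simp]: "trunc2 m n v \<in> box m n"
  by (simp add: box_def)

lemma trunc2_idem [simp]: "trunc2 m n (trunc2 m n v) = trunc2 m n v"
  by (rule coeff2_eqI) (simp add: coeff2_trunc2)

lemma box_trunc2: "v \<in> box m n \<Longrightarrow> trunc2 m n v = v"
  by (auto simp: box_def)

lemma box_iff: "v \<in> box m n \<longleftrightarrow> (\<forall>i j. \<not> (i \<le> m \<and> j \<le> n) \<longrightarrow> coeff2 v i j = 0)"
proof
  show "\<forall>i j. \<not> (i \<le> m \<and> j \<le> n) \<longrightarrow> coeff2 v i j = 0" if "v \<in> box m n"
    using that by (auto simp: box_def coeff2_trunc2)
  assume "\<forall>i j. \<not> (i \<le> m \<and> j \<le> n) \<longrightarrow> coeff2 v i j = 0"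
  hence "v = trunc2 m n v" by (intro coeff2_eqI) (auto simp: coeff2_trunc2)
  thus "v \<in> box m n" by (metis trunc2_in_box)
qed

lemma trunc2_eq_iff:
  "trunc2 m n v = trunc2 m n w \<longleftrightarrow> (\<forall>i\<le>m. \<forall>j\<le>n. coeff2 v i j = coeff2 w i j)"
proof
  show "\<forall>i\<le>m. \<forall>j\<le>n. coeff2 v i j = coeff2 w i j" if "trunc2 m n v = trunc2 m n w"
    using that by (metis coeff2_trunc2)
qed (auto intro!: coeff2_eqI simp: coeff2_trunc2)

lemma trunc2_add: "trunc2 m n (v + w) = trunc2 m n v + trunc2 m n w"
  by (rule coeff2_eqI) (simp add: coeff2_trunc2)

lemma trunc2_diff: "trunc2 m n (v - w) = trunc2 m n v - trunc2 m n w"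
  by (rule coeff2_eqI) (simp add: coeff2_trunc2)

lemma trunc2_0 [simp]: "trunc2 m n 0 = 0"
  by (rule coeff2_eqI) (simp add: coeff2_trunc2)

text \<open>A coefficient of a product involves only coefficients of at most its own bidegree, so
  the discarded series form an ideal.\<close>

lemma trunc2_mult: "trunc2 m n (v * trunc2 m n w) = trunc2 m n (v * w)"
  by (auto simp: trunc2_eq_iff coeff2_mult coeff2_trunc2 intro!: sum.cong)

lemma trunc2_mult_cong: "trunc2 m n w = trunc2 m n w' \<Longrightarrow> trunc2 m n (v * w) = trunc2 m n (v * w')"
  by (metis trunc2_mult)

lemma scale2_trunc2: "scale2 c d (trunc2 m n v) = trunc2 m n (scale2 c d v)"
  by (rule coeff2_eqI) (simp add: coeff2_trunc2 coeff2_scale2)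

subsection \<open>Koszul cohomology of the truncated ring\<close>

lemma coeff2_X_mult: "coeff2 (fps_X * v) i j = (if i = 0 then 0 else coeff2 v (i - 1) j)"
  by simp

lemma coeff2_Y_mult: "coeff2 (fps_const fps_X * v) i j = (if j = 0 then 0 else coeff2 v i (j - 1))"
  by simp

text \<open>A series without constant term lies in the ideal (X, Y): all monomials divisible by X go
  into q, the pure powers of Y into p.\<close>

lemma koszul_top:
  assumes "coeff2 z 0 0 = 0"
  obtains p q where "trunc2 m n (fps_X * q - fps_const fps_X * p) = trunc2 m n z"
proof
  define q where "q = Abs_fps (\<lambda>i. fps_nth z (Suc i))"
  define p where "p = - Abs_fps (\<lambda>i. Abs_fps (\<lambda>j. if i = 0 then coeff2 z 0 (Suc j) else 0))"
  have "fps_X * q - fps_const fps_X * p = z"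
    by (rule coeff2_eqI) (use assms in \<open>auto simp: q_def p_def gr0_conv_Suc\<close>)
  thus "trunc2 m n (fps_X * q - fps_const fps_X * p) = trunc2 m n z" by simp
qed

text \<open>Without truncation p = X w and q = Y w. Truncation adds the solutions p = Y^n and q =
  X^m, since Y kills the first and X the second; they span the middle Koszul cohomology.\<close>

lemma koszul_middle:
  assumes "trunc2 m n (fps_const fps_X * p) = trunc2 m n (fps_X * q)"
  obtains w k1 k2 where
    "trunc2 m n p = trunc2 m n (fps_X * w + const2 k1 * fps_const (fps_X ^ n))"
    "trunc2 m n q = trunc2 m n (fps_const fps_X * w + const2 k2 * fps_X ^ m)"
proof
  have eq: "(if j = 0 then 0 else coeff2 p i (j - 1)) = (if i = 0 then 0 else coeff2 q (i - 1) j)"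
    if "i \<le> m" "j \<le> n" for i j
    using assms that unfolding trunc2_eq_iff coeff2_X_mult coeff2_Y_mult by blast
  \<comment> \<open>Below the top power of X, w is p / X. At i = m the product X w is truncated
    away, so p says nothing and w must be q / Y.\<close>
  define w where "w = Abs_fps (\<lambda>i. Abs_fps (\<lambda>j.
      if i < m then coeff2 p (Suc i) j else coeff2 q i (Suc j)))"
  have p0: "coeff2 p 0 j = 0" if "j < n" for j
    using eq[of 0 "Suc j"] that by simp
  have q0: "coeff2 q i 0 = 0" if "i < m" for i
    using eq[of "Suc i" 0] that by simp
  have pq: "coeff2 p (Suc i) j = coeff2 q i (Suc j)" if "i < m" "j < n" for i j
    using eq[of "Suc i" "Suc j"] that by simp
  show "trunc2 m n p = trunc2 m n (fps_X * w + const2 (coeff2 p 0 n) * fps_const (fps_X ^ n))"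
    unfolding trunc2_eq_iff
  proof (intro allI impI)
    fix i j assume "i \<le> m" "j \<le> n"
    thus "coeff2 p i j = coeff2 (fps_X * w + const2 (coeff2 p 0 n) * fps_const (fps_X ^ n)) i j"
      using p0 by (cases i) (auto simp: w_def fps_X_power_nth simp del: fps_const_mult)
  qed
  show "trunc2 m n q = trunc2 m n (fps_const fps_X * w + const2 (coeff2 q m 0) * fps_X ^ m)"
    unfolding trunc2_eq_iff
  proof (intro allI impI)
    fix i j assume "i \<le> m" "j \<le> n"
    thus "coeff2 q i j = coeff2 (fps_const fps_X * w + const2 (coeff2 q m 0) * fps_X ^ m) i j"
      using q0 pq by (cases j) (auto simp: w_def fps_X_power_nth)
  qed
qed

section \<open>Cocycles and group extensions\<close>

lemma (in group) int_pow_commutes: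
  fixes n :: int
  assumes xy: "x \<otimes> y = y \<otimes> x" and [simp]: "x \<in> carrier G" "y \<in> carrier G"
  shows "x [^] n \<otimes> y = y \<otimes> x [^] n"
proof -
  have pow: "x [^] k \<otimes> y = y \<otimes> x [^] k" for k :: nat
    using group_commutes_pow[OF xy] by simp
  have inv: "inv z \<otimes> y = y \<otimes> inv z" if zy: "z \<otimes> y = y \<otimes> z" and [simp]: "z \<in> carrier G" for z
  proof -
    have "inv z \<otimes> y = inv z \<otimes> (y \<otimes> z) \<otimes> inv z" by (simp add: m_assoc)
    also have "\<dots> = y \<otimes> inv z" unfolding zy[symmetric] by (simp flip: m_assoc)
    finally show ?thesis .
  qed
  show ?thesis
  proof (cases "n \<ge> 0")
    case True
    then obtain k where "n = int k" using nonneg_eq_int by blast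
    thus ?thesis using pow by (simp add: int_pow_int)
  next
    case False
    then obtain k where "n = - int k" by (metis int_cases2 nle_le of_nat_0_le_iff)
    thus ?thesis using inv[OF pow] by (simp add: int_pow_neg_int)
  qed
qed

locale group_rep = group G for G (structure) +
  fixes W :: "'v::ab_group_add set" and act :: "'a \<Rightarrow> 'v \<Rightarrow> 'v"
  assumes W_0 [simp]: "0 \<in> W"
    and W_add [simp]: "v \<in> W \<Longrightarrow> w \<in> W \<Longrightarrow> v + w \<in> W"
    and W_uminus [simp]: "v \<in> W \<Longrightarrow> - v \<in> W"
    and act_closed [simp]: "g \<in> carrier G \<Longrightarrow> v \<in> W \<Longrightarrow> act g v \<in> W"
    and act_add: "g \<in> carrier G \<Longrightarrow> v \<in> W \<Longrightarrow> w \<in> W \<Longrightarrow> act g (v + w) = act g v + act g w"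
    and act_mult: "g \<in> carrier G \<Longrightarrow> h \<in> carrier G \<Longrightarrow> v \<in> W \<Longrightarrow> act (g \<otimes> h) v = act g (act h v)"
    and act_one: "v \<in> W \<Longrightarrow> act \<one> v = v"
begin

lemma W_diff [simp]: "v \<in> W \<Longrightarrow> w \<in> W \<Longrightarrow> v - w \<in> W"
  using W_add[of v "- w"] by simp

lemma act_0: "g \<in> carrier G \<Longrightarrow> act g 0 = 0"
  using act_add[of g 0 0] by simp

lemma act_uminus:
  assumes "g \<in> carrier G" "v \<in> W"
  shows "act g (- v) = - act g v"
proof -
  have "act g (v + - v) = act g v + act g (- v)"
    using assms by (intro act_add) auto
  thus ?thesis using assms by (simp add: act_0 eq_neg_iff_add_eq_0 add.commute)
qed

lemma act_diff: "g \<in> carrier G \<Longrightarrow> v \<in> W \<Longrightarrow> w \<in> W \<Longrightarrow> act g (v - w) = act g v - act g w"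
  using act_add[of g v "- w"] by (simp add: act_uminus)

definition cocycle :: "('a \<Rightarrow> 'a \<Rightarrow> 'v) \<Rightarrow> bool" where
  "cocycle f \<longleftrightarrow> (\<forall>g\<in>carrier G. \<forall>h\<in>carrier G. f g h \<in> W) \<and>
     (\<forall>g\<in>carrier G. \<forall>h\<in>carrier G. \<forall>k\<in>carrier G.
        act g (f h k) + f g (h \<otimes> k) = f (g \<otimes> h) k + f g h)"

definition coboundary :: "('a \<Rightarrow> 'a \<Rightarrow> 'v) \<Rightarrow> bool" where
  "coboundary f \<longleftrightarrow> (\<exists>F. (\<forall>g\<in>carrier G. F g \<in> W) \<and>
     (\<forall>g\<in>carrier G. \<forall>h\<in>carrier G. f g h = act g (F h) - F (g \<otimes> h) + F g))"

lemma cocycle_closed: "cocycle f \<Longrightarrow> g \<in> carrier G \<Longrightarrow> h \<in> carrier G \<Longrightarrow> f g h \<in> W"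
  by (simp add: cocycle_def)

lemma cocycle_eq:
  "cocycle f \<Longrightarrow> g \<in> carrier G \<Longrightarrow> h \<in> carrier G \<Longrightarrow> k \<in> carrier G \<Longrightarrow>
     act g (f h k) + f g (h \<otimes> k) = f (g \<otimes> h) k + f g h"
  by (simp add: cocycle_def)

lemma coboundary_cocycle:
  assumes "coboundary f"
  shows "cocycle f"
proof -
  obtain F where F: "\<forall>g\<in>carrier G. F g \<in> W"
    "\<forall>g\<in>carrier G. \<forall>h\<in>carrier G. f g h = act g (F h) - F (g \<otimes> h) + F g"
    using assms unfolding coboundary_def by blast
  show ?thesis
    unfolding cocycle_def
  proof (intro conjI ballI)
    show "f g h \<in> W" if "g \<in> carrier G" "h \<in> carrier G" for g h
      using that F by simp
    show "act g (f h k) + f g (h \<otimes> k) = f (g \<otimes> h) k + f g h"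
      if "g \<in> carrier G" "h \<in> carrier G" "k \<in> carrier G" for g h k
      using that by (simp add: F act_add act_diff act_mult m_assoc)
  qed
qed

lemma cocycle_add:
  assumes f: "cocycle f" and f': "cocycle f'"
  shows "cocycle (\<lambda>g h. f g h + f' g h)"
  unfolding cocycle_def
proof (intro conjI ballI)
  show "f g h + f' g h \<in> W" if "g \<in> carrier G" "h \<in> carrier G" for g h
    using that f f' by (simp add: cocycle_closed)
  show "act g (f h k + f' h k) + (f g (h \<otimes> k) + f' g (h \<otimes> k)) =
      f (g \<otimes> h) k + f' (g \<otimes> h) k + (f g h + f' g h)"
    if ghk: "g \<in> carrier G" "h \<in> carrier G" "k \<in> carrier G" for g h k
  proof -
    have "act g (f h k + f' h k) = act g (f h k) + act g (f' h k)"
      using ghk f f' by (intro act_add cocycle_closed)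
    moreover have "act g (f h k) + f g (h \<otimes> k) + (act g (f' h k) + f' g (h \<otimes> k)) =
        f (g \<otimes> h) k + f g h + (f' (g \<otimes> h) k + f' g h)"
      by (simp only: cocycle_eq[OF f ghk] cocycle_eq[OF f' ghk])
    ultimately show ?thesis by (simp only: add_ac)
  qed
qed

text \<open>Cocycles are not assumed to be normalised, hence the unusual unit of the extension.\<close>

definition ext :: "('a \<Rightarrow> 'a \<Rightarrow> 'v) \<Rightarrow> ('v \<times> 'a) monoid" where
  "ext f = \<lparr>carrier = W \<times> carrier G,
     mult = (\<lambda>(v, g) (w, h). (v + act g w + f g h, g \<otimes> h)), one = (- f \<one> \<one>, \<one>)\<rparr>"

lemma carrier_ext: "carrier (ext f) = W \<times> carrier G"
  and mult_ext: "(v, g) \<otimes>\<^bsub>ext f\<^esub> (w, h) = (v + act g w + f g h, g \<otimes> h)"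
  and one_ext: "\<one>\<^bsub>ext f\<^esub> = (- f \<one> \<one>, \<one>)"
  by (simp_all add: ext_def)

lemma group_ext:
  assumes f: "cocycle f"
  shows "group (ext f)"
proof (rule groupI)
  note cl = cocycle_closed[OF f]
  show "x \<otimes>\<^bsub>ext f\<^esub> y \<in> carrier (ext f)" if "x \<in> carrier (ext f)" "y \<in> carrier (ext f)" for x y
    using that by (cases x; cases y) (simp add: carrier_ext mult_ext cl)
  show "\<one>\<^bsub>ext f\<^esub> \<in> carrier (ext f)"
    by (simp add: one_ext carrier_ext cl)
  show "x \<otimes>\<^bsub>ext f\<^esub> y \<otimes>\<^bsub>ext f\<^esub> z = x \<otimes>\<^bsub>ext f\<^esub> (y \<otimes>\<^bsub>ext f\<^esub> z)"
    if car: "x \<in> carrier (ext f)" "y \<in> carrier (ext f)" "z \<in> carrier (ext f)" for x y z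
  proof -
    obtain u g v h w k where xyz: "x = (u, g)" "y = (v, h)" "z = (w, k)"
      and [simp]: "u \<in> W" "v \<in> W" "w \<in> W" "g \<in> carrier G" "h \<in> carrier G" "k \<in> carrier G"
      using car by (auto simp: carrier_ext)
    have "act g (f h k) = f (g \<otimes> h) k + f g h - f g (h \<otimes> k)"
      using cocycle_eq[OF f, of g h k] by (simp add: algebra_simps)
    thus ?thesis
      by (simp add: xyz mult_ext act_add act_mult cl m_assoc algebra_simps)
  qed
  \<comment> \<open>The cocycle identity at (1, 1, g). It is what makes
    \<open>- f \<one> \<one>\<close> the first component of a left unit.\<close>
  have f1: "f \<one> g = f \<one> \<one>" if "g \<in> carrier G" for g
    using cocycle_eq[OF f, of \<one> \<one> g] that by (simp add: act_one cl)
  show "\<one>\<^bsub>ext f\<^esub> \<otimes>\<^bsub>ext f\<^esub> x = x" if "x \<in> carrier (ext f)" for x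
    using that f1[of "snd x"] by (cases x) (auto simp: carrier_ext mult_ext one_ext act_one)
  show "\<exists>y\<in>carrier (ext f). y \<otimes>\<^bsub>ext f\<^esub> x = \<one>\<^bsub>ext f\<^esub>" if car: "x \<in> carrier (ext f)" for x
  proof -
    obtain v g where x: "x = (v, g)" and [simp]: "v \<in> W" "g \<in> carrier G"
      using car by (auto simp: carrier_ext)
    show ?thesis
      by (rule bexI[of _ "(- f \<one> \<one> - act (inv g) v - f (inv g) g, inv g)"])
         (simp_all add: x mult_ext one_ext carrier_ext cl)
  qed
qed

text \<open>Multiplicativity of a section g \<mapsto> (- F g, g) is the coboundary equation for F,
  hence the sign in the definition of \<open>F\<close>.\<close>

lemma coboundary_if_split:
  assumes \<sigma>: "\<sigma> \<in> hom G (ext f)" and snd_\<sigma>: "\<And>g. g \<in> carrier G \<Longrightarrow> snd (\<sigma> g) = g"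
  shows "coboundary f"
  unfolding coboundary_def
proof (intro exI conjI ballI)
  define F where "F g = - fst (\<sigma> g)" for g
  have \<sigma>_eq: "\<sigma> g = (- F g, g)" if "g \<in> carrier G" for g
    using snd_\<sigma>[OF that] by (cases "\<sigma> g") (simp add: F_def)
  show W: "F g \<in> W" if "g \<in> carrier G" for g
  proof -
    have "\<sigma> g \<in> carrier (ext f)" using \<sigma> that by (auto simp: hom_def)
    hence "- F g \<in> W" by (simp add: \<sigma>_eq that carrier_ext)
    thus ?thesis using W_uminus[of "- F g"] by simp
  qed
  show "f g h = act g (F h) - F (g \<otimes> h) + F g" if "g \<in> carrier G" "h \<in> carrier G" for g h
    using Group.hom_mult[OF \<sigma> that] that by (simp add: \<sigma>_eq mult_ext act_uminus W algebra_simps)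
qed

lemma snd_ext_int_pow:
  assumes f: "cocycle f" and x: "x \<in> carrier (ext f)"
  shows "snd (x [^]\<^bsub>ext f\<^esub> (n :: int)) = snd x [^] n"
proof -
  have "snd \<in> hom (ext f) G"
    by (rule homI) (auto simp: carrier_ext mult_ext)
  thus ?thesis
    by (rule hom_int_pow[OF _ x group_ext[OF f] is_group])
qed

end

section \<open>A lattice extended by a hyperbolic automorphism\<close>

text \<open>
  The lattice \<open>U\<close> is embedded in \<open>\<real>\<^sup>2\<close> by \<open>x \<mapsto> (x, cj x)\<close>, and \<open>c\<close> acts on it with eigenvalues
  \<open>c\<close> and \<open>c\<^sup>-\<^sup>1\<close>. The last two assumptions say that this automorphism fixes no class in the first
  cohomology of \<open>U\<close> with coefficients in the representation below.
\<close>

locale lattice_rep =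
  fixes U :: "real set" and cj :: "real \<Rightarrow> real" and a b c :: real
    and \<chi> :: complex and l1 l2 :: nat
  assumes U_basis: "U = {of_int m * a + of_int n * b | m n. True}"
    and cj_add: "x \<in> U \<Longrightarrow> y \<in> U \<Longrightarrow> cj (x + y) = cj x + cj y"
    and c_nz: "c \<noteq> 0"
    and c_U: "x \<in> U \<Longrightarrow> c * x \<in> U"
    and c_U': "x \<in> U \<Longrightarrow> x / c \<in> U"
    and cj_c: "x \<in> U \<Longrightarrow> cj (c * x) = cj x / c"
    and nondeg: "a * cj b \<noteq> b * cj a"
    and \<chi>_nz: "\<chi> \<noteq> 0"
    and eigen1: "\<chi> / of_real c ^ (l2 + 1) \<noteq> 1"
    and eigen2: "\<chi> * of_real c ^ (l1 + 1) \<noteq> 1"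
begin

lemma U_a [simp]: "a \<in> U" and U_b [simp]: "b \<in> U" and U_0 [simp]: "0 \<in> U"
  unfolding U_basis
  by (rule CollectI, rule exI[of _ 1], rule exI[of _ 0], simp,
      rule CollectI, rule exI[of _ 0], rule exI[of _ 1], simp,
      rule CollectI, rule exI[of _ 0], rule exI[of _ 0], simp)

lemma U_add [simp]:
  assumes "x \<in> U" "y \<in> U"
  shows "x + y \<in> U"
proof -
  obtain m n p q where "x = of_int m * a + of_int n * b" "y = of_int p * a + of_int q * b"
    using assms by (auto simp: U_basis)
  hence "x + y = of_int (m + p) * a + of_int (n + q) * b" by (simp add: algebra_simps)
  thus ?thesis unfolding U_basis by blast
qed

lemma U_uminus [simp]:
  assumes "x \<in> U"
  shows "- x \<in> U"
proof -
  obtain m n where "x = of_int m * a + of_int n * b"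
    using assms by (auto simp: U_basis)
  hence "- x = of_int (- m) * a + of_int (- n) * b" by (simp add: algebra_simps)
  thus ?thesis unfolding U_basis by blast
qed

lemma U_diff [simp]: "x \<in> U \<Longrightarrow> y \<in> U \<Longrightarrow> x - y \<in> U"
  using U_add[of x "- y"] by simp

lemma cj_0 [simp]: "cj 0 = 0"
  using cj_add[of 0 0] by simp

lemma cj_uminus: "x \<in> U \<Longrightarrow> cj (- x) = - cj x"
  using cj_add[of x "- x"] by simp

lemma U_of_int [simp]: "x \<in> U \<Longrightarrow> of_int m * x \<in> U"
  and cj_of_int: "x \<in> U \<Longrightarrow> cj (of_int m * x) = of_int m * cj x"
proof -
  assume x: "x \<in> U"
  have nat: "of_nat k * x \<in> U \<and> cj (of_nat k * x) = of_nat k * cj x" for k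
    by (induction k) (simp_all add: x algebra_simps cj_add)
  show "of_int m * x \<in> U"
    using nat[of "nat m"] nat[of "nat (- m)"] U_uminus[of "of_nat (nat (- m)) * x"]
    by (cases "m \<ge> 0") auto
  show "cj (of_int m * x) = of_int m * cj x"
    using nat[of "nat m"] nat[of "nat (- m)"] cj_uminus[of "of_nat (nat (- m)) * x"]
    by (cases "m \<ge> 0") auto
qed

text \<open>As in the subgroup criterion, stability under differences yields zero, negatives, sums
  and integer multiples.\<close>

lemma lattice_induct [consumes 1, case_names a b diff]:
  assumes "u \<in> U" and Pa: "Q a" and Pb: "Q b"
    and diff: "\<And>x y. x \<in> U \<Longrightarrow> y \<in> U \<Longrightarrow> Q x \<Longrightarrow> Q y \<Longrightarrow> Q (x - y)"
  shows "Q u"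
proof -
  have 0: "Q 0" using diff[of a a] Pa by simp
  have neg: "Q (- x)" if "x \<in> U" "Q x" for x
    using diff[of 0 x] 0 that by simp
  have add: "Q (x + y)" if "x \<in> U" "y \<in> U" "Q x" "Q y" for x y
    using diff[of x "- y"] neg[of y] that by simp
  have mult: "Q (of_int m * x)" if x: "x \<in> U" "Q x" for m x
  proof -
    have nat: "Q (of_int (int k) * x)" for k
    proof (induction k)
      case (Suc k)
      have "Q (of_int (int k) * x + x)" using Suc x by (intro add U_of_int) simp_all
      thus ?case by (simp add: algebra_simps)
    qed (simp add: 0)
    show ?thesis
    proof (cases "m \<ge> 0")
      case True thus ?thesis using nat[of "nat m"] by simp
    next
      case False
      hence "Q (- (of_int (int (nat (- m))) * x))"
        using nat[of "nat (- m)"] x by (intro neg) (auto simp del: of_int_of_nat_eq)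
      thus ?thesis using False by simp
    qed
  qed
  obtain m n where "u = of_int m * a + of_int n * b"
    using assms(1) by (auto simp: U_basis)
  thus ?thesis using Pa Pb by (auto intro!: add mult)
qed

text \<open>A relation and its conjugate form a linear system with determinant a cj(b) - b cj(a), to
  which Cramer's rule applies.\<close>

lemma coords_unique:
  assumes "of_int m * a + of_int n * b = of_int p * a + of_int q * b"
  shows "m = p \<and> n = q"
proof -
  have eq: "of_int (m - p) * a + of_int (n - q) * b = 0"
    using assms by (simp add: algebra_simps)
  hence "cj (of_int (m - p) * a + of_int (n - q) * b) = 0" by simp
  hence eq': "of_int (m - p) * cj a + of_int (n - q) * cj b = 0"
    by (simp add: cj_add cj_of_int del: of_int_diff)
  have "of_int (m - p) * (a * cj b - b * cj a) =
      cj b * (of_int (m - p) * a + of_int (n - q) * b) - b * (of_int (m - p) * cj a + of_int (n - q) * cj b)"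
    "of_int (n - q) * (a * cj b - b * cj a) =
      a * (of_int (m - p) * cj a + of_int (n - q) * cj b) - cj a * (of_int (m - p) * a + of_int (n - q) * b)"
    by (simp_all add: algebra_simps)
  hence "of_int (m - p) * (a * cj b - b * cj a) = 0" "of_int (n - q) * (a * cj b - b * cj a) = 0"
    by (simp_all only: eq eq')
  thus ?thesis using nondeg by (auto simp del: of_int_diff)
qed

text \<open>U is free abelian on a and b, so a commuting pair of images determines a homomorphism.
  Unique coordinates justify the definite description in its construction.\<close>

lemma lattice_hom:
  assumes "group H" "A \<in> carrier H" "B \<in> carrier H" and comm: "A \<otimes>\<^bsub>H\<^esub> B = B \<otimes>\<^bsub>H\<^esub> A"
  obtains s where "\<And>u. u \<in> U \<Longrightarrow> s u \<in> carrier H" "s a = A" "s b = B"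
    "\<And>u v. u \<in> U \<Longrightarrow> v \<in> U \<Longrightarrow> s (u + v) = s u \<otimes>\<^bsub>H\<^esub> s v"
proof -
  interpret H: group H by fact
  have "\<exists>k. \<forall>m n. k (of_int m * a + of_int n * b) = A [^]\<^bsub>H\<^esub> m \<otimes>\<^bsub>H\<^esub> B [^]\<^bsub>H\<^esub> n"
  proof -
    define k where "k u = (THE h. \<exists>m n. u = of_int m * a + of_int n * b \<and>
        h = A [^]\<^bsub>H\<^esub> (m :: int) \<otimes>\<^bsub>H\<^esub> B [^]\<^bsub>H\<^esub> (n :: int))" for u
    have "k (of_int m * a + of_int n * b) = A [^]\<^bsub>H\<^esub> m \<otimes>\<^bsub>H\<^esub> B [^]\<^bsub>H\<^esub> n" for m n
      unfolding k_def by (rule the_equality) (use coords_unique in metis)+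
    thus ?thesis by blast
  qed
  then obtain k where k: "\<And>m n. k (of_int m * a + of_int n * b) = A [^]\<^bsub>H\<^esub> m \<otimes>\<^bsub>H\<^esub> B [^]\<^bsub>H\<^esub> n"
    by blast
  have AB: "B [^]\<^bsub>H\<^esub> n \<otimes>\<^bsub>H\<^esub> A [^]\<^bsub>H\<^esub> m = A [^]\<^bsub>H\<^esub> m \<otimes>\<^bsub>H\<^esub> B [^]\<^bsub>H\<^esub> n" for m n :: int
  proof -
    have "B [^]\<^bsub>H\<^esub> n \<otimes>\<^bsub>H\<^esub> A = A \<otimes>\<^bsub>H\<^esub> B [^]\<^bsub>H\<^esub> n"
      using assms by (intro H.int_pow_commutes) simp_all
    thus ?thesis using assms by (intro H.int_pow_commutes[symmetric]) simp_all
  qed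
  show ?thesis
  proof
    show "k u \<in> carrier H" if "u \<in> U" for u
      using that k assms by (auto simp: U_basis)
    show "k a = A" "k b = B" using k[of 1 0] k[of 0 1] assms by simp_all
    show "k (u + v) = k u \<otimes>\<^bsub>H\<^esub> k v" if uvU: "u \<in> U" "v \<in> U" for u v
    proof -
      obtain m n p q where uv: "u = of_int m * a + of_int n * b" "v = of_int p * a + of_int q * b"
        using uvU by (auto simp: U_basis)
      have "u + v = of_int (m + p) * a + of_int (n + q) * b" by (simp add: uv algebra_simps)
      hence "k (u + v) = A [^]\<^bsub>H\<^esub> m \<otimes>\<^bsub>H\<^esub> A [^]\<^bsub>H\<^esub> p \<otimes>\<^bsub>H\<^esub> (B [^]\<^bsub>H\<^esub> n \<otimes>\<^bsub>H\<^esub> B [^]\<^bsub>H\<^esub> q)"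
        using assms(2,3) by (simp add: k H.int_pow_mult del: of_int_add)
      also have "\<dots> = A [^]\<^bsub>H\<^esub> m \<otimes>\<^bsub>H\<^esub> (B [^]\<^bsub>H\<^esub> n \<otimes>\<^bsub>H\<^esub> A [^]\<^bsub>H\<^esub> p) \<otimes>\<^bsub>H\<^esub> B [^]\<^bsub>H\<^esub> q"
        using assms(2,3) by (simp add: AB H.m_assoc)
      also have "\<dots> = k u \<otimes>\<^bsub>H\<^esub> k v"
        using assms(2,3) by (simp add: uv k H.m_assoc)
      finally show ?thesis .
    qed
  qed
qed

subsection \<open>The group and its representation\<close>

lemma c_powi_U [simp]: "x \<in> U \<Longrightarrow> c powi n * x \<in> U"
  and cj_c_powi: "x \<in> U \<Longrightarrow> cj (c powi n * x) = c powi (- n) * cj x"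
proof -
  have nat: "\<forall>x\<in>U. c ^ k * x \<in> U \<and> cj (c ^ k * x) = cj x / c ^ k \<and> x / c ^ k \<in> U" for k
  proof (induction k)
    case (Suc k)
    show ?case
    proof (intro ballI conjI)
      fix x assume x: "x \<in> U"
      show "c ^ Suc k * x \<in> U" using Suc c_U[OF x] by (auto simp: mult_ac)
      show "cj (c ^ Suc k * x) = cj x / c ^ Suc k"
        using Suc c_U[OF x] cj_c[OF x] by (auto simp: mult_ac)
      show "x / c ^ Suc k \<in> U" using Suc c_U'[OF x] by (auto simp: field_simps)
    qed
  qed auto
  assume x: "x \<in> U"
  have "c powi n * x \<in> U \<and> cj (c powi n * x) = c powi (- n) * cj x"
  proof (cases "n \<ge> 0")
    case True
    then obtain k where "n = int k" using nonneg_eq_int by blast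
    thus ?thesis using nat x by (simp add: power_int_minus field_simps)
  next
    case False
    then obtain k where n: "n = - int k" by (metis int_cases2 nle_le of_nat_0_le_iff)
    have "cj (c ^ k * (x / c ^ k)) = cj (x / c ^ k) / c ^ k" using nat x by blast
    hence "cj (x / c ^ k) = c ^ k * cj x" using c_nz by (simp add: field_simps)
    thus ?thesis using nat x n by (simp add: power_int_minus field_simps)
  qed
  thus "c powi n * x \<in> U" "cj (c powi n * x) = c powi (- n) * cj x" by auto
qed

text \<open>The pair (n, x) stands for the product of the translation x and the n-th power of a
  generator t, with t x = (c x) t.\<close>

definition semi :: "(int \<times> real) monoid" where
  "semi = \<lparr>carrier = UNIV \<times> U, mult = (\<lambda>(n, x) (m, y). (n + m, x + c powi n * y)), one = (0, 0)\<rparr>"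

lemma carrier_semi: "carrier semi = UNIV \<times> U"
  and mult_semi: "(n, x) \<otimes>\<^bsub>semi\<^esub> (m, y) = (n + m, x + c powi n * y)"
  and one_semi: "\<one>\<^bsub>semi\<^esub> = (0, 0)"
  by (simp_all add: semi_def)

lemma group_semi: "group semi"
proof (rule groupI)
  show "\<exists>y\<in>carrier semi. y \<otimes>\<^bsub>semi\<^esub> x = \<one>\<^bsub>semi\<^esub>" if car: "x \<in> carrier semi" for x
  proof -
    obtain n u where "x = (n, u)" "u \<in> U" using car by (auto simp: carrier_semi)
    thus ?thesis
      by (intro bexI[of _ "(- n, - (c powi (- n) * u))"]) (simp_all add: carrier_semi mult_semi one_semi)
  qed
  show "x \<otimes>\<^bsub>semi\<^esub> y \<otimes>\<^bsub>semi\<^esub> z = x \<otimes>\<^bsub>semi\<^esub> (y \<otimes>\<^bsub>semi\<^esub> z)" for x y z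
    by (cases x; cases y; cases z) (simp add: mult_semi power_int_add c_nz algebra_simps)
qed (auto simp: carrier_semi mult_semi one_semi)

definition lexp :: "real \<Rightarrow> complex fps fps" where
  "lexp x = exp2 (of_real x) (of_real (cj x))"

text \<open>The n-th power of the generator t acts on the monomial X^i Y^j with weight (\<chi>
  c^(i-j))^n.\<close>

definition tor :: "int \<Rightarrow> complex fps fps \<Rightarrow> complex fps fps" where
  "tor n v = const2 (\<chi> powi n) * scale2 (of_real (c powi n)) (of_real (c powi (- n))) v"

definition lact :: "int \<times> real \<Rightarrow> complex fps fps \<Rightarrow> complex fps fps" where
  "lact = (\<lambda>(n, x) v. trunc2 l1 l2 (lexp x * tor n v))"

abbreviation tr :: "complex fps fps \<Rightarrow> complex fps fps" where
  "tr \<equiv> trunc2 l1 l2"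

lemma lexp_add: "x \<in> U \<Longrightarrow> y \<in> U \<Longrightarrow> lexp (x + y) = lexp x * lexp y"
  by (simp add: lexp_def cj_add exp2_add)

lemma lexp_0: "lexp 0 = 1"
  by (simp add: lexp_def exp2_0)

lemma tor_0: "tor 0 v = v"
  by (simp add: tor_def scale2_1)

lemma tor_add: "tor n (v + w) = tor n v + tor n w"
  by (simp add: tor_def scale2_add algebra_simps)

lemma tor_mult: "tor n (v * w) = scale2 (of_real (c powi n)) (of_real (c powi (- n))) v * tor n w"
  by (simp add: tor_def scale2_mult mult_ac)

lemma tor_tr: "tor n (tr v) = tr (tor n v)"
  by (rule coeff2_eqI) (simp add: tor_def coeff2_trunc2 coeff2_scale2)

lemma tor_tor: "tor n (tor m v) = tor (n + m) v"
proof -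
  have "tor n (tor m v) = const2 (\<chi> powi n) * (const2 (\<chi> powi m) *
      scale2 (of_real (c powi n * c powi m)) (of_real (c powi (- n) * c powi (- m))) v)"
    by (simp add: tor_def scale2_mult scale2_const2 scale2_scale2)
  also have "c powi (- n) * c powi (- m) = c powi (- (n + m))"
    by (subst power_int_add[symmetric]) (simp_all add: c_nz)
  also have "c powi n * c powi m = c powi (n + m)" by (simp add: power_int_add c_nz)
  finally show ?thesis
    by (simp add: tor_def power_int_add \<chi>_nz flip: mult.assoc)
qed

lemma tor_lexp: "x \<in> U \<Longrightarrow> tor n (lexp x * v) = lexp (c powi n * x) * tor n v"
  by (simp add: tor_mult lexp_def scale2_exp2 cj_c_powi)

lemma lact_lact:
  assumes "x \<in> U" "y \<in> U"
  shows "lact (n, x) (lact (m, y) v) = lact (n + m, x + c powi n * y) v"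
proof -
  have "lact (n, x) (lact (m, y) v) = tr (lexp x * tr (tor n (lexp y * tor m v)))"
    by (simp add: lact_def tor_tr)
  also have "\<dots> = tr (lexp x * (lexp (c powi n * y) * tor (n + m) v))"
    using assms by (simp add: trunc2_mult tor_lexp tor_tor)
  also have "\<dots> = lact (n + m, x + c powi n * y) v"
    using assms by (simp add: lact_def lexp_add mult.assoc)
  finally show ?thesis .
qed

sublocale rep: group_rep semi "box l1 l2" lact
proof (intro group_rep.intro group_rep_axioms.intro group_semi)
  show "0 \<in> box l1 l2" by (simp add: box_iff)
  show "v + w \<in> box l1 l2" if "v \<in> box l1 l2" "w \<in> box l1 l2" for v w
    using that by (simp_all add: box_iff)
  show "- v \<in> box l1 l2" if "v \<in> box l1 l2" for v
    using that by (simp add: box_iff)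
  show "lact g v \<in> box l1 l2" for g v by (cases g) (simp add: lact_def)
  show "lact g (v + w) = lact g v + lact g w" for g v w
    by (cases g) (simp add: lact_def tor_add algebra_simps trunc2_add)
  show "lact (g \<otimes>\<^bsub>semi\<^esub> h) v = lact g (lact h v)" if "g \<in> carrier semi" "h \<in> carrier semi" for g h v
    using that by (cases g; cases h) (auto simp: carrier_semi mult_semi lact_lact)
  show "lact \<one>\<^bsub>semi\<^esub> v = v" if "v \<in> box l1 l2" for v
    using that by (simp add: one_semi lact_def lexp_0 tor_0 box_trunc2)
qed

subsection \<open>Cohomology of the lattice\<close>

abbreviation Qx :: "real \<Rightarrow> complex fps fps" where "Qx u \<equiv> lift_fps (fps_expint (of_real u))"
abbreviation Qy :: "real \<Rightarrow> complex fps fps" where "Qy u \<equiv> fps_const (fps_expint (of_real (cj u)))"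
abbreviation Px :: "real \<Rightarrow> complex fps fps" where "Px u \<equiv> lift_fps (fps_exp (of_real u))"
abbreviation Py :: "real \<Rightarrow> complex fps fps" where "Py u \<equiv> fps_const (fps_exp (of_real (cj u)))"
abbreviation "XX \<equiv> (fps_X :: complex fps fps)"
abbreviation "YY \<equiv> (fps_const fps_X :: complex fps fps)"
abbreviation "Yn \<equiv> (fps_const (fps_X ^ l2) :: complex fps fps)"

lemma Px_eq: "Px u = 1 + XX * Qx u"
  by (subst fps_exp_expint) (simp add: lift_fps_add lift_fps_mult lift_fps_1 lift_fps_X)

lemma Py_eq: "Py u = 1 + YY * Qy u"
  by (subst fps_exp_expint) (simp add: fps_const_add[symmetric] del: fps_const_add)

lemma lexp_eq: "lexp u = Px u * Py u"
  by (simp add: lexp_def exp2_def)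

text \<open>From exp(uX + u'Y) - 1 = (exp(uX) - 1) + exp(uX) (exp(u'Y) - 1). The coefficients of X
  and Y for u = a and u = b are the rows of the matrix that changes the Koszul generators.\<close>

lemma lexp_koszul: "lexp u = 1 + (Qx u * XX + Px u * Qy u * YY)"
proof -
  have "lexp u = Px u + Px u * Qy u * YY"
    unfolding lexp_eq by (subst Py_eq) (simp add: algebra_simps del: fps_const_mult)
  thus ?thesis by (subst (asm) (1) Px_eq) (simp add: algebra_simps del: fps_const_mult)
qed

lemma lact_U: "lact (0, u) v = tr (lexp u * v)"
  by (simp add: lact_def tor_0)

lemma const2_tr: "const2 k * tr v = tr (const2 k * v)"
  by (rule coeff2_eqI) (simp add: coeff2_trunc2)

lemma lact_const2: "lact g (const2 k * v) = const2 k * lact g v"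
  by (cases g) (simp add: lact_def tor_mult scale2_const2 const2_tr mult.left_commute)

lemma lact_add: "lact g (v + w) = lact g v + lact g w"
  by (cases g) (simp add: lact_def tor_add distrib_left trunc2_add)

lemma lact_diff: "lact g (v - w) = lact g v - lact g w"
  using lact_add[of g "v - w" w] by simp

text \<open>The constant term of the determinant is a cj(b) - b cj(a), so \<open>nondeg\<close>
  makes it a unit.\<close>

lemma koszul_det_unit:
  obtains d where "(Qx a * (Px b * Qy b) - Px a * Qy a * Qx b) * d = 1"
proof -
  have "coeff2 (Qx a * (Px b * Qy b) - Px a * Qy a * Qx b) 0 0 = of_real (a * cj b - b * cj a)"
    by (simp add: lift_fps_def fps_expint_def)
  also have "\<dots> \<noteq> 0" unfolding of_real_eq_0_iff using nondeg by simp
  finally show ?thesis using that fps_fps_unit by blast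
qed

text \<open>
  The operators \<open>exp(a X + a' Y) - 1\<close> and \<open>exp(b X + b' Y) - 1\<close> are obtained from \<open>X\<close>, \<open>Y\<close> by an
  invertible matrix over the power series ring, so the two pairs have the same Koszul cohomology.
\<close>

lemma lattice_H2:
  assumes z: "coeff2 z 0 0 = 0"
  obtains p q where "p \<in> box l1 l2" "q \<in> box l1 l2"
    "lact (0, a) q - q - (lact (0, b) p - p) = tr z"
proof -
  obtain d where d: "(Qx a * (Px b * Qy b) - Px a * Qy a * Qx b) * d = 1"
    by (rule koszul_det_unit)
  have "coeff2 (d * z) 0 0 = 0" using z by simp
  then obtain p q where pq: "tr (XX * q - YY * p) = tr (d * z)"
    by (rule koszul_top)
  \<comment> \<open>Applying the matrix to (p, q) multiplies the expression X q - Y p by the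
    determinant. The division by it was made beforehand, in passing from z to d z.\<close>
  define p' where "p' = Qx a * p + Px a * Qy a * q"
  define q' where "q' = Qx b * p + Px b * Qy b * q"
  have "lact (0, a) (tr q') - tr q' - (lact (0, b) (tr p') - tr p')
      = tr (lexp a * q' - q' - (lexp b * p' - p'))"
    by (simp add: lact_U trunc2_mult trunc2_diff)
  also have "lexp a * q' - q' - (lexp b * p' - p') =
      (Qx a * (Px b * Qy b) - Px a * Qy a * Qx b) * (XX * q - YY * p)"
    unfolding p'_def q'_def lexp_koszul by (simp add: algebra_simps del: fps_const_mult)
  also have "tr \<dots> = tr ((Qx a * (Px b * Qy b) - Px a * Qy a * Qx b) * (d * z))"
    by (rule trunc2_mult_cong[OF pq])
  also have "(Qx a * (Px b * Qy b) - Px a * Qy a * Qx b) * (d * z) = z"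
    using d by (simp flip: mult.assoc)
  finally show ?thesis by (intro that[of "tr p'" "tr q'"]) simp_all
qed

text \<open>Formally the coboundary of Y^l2 / X, which is not in the ring; \<open>K2\<close> is
  likewise the coboundary of X^l1 / Y. They come from the two exceptional solutions in
  \<open>koszul_middle\<close>.\<close>

definition K1 :: "real \<Rightarrow> complex fps fps" where "K1 u = tr (Qx u * Yn)"
definition K2 :: "real \<Rightarrow> complex fps fps" where "K2 u = tr (Qy u * XX ^ l1)"

lemma tr_X_top: "tr (XX * v * (w * XX ^ l1)) = 0"
proof -
  have "XX * v * (w * XX ^ l1) = XX ^ Suc l1 * (v * w)" by (simp add: mult_ac)
  also have "tr \<dots> = 0"
    unfolding trunc2_def fps_X_power_mult_nth by (rule coeff2_eqI) simp
  finally show ?thesis .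
qed

lemma tr_Y_top: "tr (YY * v * (w * Yn)) = 0"
proof -
  have "YY * v * (w * Yn) = fps_const (fps_X ^ Suc l2) * (v * w)" by (simp add: mult_ac)
  also have "tr \<dots> = 0"
    unfolding trunc2_def fps_mult_left_const_nth fps_X_power_mult_nth by (rule coeff2_eqI) simp
  finally show ?thesis .
qed

lemma tr_Px: "tr (Px u * (w * XX ^ l1)) = tr (w * XX ^ l1)"
  by (simp only: Px_eq distrib_right trunc2_add tr_X_top) simp

lemma tr_Py: "tr (Py u * (w * Yn)) = tr (w * Yn)"
  by (simp only: Py_eq distrib_right trunc2_add tr_Y_top) simp

text \<open>On multiples of Y^l2 the factor exp(u' Y) acts trivially, so the identity reduces to the
  splitting of the integral in the variable X.\<close>

lemma K1_add: "u \<in> U \<Longrightarrow> v \<in> U \<Longrightarrow> K1 (u + v) = K1 u + lact (0, u) (K1 v)"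
proof -
  have "lact (0, u) (K1 v) = tr (Py u * (Px u * Qx v * Yn))"
    by (simp only: lact_U K1_def trunc2_mult lexp_eq) (simp only: mult_ac)
  also have "\<dots> = tr (Px u * Qx v * Yn)" by (rule tr_Py)
  finally show ?thesis
    by (simp add: K1_def fps_expint_add lift_fps_add lift_fps_mult distrib_right trunc2_add)
qed

lemma K2_add: "u \<in> U \<Longrightarrow> v \<in> U \<Longrightarrow> K2 (u + v) = K2 u + lact (0, u) (K2 v)"
proof -
  assume uv: "u \<in> U" "v \<in> U"
  have "lact (0, u) (K2 v) = tr (Px u * (Py u * Qy v * XX ^ l1))"
    by (simp only: lact_U K2_def trunc2_mult lexp_eq) (simp only: mult_ac)
  also have "\<dots> = tr (Py u * Qy v * XX ^ l1)" by (rule tr_Px)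
  finally show ?thesis using uv
    by (simp add: K2_def fps_expint_add cj_add fps_const_add[symmetric] distrib_right trunc2_add
             del: fps_const_add)
qed

lemma crossed_hom_eq:
  assumes D: "\<And>u v. u \<in> U \<Longrightarrow> v \<in> U \<Longrightarrow> D (u + v) = D u + lact (0, u) (D v)"
    and E: "\<And>u v. u \<in> U \<Longrightarrow> v \<in> U \<Longrightarrow> E (u + v) = E u + lact (0, u) (E v)"
    and "D a = E a" "D b = E b" "u \<in> U"
  shows "D u = E u"
  using assms(5)
proof (induction rule: lattice_induct)
  case (diff x y)
  have "D x = D (x - y) + lact (0, x - y) (D y)" "E x = E (x - y) + lact (0, x - y) (E y)"
    using D[of "x - y" y] E[of "x - y" y] diff(1,2) by simp_all
  thus ?case using diff by simp
qed (use assms in auto)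

text \<open>Commutativity of a and b turns the values D(a), D(b) into a Koszul cocycle for the two
  operators. It is carried to one for X and Y, solved there and carried back; agreement on a and b
  suffices.\<close>

lemma lattice_H1:
  assumes box: "\<And>u. u \<in> U \<Longrightarrow> D u \<in> box l1 l2"
    and D: "\<And>u v. u \<in> U \<Longrightarrow> v \<in> U \<Longrightarrow> D (u + v) = D u + lact (0, u) (D v)"
  obtains w k1 k2 where "w \<in> box l1 l2"
    "\<And>u. u \<in> U \<Longrightarrow> D u = lact (0, u) w - w + const2 k1 * K1 u + const2 k2 * K2 u"
proof -
  obtain d where d: "(Qx a * (Px b * Qy b) - Px a * Qy a * Qx b) * d = 1"
    by (rule koszul_det_unit)
  define p where "p = D a"
  define q where "q = D b"
  have "D (a + b) = D (b + a)" by (simp add: add.commute)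
  hence pq: "tr (lexp a * q - q) = tr (lexp b * p - p)"
    using D[of a b] D[of b a] box[of a] box[of b]
    by (simp add: p_def q_def lact_U trunc2_diff box_trunc2 algebra_simps)
  \<comment> \<open>The inverse matrix, as adjugate times inverse determinant, applied to (p,
    q).\<close>
  define p' where "p' = d * (Px b * Qy b * p - Px a * Qy a * q)"
  define q' where "q' = d * (Qx a * q - Qx b * p)"
  have "YY * p' = XX * q' + d * ((lexp b * p - p) - (lexp a * q - q))"
    unfolding p'_def q'_def lexp_koszul by (simp add: algebra_simps del: fps_const_mult)
  moreover have "tr (d * ((lexp b * p - p) - (lexp a * q - q))) = tr (d * 0)"
    by (rule trunc2_mult_cong) (simp add: trunc2_diff[of _ _ "lexp b * p - p"] pq)
  ultimately have "tr (YY * p') = tr (XX * q')" by (simp add: trunc2_add)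
  then obtain w k1 k2 where
    w: "tr p' = tr (XX * w + const2 k1 * Yn)" "tr q' = tr (YY * w + const2 k2 * XX ^ l1)"
    by (rule koszul_middle)
  have K2_Px: "K2 u = tr (Px u * Qy u * XX ^ l1)" for u
    using tr_Px[of u "Qy u"] by (simp add: K2_def mult.assoc)
  have val: "tr (Qx u * p' + Px u * Qy u * q') =
      lact (0, u) (tr w) - tr w + const2 k1 * K1 u + const2 k2 * K2 u" for u
  proof -
    have "tr (Qx u * p' + Px u * Qy u * q') =
        tr (Qx u * (XX * w + const2 k1 * Yn) + Px u * Qy u * (YY * w + const2 k2 * XX ^ l1))"
      by (simp only: trunc2_add trunc2_mult_cong[OF w(1)] trunc2_mult_cong[OF w(2)])
    also have "Qx u * (XX * w + const2 k1 * Yn) + Px u * Qy u * (YY * w + const2 k2 * XX ^ l1) =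
        lexp u * w - w + const2 k1 * (Qx u * Yn) + const2 k2 * (Px u * Qy u * XX ^ l1)"
      unfolding lexp_koszul by (simp add: algebra_simps del: fps_const_mult)
    finally show ?thesis
      by (simp only: K1_def K2_Px lact_U const2_tr trunc2_mult trunc2_add trunc2_diff)
  qed
  have *: "x = (Qx a * (Px b * Qy b) - Px a * Qy a * Qx b) * d * x" for x using d by simp
  have "Qx a * p' + Px a * Qy a * q' = p" "Qx b * p' + Px b * Qy b * q' = q"
    by (subst *[of p], simp add: p'_def q'_def algebra_simps,
        subst *[of q], simp add: p'_def q'_def algebra_simps)
  hence ab: "D a = lact (0, a) (tr w) - tr w + const2 k1 * K1 a + const2 k2 * K2 a"
    "D b = lact (0, b) (tr w) - tr w + const2 k1 * K1 b + const2 k2 * K2 b"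
    using val[of a] val[of b] box by (simp_all add: p_def q_def box_trunc2)
  have "D u = lact (0, u) (tr w) - tr w + const2 k1 * K1 u + const2 k2 * K2 u" if "u \<in> U" for u
    using D _ ab that
  proof (rule crossed_hom_eq)
    fix u v assume uv: "u \<in> U" "v \<in> U"
    have w: "lact (0, u + v) (tr w) = lact (0, u) (lact (0, v) (tr w))"
      using lact_lact[OF uv, of 0 0] by simp
    show "lact (0, u + v) (tr w) - tr w + const2 k1 * K1 (u + v) + const2 k2 * K2 (u + v) =
       lact (0, u) (tr w) - tr w + const2 k1 * K1 u + const2 k2 * K2 u +
       lact (0, u) (lact (0, v) (tr w) - tr w + const2 k1 * K1 v + const2 k2 * K2 v)"
      by (simp only: w lact_add lact_diff lact_const2 K1_add[OF uv] K2_add[OF uv])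
         (simp add: algebra_simps)
  qed
  thus ?thesis by (intro that[of "tr w"]) simp_all
qed

section \<open>Eigenvalues of the automorphism on the first cohomology of the lattice\<close>

lemma lact_t: "lact (1, 0) v = tr (const2 \<chi> * scale2 (of_real c) (of_real (inverse c)) v)"
  by (simp add: lact_def tor_def lexp_0 power_int_minus)

text \<open>The factor Y^l2 contributes c^(-l2) and the denominator X of \<open>Qx\<close> one more
  inverse c. For \<open>K2\<close> the factor X^l1 and the denominator Y contribute c^(l1+1) in the
  same way.\<close>

lemma K1_eigen: "lact (1, 0) (K1 u) = const2 (\<chi> / of_real c ^ (l2 + 1)) * K1 (c * u)"
proof -
  have "const2 \<chi> * scale2 (of_real c) (of_real (inverse c)) (Qx u * Yn) =
      const2 (\<chi> / of_real c ^ (l2 + 1)) *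
        (const2 (of_real c) * scale2 (of_real c) (of_real (inverse c)) (Qx u) * Yn)"
    using c_nz
    by (simp add: scale2_mult scale2_Y mult_ac field_simps del: fps_const_mult)
       (simp add: fps_const_mult[symmetric] mult_ac power_divide flip: mult.assoc)
  also have "const2 (of_real c) * scale2 (of_real c) (of_real (inverse c)) (Qx u) = Qx (c * u)"
    using scale2_lift_expint[of "of_real c" "of_real (inverse c)" "of_real u"] by simp
  finally show ?thesis
    by (simp only: K1_def lact_t scale2_trunc2 trunc2_mult const2_tr trunc2_idem)
qed

lemma K2_eigen:
  assumes "u \<in> U"
  shows "lact (1, 0) (K2 u) = const2 (\<chi> * of_real c ^ (l1 + 1)) * K2 (c * u)"
proof -
  have "const2 \<chi> * scale2 (of_real c) (of_real (inverse c)) (Qy u * XX ^ l1) =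
      const2 (\<chi> * of_real c ^ (l1 + 1)) *
        (const2 (of_real (inverse c)) * scale2 (of_real c) (of_real (inverse c)) (Qy u) * XX ^ l1)"
    using c_nz by (simp add: scale2_mult scale2_X mult_ac field_simps)
  also have "const2 (of_real (inverse c)) * scale2 (of_real c) (of_real (inverse c)) (Qy u) =
      Qy (c * u)"
    using scale2_const_expint[of "of_real (inverse c)" "of_real c" "of_real (cj u)"]
    by (simp add: cj_c[OF assms] field_simps)
  finally show ?thesis
    by (simp only: K2_def lact_t scale2_trunc2 trunc2_mult const2_tr trunc2_idem)
qed

subsection \<open>Splitting the extension\<close>

lemma cocycle_semi_eq:
  assumes "rep.cocycle f" "x \<in> U" "y \<in> U" "z \<in> U"
  shows "lact (n, x) (f (m, y) (k, z)) + f (n, x) (m + k, y + c powi m * z) =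
     f (n + m, x + c powi n * y) (k, z) + f (n, x) (m, y)"
  using rep.cocycle_eq[OF assms(1), of "(n, x)" "(m, y)" "(k, z)"] assms
  by (simp add: carrier_semi mult_semi)

text \<open>Lifts (p, a) and (q, b) commute iff p, q solve the Koszul equation with the defect f(b,
  a) - f(a, b) on the right. Vanishing of its constant term makes this solvable, and a commuting
  pair of lifts gives a homomorphism on U.\<close>

lemma lattice_split:
  assumes f: "rep.cocycle f" and z: "coeff2 (f (0, a) (0, b) - f (0, b) (0, a)) 0 0 = 0"
  obtains S where "\<And>u. u \<in> U \<Longrightarrow> S u \<in> box l1 l2"
    "\<And>u v. u \<in> U \<Longrightarrow> v \<in> U \<Longrightarrow> S (u + v) = S u + lact (0, u) (S v) + f (0, u) (0, v)"
proof -
  define z where "z = f (0, b) (0, a) - f (0, a) (0, b)"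
  have box: "f (0, u) (0, v) \<in> box l1 l2" if "u \<in> U" "v \<in> U" for u v
    using that by (intro rep.cocycle_closed[OF f]) (auto simp: carrier_semi)
  have tr_z: "tr z = z"
    by (intro box_trunc2) (simp add: z_def box)
  have "coeff2 z 0 0 = 0" using z by (simp add: z_def)
  then obtain p q where pq: "p \<in> box l1 l2" "q \<in> box l1 l2"
    "lact (0, a) q - q - (lact (0, b) p - p) = tr z"
    by (rule lattice_H2)
  let ?E = "rep.ext f"
  have "(p, (0, a)) \<otimes>\<^bsub>?E\<^esub> (q, (0, b)) = (q, (0, b)) \<otimes>\<^bsub>?E\<^esub> (p, (0, a))"
    using pq(3) by (simp add: rep.mult_ext mult_semi tr_z) (simp add: z_def algebra_simps)
  then obtain s where s: "\<And>u. u \<in> U \<Longrightarrow> s u \<in> carrier ?E" "s a = (p, (0, a))" "s b = (q, (0, b))"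
    "\<And>u v. u \<in> U \<Longrightarrow> v \<in> U \<Longrightarrow> s (u + v) = s u \<otimes>\<^bsub>?E\<^esub> s v"
    using lattice_hom[OF rep.group_ext[OF f], of "(p, (0, a))" "(q, (0, b))"] pq(1,2)
    by (auto simp: rep.carrier_ext carrier_semi)
  \<comment> \<open>Composed with the projection, \<open>s\<close> is a homomorphism on U; its
    values on a and b show that it is the inclusion.\<close>
  have snd_s: "snd (s u) = (0, u)" if "u \<in> U" for u
    using that
  proof (induction rule: lattice_induct)
    case (diff x y)
    obtain v n d where d: "s (x - y) = (v, (n, d))" by (metis surj_pair)
    have "snd (s x) = snd (s (x - y) \<otimes>\<^bsub>?E\<^esub> s y)"
      using s(4)[of "x - y" y] diff(1,2) by simp
    also have "\<dots> = (n, d) \<otimes>\<^bsub>semi\<^esub> snd (s y)"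
      by (cases "s y") (simp add: d rep.mult_ext)
    finally have "n = 0" "d = x - y" using diff(3,4) by (auto simp: mult_semi)
    thus ?case by (simp add: d)
  qed (simp_all add: s)
  have s_eq: "s u = (fst (s u), (0, u))" if "u \<in> U" for u
    using snd_s[OF that] by (cases "s u") simp
  show ?thesis
  proof
    show "fst (s u) \<in> box l1 l2" if "u \<in> U" for u
      using s(1)[OF that] by (cases "s u") (simp add: rep.carrier_ext)
    show "fst (s (u + v)) = fst (s u) + lact (0, u) (fst (s v)) + f (0, u) (0, v)"
      if "u \<in> U" "v \<in> U" for u v
      using s(4)[OF that] rep.mult_ext[of f "fst (s u)" "(0, u)" "fst (s v)" "(0, v)"]
      by (simp flip: s_eq add: that)
  qed
qed

lemma semi_int_pow: "(1, 0) [^]\<^bsub>semi\<^esub> (n :: int) = (n, 0)"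
proof -
  have nat: "(1, 0) [^]\<^bsub>semi\<^esub> k = (int k, 0)" for k :: nat
    by (induction k) (simp_all add: one_semi mult_semi)
  have neg: "inv\<^bsub>semi\<^esub> (n, 0) = (- n, 0)" for n
    by (rule rep.inv_equality) (simp_all add: mult_semi one_semi carrier_semi)
  show ?thesis
    by (simp add: int_pow_def2 nat neg)
qed

text \<open>The universal property of the semidirect product by an infinite cyclic group:
  compatibility with the generator T propagates to all its powers.\<close>

lemma semi_hom:
  assumes "group H" and s: "\<And>u. u \<in> U \<Longrightarrow> s u \<in> carrier H" and T: "T \<in> carrier H"
    and s_add: "\<And>u v. u \<in> U \<Longrightarrow> v \<in> U \<Longrightarrow> s (u + v) = s u \<otimes>\<^bsub>H\<^esub> s v"
    and s_T: "\<And>u. u \<in> U \<Longrightarrow> T \<otimes>\<^bsub>H\<^esub> s u = s (c * u) \<otimes>\<^bsub>H\<^esub> T"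
  shows "(\<lambda>(n, u). s u \<otimes>\<^bsub>H\<^esub> T [^]\<^bsub>H\<^esub> n) \<in> hom semi H"
proof -
  interpret H: group H by fact
  have nat: "T [^]\<^bsub>H\<^esub> k \<otimes>\<^bsub>H\<^esub> s u = s (c ^ k * u) \<otimes>\<^bsub>H\<^esub> T [^]\<^bsub>H\<^esub> k" if "u \<in> U" for k :: nat and u
    using that
  proof (induction k arbitrary: u)
    case (Suc k)
    have cU: "c ^ k * (c * u) \<in> U" using c_powi_U[of "c * u" "int k"] Suc(2) c_U by simp
    have "T [^]\<^bsub>H\<^esub> Suc k \<otimes>\<^bsub>H\<^esub> s u = T [^]\<^bsub>H\<^esub> k \<otimes>\<^bsub>H\<^esub> (T \<otimes>\<^bsub>H\<^esub> s u)"
      using T s Suc(2) by (simp add: H.m_assoc)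
    also have "\<dots> = T [^]\<^bsub>H\<^esub> k \<otimes>\<^bsub>H\<^esub> s (c * u) \<otimes>\<^bsub>H\<^esub> T"
      using T s Suc(2) c_U by (simp add: s_T H.m_assoc)
    also have "\<dots> = s (c ^ k * (c * u)) \<otimes>\<^bsub>H\<^esub> T [^]\<^bsub>H\<^esub> Suc k"
      using T s Suc c_U cU by (simp add: H.m_assoc)
    finally show ?case by (simp add: mult_ac)
  qed (simp add: s)
  have int: "T [^]\<^bsub>H\<^esub> n \<otimes>\<^bsub>H\<^esub> s u = s (c powi n * u) \<otimes>\<^bsub>H\<^esub> T [^]\<^bsub>H\<^esub> n" if u: "u \<in> U" for n :: int and u
  proof (cases "n \<ge> 0")
    case True
    then obtain k where "n = int k" using nonneg_eq_int by blast
    thus ?thesis using nat[OF u] by (simp add: int_pow_int)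
  next
    case False
    then obtain k where n: "n = - int k" by (metis int_cases2 nle_le of_nat_0_le_iff)
    define v where "v = c powi n * u"
    define t where "t = T [^]\<^bsub>H\<^esub> k"
    have v: "v \<in> U" using u by (simp add: v_def)
    have t: "t \<in> carrier H" using T by (simp add: t_def)
    have "c ^ k * v = u" using c_nz by (simp add: v_def n power_int_minus)
    hence tv: "t \<otimes>\<^bsub>H\<^esub> s v = s u \<otimes>\<^bsub>H\<^esub> t" using nat[OF v, of k] by (simp add: t_def)
    have "inv\<^bsub>H\<^esub> t \<otimes>\<^bsub>H\<^esub> s u = inv\<^bsub>H\<^esub> t \<otimes>\<^bsub>H\<^esub> (s u \<otimes>\<^bsub>H\<^esub> t) \<otimes>\<^bsub>H\<^esub> inv\<^bsub>H\<^esub> t"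
      using t s[OF u] by (simp add: H.m_assoc)
    also have "\<dots> = s v \<otimes>\<^bsub>H\<^esub> inv\<^bsub>H\<^esub> t"
      unfolding tv[symmetric] using t s[OF v] by (simp flip: H.m_assoc)
    finally show ?thesis using T by (simp add: n H.int_pow_neg_int t_def v_def)
  qed
  show ?thesis
  proof (rule homI)
    fix x y assume "x \<in> carrier semi" "y \<in> carrier semi"
    then obtain n u m v where xy: "x = (n, u)" "y = (m, v)" and uv: "u \<in> U" "v \<in> U"
      by (auto simp: carrier_semi)
    have "s u \<otimes>\<^bsub>H\<^esub> T [^]\<^bsub>H\<^esub> n \<otimes>\<^bsub>H\<^esub> (s v \<otimes>\<^bsub>H\<^esub> T [^]\<^bsub>H\<^esub> m) =
        s u \<otimes>\<^bsub>H\<^esub> (T [^]\<^bsub>H\<^esub> n \<otimes>\<^bsub>H\<^esub> s v) \<otimes>\<^bsub>H\<^esub> T [^]\<^bsub>H\<^esub> m"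
      using T s uv by (simp add: H.m_assoc)
    also have "\<dots> = s (u + c powi n * v) \<otimes>\<^bsub>H\<^esub> T [^]\<^bsub>H\<^esub> (n + m)"
      using T s uv by (simp add: int s_add H.m_assoc H.int_pow_mult)
    finally show "(case x \<otimes>\<^bsub>semi\<^esub> y of (n, u) \<Rightarrow> s u \<otimes>\<^bsub>H\<^esub> T [^]\<^bsub>H\<^esub> n) =
        (case x of (n, u) \<Rightarrow> s u \<otimes>\<^bsub>H\<^esub> T [^]\<^bsub>H\<^esub> n) \<otimes>\<^bsub>H\<^esub>
        (case y of (n, u) \<Rightarrow> s u \<otimes>\<^bsub>H\<^esub> T [^]\<^bsub>H\<^esub> n)"
      by (simp add: xy mult_semi)
  qed (use T s in \<open>auto simp: carrier_semi\<close>)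
qed

theorem cocycle_coboundary:
  assumes f: "rep.cocycle f" and z: "coeff2 (f (0, a) (0, b) - f (0, b) (0, a)) 0 0 = 0"
  shows "rep.coboundary f"
proof -
  obtain S where S: "\<And>u. u \<in> U \<Longrightarrow> S u \<in> box l1 l2"
    "\<And>u v. u \<in> U \<Longrightarrow> v \<in> U \<Longrightarrow> S (u + v) = S u + lact (0, u) (S v) + f (0, u) (0, v)"
    using lattice_split[OF f z] by blast
  have fbox: "f (n, u) (m, v) \<in> box l1 l2" if "u \<in> U" "v \<in> U" for n u m v
    using that by (intro rep.cocycle_closed[OF f]) (auto simp: carrier_semi)
  have lbox: "lact g v \<in> box l1 l2" for g v by (cases g) (simp add: lact_def)
  \<comment> \<open>With T0 = (0, t) and s(u) = (S u, u), \<open>D u\<close> is the difference of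
    the first components of T0 s(u / c) and s(u) T0, which both lie over the same group
    element.\<close>
  define D where "D u = lact (1, 0) (S (u / c)) + f (1, 0) (0, u / c) - S u - f (0, u) (1, 0)" for u
  have D_box: "D u \<in> box l1 l2" if "u \<in> U" for u
    using that by (auto simp: D_def intro!: rep.W_diff rep.W_add S fbox lbox c_U')
  have D_add: "D (u + v) = D u + lact (0, u) (D v)" if uv: "u \<in> U" "v \<in> U" for u v
  proof -
    define x where "x = u / c"
    define y where "y = v / c"
    have xy: "x \<in> U" "y \<in> U" "c * x = u" "c * y = v" "(u + v) / c = x + y"
      using uv c_U' c_nz by (auto simp: x_def y_def add_divide_distrib)
    \<comment> \<open>Here t x = u t. The three cocycle identities below belong to the triples (t,
      x, y), (u, t, y) and (u, v, t); their mixed terms cancel.\<close>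
    have "lact (1, 0) (lact (0, x) (S y)) = lact (0, u) (lact (1, 0) (S y))"
      using lact_lact[of 0 x 1 0] lact_lact[of u 0 0 1] uv xy by simp
    moreover have "lact (1, 0) (f (0, x) (0, y)) = f (1, u) (0, y) + f (1, 0) (0, x) - f (1, 0) (0, x + y)"
      using cocycle_semi_eq[OF f, of 0 x y 1 0 0] xy by (simp add: algebra_simps)
    moreover have "lact (0, u) (f (1, 0) (0, y)) = f (1, u) (0, y) + f (0, u) (1, 0) - f (0, u) (1, v)"
      using cocycle_semi_eq[OF f, of u 0 y 0 1 0] xy uv by (simp add: algebra_simps)
    moreover have "lact (0, u) (f (0, v) (1, 0)) =
        f (0, u + v) (1, 0) + f (0, u) (0, v) - f (0, u) (1, v)"
      using cocycle_semi_eq[OF f, of u v 0 0 0 1] xy uv by (simp add: algebra_simps)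
    ultimately show ?thesis
      using uv xy(1,2)
      by (simp add: D_def xy(5) x_def[symmetric] y_def[symmetric] S(2) lact_add lact_diff)
  qed
  obtain w k1 k2 where w: "w \<in> box l1 l2"
    and D: "\<And>u. u \<in> U \<Longrightarrow> D u = lact (0, u) w - w + const2 k1 * K1 u + const2 k2 * K2 u"
    using lattice_H1[OF D_box D_add] by blast
  define e1 where "e1 = \<chi> / of_real c ^ (l2 + 1)"
  define e2 where "e2 = \<chi> * of_real c ^ (l1 + 1)"
  \<comment> \<open>Replacing S by S + K changes the discrepancy D(u) by t K(u / c) - K(u). On the
    two classes this is multiplication by e - 1, hence the denominators 1 - e1 and 1 - e2.\<close>
  define K where "K u = const2 (k1 / (1 - e1)) * K1 u + const2 (k2 / (1 - e2)) * K2 u" for u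
  have K_box: "K u \<in> box l1 l2" for u
    unfolding K_def K1_def K2_def const2_tr trunc2_add[symmetric] by simp
  have K_add: "K (u + v) = K u + lact (0, u) (K v)" if "u \<in> U" "v \<in> U" for u v
    using that by (simp only: K_def K1_add K2_add lact_add lact_const2) (simp add: algebra_simps)
  have scalar: "k / (1 - e) - k / (1 - e) * e = k" if "e \<noteq> 1" for k e :: complex
  proof -
    have "k / (1 - e) * (1 - e) = k" using that by simp
    thus ?thesis by (simp only: right_diff_distrib mult_1_right)
  qed
  have K_t: "K (c * u) - lact (1, 0) (K u) = const2 k1 * K1 (c * u) + const2 k2 * K2 (c * u)"
    if "u \<in> U" for u
  proof -
    have "K (c * u) - lact (1, 0) (K u) =
        const2 (k1 / (1 - e1) - k1 / (1 - e1) * e1) * K1 (c * u) +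
        const2 (k2 / (1 - e2) - k2 / (1 - e2) * e2) * K2 (c * u)"
    proof -
      have *: "const2 (k - k * e) = const2 k - const2 k * const2 e" for k e by simp
      show ?thesis
        by (simp only: K_def lact_add lact_const2 K1_eigen K2_eigen[OF that] e1_def[symmetric]
              e2_def[symmetric] *) (simp add: algebra_simps del: fps_const_mult fps_const_sub)
    qed
    also have "k1 / (1 - e1) - k1 / (1 - e1) * e1 = k1"
      using eigen1 by (intro scalar) (simp add: e1_def)
    also have "k2 / (1 - e2) - k2 / (1 - e2) * e2 = k2"
      using eigen2 by (intro scalar) (simp add: e2_def)
    finally show ?thesis .
  qed
  define s where "s u = (S u + K u, (0 :: int, u))" for u
  \<comment> \<open>The vector w in the lift of t removes the coboundary part u w - w of D.\<close>
  define T where "T = (w, (1 :: int, 0 :: real))"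
  let ?E = "rep.ext f"
  let ?\<sigma> = "\<lambda>(n, u). s u \<otimes>\<^bsub>?E\<^esub> T [^]\<^bsub>?E\<^esub> n"
  have T: "T \<in> carrier ?E" using w by (simp add: T_def rep.carrier_ext carrier_semi)
  interpret E: group ?E by (rule rep.group_ext[OF f])
  have "?\<sigma> \<in> hom semi ?E"
  proof (rule semi_hom[OF rep.group_ext[OF f]])
    show "s u \<in> carrier ?E" if "u \<in> U" for u
      using that S K_box by (simp add: s_def rep.carrier_ext carrier_semi)
    show "s (u + v) = s u \<otimes>\<^bsub>?E\<^esub> s v" if "u \<in> U" "v \<in> U" for u v
      using that by (simp add: s_def rep.mult_ext mult_semi S K_add lact_add)
    show "T \<otimes>\<^bsub>?E\<^esub> s u = s (c * u) \<otimes>\<^bsub>?E\<^esub> T" if "u \<in> U" for u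
    proof -
      have "D (c * u) = lact (0, c * u) w - w + (K (c * u) - lact (1, 0) (K u))"
        using D[OF c_U[OF that]] K_t[OF that] by simp
      thus ?thesis using c_nz
        by (simp add: s_def T_def rep.mult_ext mult_semi lact_add D_def algebra_simps)
    qed
  qed (rule T)
  moreover have "snd (?\<sigma> g) = g" if "g \<in> carrier semi" for g
  proof -
    obtain n u where g: "g = (n, u)" by (cases g)
    have "snd (T [^]\<^bsub>?E\<^esub> n) = (n, 0)"
      using rep.snd_ext_int_pow[OF f T, of n] by (simp add: T_def semi_int_pow)
    thus ?thesis
      by (cases "T [^]\<^bsub>?E\<^esub> n") (simp add: g s_def rep.mult_ext mult_semi)
  qed
  ultimately show ?thesis by (rule rep.coboundary_if_split)
qed

subsection \<open>The invariant of a cocycle\<close>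

text \<open>The constant coefficient is an equivariant map to the one-dimensional representation on
  which U acts trivially and t acts by \<chi>.\<close>

lemma coeff2_lact_00: "coeff2 (lact (n, x) v) 0 0 = \<chi> powi n * coeff2 v 0 0"
  by (simp add: lact_def coeff2_trunc2 lexp_def coeff2_exp2 tor_def coeff2_scale2)

lemma coboundary_invariant:
  assumes "rep.coboundary f"
  shows "coeff2 (f (0, a) (0, b) - f (0, b) (0, a)) 0 0 = 0"
proof -
  obtain F where "\<forall>g\<in>carrier semi. \<forall>h\<in>carrier semi.
      f g h = lact g (F h) - F (g \<otimes>\<^bsub>semi\<^esub> h) + F g"
    using assms unfolding rep.coboundary_def by blast
  thus ?thesis by (simp add: carrier_semi mult_semi coeff2_lact_00 add.commute)
qed

text \<open>The antisymmetrised constant coefficient h is biadditive and alternating on U.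
  Multiplication by c has determinant 1, so it preserves h(a, b); conjugation by t multiplies h by
  \<chi>. For \<chi> \<noteq> 1 both hold only if h(a, b) = 0.\<close>

theorem cocycle_invariant:
  assumes f: "rep.cocycle f" and "\<chi> \<noteq> 1"
  shows "coeff2 (f (0, a) (0, b) - f (0, b) (0, a)) 0 0 = 0"
proof -
  define g where "g n x m y = coeff2 (f (n, x) (m, y)) 0 0" for n x m y
  have g: "\<chi> powi n * g m y k z + g n x (m + k) (y + c powi m * z) =
      g (n + m) (x + c powi n * y) k z + g n x m y"
    if "x \<in> U" "y \<in> U" "z \<in> U" for n x m y k z
    using arg_cong[OF cocycle_semi_eq[OF f that, of n m k], of "\<lambda>v. coeff2 v 0 0"]
    by (simp add: g_def coeff2_lact_00)
  define h where "h u v = g 0 u 0 v - g 0 v 0 u" for u v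
  have h_add: "h (u + v) w = h u w + h v w" if "u \<in> U" "v \<in> U" "w \<in> U" for u v w
  proof -
    have "g 0 (u + v) 0 w = g 0 v 0 w + g 0 u 0 (v + w) - g 0 u 0 v"
      "g 0 w 0 (u + v) = g 0 (u + w) 0 v + g 0 w 0 u - g 0 u 0 v"
      "g 0 u 0 (v + w) = g 0 (u + w) 0 v + g 0 u 0 w - g 0 w 0 v"
      using g[of u v w 0 0 0] g[of w u v 0 0 0] g[of u w v 0 0 0] that
      by (simp_all add: eq_diff_eq add_ac)
    thus ?thesis by (simp add: h_def)
  qed
  have h_anti: "h u v = - h v u" for u v by (simp add: h_def)
  have h_int: "h (of_int m * u) w = of_int m * h u w" if "u \<in> U" "w \<in> U" for m u w
  proof -
    have 0: "h 0 w = 0" using h_add[of 0 0 w] that by simp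
    have nat: "h (of_int (int k) * u) w = of_int (int k) * h u w" for k
    proof (induction k)
      case (Suc k)
      have "h (of_int (int k) * u + u) w = of_int (int k) * h u w + h u w"
        using Suc that U_of_int[of u "int k"] by (simp add: h_add)
      thus ?case by (simp add: algebra_simps)
    qed (simp add: 0)
    show ?thesis
    proof (cases "m \<ge> 0")
      case True thus ?thesis using nat[of "nat m"] by simp
    next
      case False
      thus ?thesis using nat[of "nat (- m)"] h_add[of "of_int m * u" "of_int (- m) * u" w] that 0
        by (simp add: add_eq_0_iff)
    qed
  qed
  have h_det: "h (of_int m * a + of_int n * b) (of_int p * a + of_int q * b) =
      of_int (m * q - n * p) * h a b" for m n p q
  proof -
    have h_add': "h w (u + v) = h w u + h w v" if "u \<in> U" "v \<in> U" "w \<in> U" for u v w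
      unfolding h_anti[of w] h_add[OF that] by simp
    have h_int': "h w (of_int m * u) = of_int m * h w u" if "u \<in> U" "w \<in> U" for m u w
      using h_int[OF that] by (simp add: h_anti[of _ w])
    have "h (of_int m * a + of_int n * b) (of_int p * a + of_int q * b) =
        of_int p * (of_int m * h a a + of_int n * h b a) + of_int q * (of_int m * h a b + of_int n * h b b)"
      by (simp add: h_add h_add' h_int h_int')
    moreover have "h a a = 0" "h b b = 0" by (simp_all add: h_def)
    ultimately show ?thesis by (simp add: h_anti[of b a] algebra_simps)
  qed
  obtain m n where ca: "c * a = of_int m * a + of_int n * b"
    using c_U[OF U_a] unfolding U_basis by blast
  obtain p q where cb: "c * b = of_int p * a + of_int q * b"
    using c_U[OF U_b] unfolding U_basis by blast
  \<comment> \<open>The determinant of multiplication by c is read off from the embedding in the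
    plane, where the eigenvalues are c and 1 / c.\<close>
  have "m * q - n * p = 1"
  proof -
    have cj_ab: "cj a / c = of_int m * cj a + of_int n * cj b"
      "cj b / c = of_int p * cj a + of_int q * cj b"
      using cj_c[of a] cj_c[of b] unfolding ca cb by (simp_all add: cj_add cj_of_int)
    have "of_int (m * q - n * p) * (a * cj b - b * cj a) = (c * a) * (cj b / c) - (c * b) * (cj a / c)"
      unfolding ca cb cj_ab by (simp add: algebra_simps)
    also have "\<dots> = a * cj b - b * cj a" using c_nz by simp
    finally have "of_int (m * q - n * p) * (a * cj b - b * cj a) = a * cj b - b * cj a" .
    hence "real_of_int (m * q - n * p) = 1" using nondeg by (simp del: of_int_diff of_int_mult)
    thus ?thesis by linarith
  qed
  hence "h (c * a) (c * b) = h a b" by (simp add: ca cb h_det)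
  moreover have "h (c * u) (c * v) = \<chi> * h u v" if "u \<in> U" "v \<in> U" for u v
  proof -
    \<comment> \<open>The right-hand side is symmetric in u and v, so it disappears under
      antisymmetrisation.\<close>
    have *: "\<chi> * g 0 u 0 v - g 0 (c * u) 0 (c * v) = g 1 0 0 v - g 0 (c * u) 1 0 - g 1 0 0 (u + v)
        + g 1 0 0 u - g 0 (c * v) 1 0 + g 0 (c * (u + v)) 1 0" if "u \<in> U" "v \<in> U" for u v
    proof -
      have abel: "A - J = E - G - B + D - H + I"
        if "A + B = C + D" "E + F = C + G" "H + F = I + J" for A B C D E F G H I J :: complex
      proof -
        have "A = C + D - B" "C = E + F - G" "J = H + F - I"
          using that by (simp_all only: eq_diff_eq add.commute)
        thus ?thesis by simp
      qed
      have "\<chi> * g 0 u 0 v + g 1 0 0 (u + v) = g 1 (c * u) 0 v + g 1 0 0 u"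
        "g 1 0 0 v + g 0 (c * u) 1 (c * v) = g 1 (c * u) 0 v + g 0 (c * u) 1 0"
        "g 0 (c * v) 1 0 + g 0 (c * u) 1 (c * v) = g 0 (c * (u + v)) 1 0 + g 0 (c * u) 0 (c * v)"
        using g[of 0 u v 1 0 0] g[of "c * u" 0 v 0 1 0] g[of "c * u" "c * v" 0 0 0 1] that c_U
        by (simp_all add: algebra_simps)
      thus ?thesis by (rule abel)
    qed
    have "\<chi> * g 0 u 0 v - g 0 (c * u) 0 (c * v) = \<chi> * g 0 v 0 u - g 0 (c * v) 0 (c * u)"
      unfolding *[OF that] *[OF that(2,1)] by (simp add: add.commute[of v u])
    thus ?thesis by (simp add: h_def algebra_simps)
  qed
  ultimately have "(\<chi> - 1) * h a b = 0" by (simp add: algebra_simps)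
  thus ?thesis using assms(2) by (simp add: h_def g_def)
qed

text \<open>The cup product of the crossed homomorphisms \<open>Qx\<close> and \<open>Qy\<close>,
  with values in series in X and in Y. The product rule \<alpha>(g) g\<beta>(h) explains the factor
  \<open>Py x\<close>: g acts only on the second argument. Their constant terms are u and cj(u), so
  the invariant is a cj(b) - b cj(a).\<close>

theorem cocycle_exists:
  assumes "\<chi> = 1"
  obtains f where "rep.cocycle f" "coeff2 (f (0, a) (0, b) - f (0, b) (0, a)) 0 0 \<noteq> 0"
proof
  define f :: "int \<times> real \<Rightarrow> int \<times> real \<Rightarrow> complex fps fps" where
    "f = (\<lambda>(n, x) (m, y). tr (Qx x * Py x * Qy (c powi n * y)))"
  show "rep.cocycle f"
    unfolding rep.cocycle_def carrier_semi
  proof (intro conjI ballI)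
    fix g h k :: "int \<times> real" assume "g \<in> UNIV \<times> U" "h \<in> UNIV \<times> U" "k \<in> UNIV \<times> U"
    then obtain n x m y r z where ghk: "g = (n, x)" "h = (m, y)" "k = (r, z)"
      and U: "x \<in> U" "y \<in> U" "z \<in> U" by auto
    define y' where "y' = c powi n * y"
    define z' where "z' = c powi (n + m) * z"
    have U': "y' \<in> U" "z' \<in> U" "c powi m * z \<in> U" using U by (simp_all add: y'_def z'_def)
    have nz: "of_real (c powi n) \<noteq> (0 :: complex)" using c_nz by simp
    have cc: "c powi n * c powi (- n) = 1" using c_nz by (simp add: power_int_minus)
    have zz: "c powi n * (c powi m * z) = z'" by (simp add: z'_def power_int_add c_nz)
    have "tor n (Qx y * Py y * Qy (c powi m * z)) =
        scale2 (of_real (c powi n)) (of_real (c powi (- n))) (Qx y) *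
        scale2 (of_real (c powi n)) (of_real (c powi (- n))) (Py y) *
        scale2 (of_real (c powi n)) (of_real (c powi (- n))) (Qy (c powi m * z))" (is "_ = ?A * ?B * ?C")
      unfolding tor_def by (simp add: scale2_mult assms del: fps_const_mult)
    \<comment> \<open>The crossed homomorphisms need the twists c and 1 / c of the torus action. The
      twists cancel in the product, which is why \<chi> = 1 is the right character.\<close>
    also have "\<dots> = (const2 (of_real (c powi n)) * ?A) * ?B * (const2 (of_real (c powi (- n))) * ?C)"
    proof -
      have "const2 (of_real (c powi n)) * const2 (of_real (c powi (- n))) = 1"
        by (simp only: fps_const_mult of_real_mult[symmetric] cc) simp
      moreover have "(k * A) * B * (l * C) = (k * l) * (A * B * C)" for k l A B C :: "complex fps fps"
        by (simp only: mult_ac)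
      ultimately show ?thesis by simp
    qed
    also have "const2 (of_real (c powi n)) * ?A = Qx y'"
      by (simp only: scale2_lift_expint y'_def of_real_mult)
    also have "const2 (of_real (c powi (- n))) * ?C = Qy z'"
      using U' by (simp only: scale2_const_expint cj_c_powi[OF U'(3)] zz[symmetric] of_real_mult)
    also have "?B = Py y'"
      using U by (intro coeff2_eqI) (simp add: coeff2_scale2 y'_def cj_c_powi power_mult_distrib)
    finally have act: "lact g (f h k) = tr (Px x * Py x * (Qx y' * Py y' * Qy z'))"
      by (simp add: ghk f_def lact_def tor_tr trunc2_mult lexp_eq)
    have "f (g \<otimes>\<^bsub>semi\<^esub> h) k = tr (Qx (x + y') * Py (x + y') * Qy z')"
      by (simp add: ghk f_def mult_semi y'_def z'_def)
    also have "Qx (x + y') = Qx x + Px x * Qx y'"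
      by (simp add: fps_expint_add lift_fps_add lift_fps_mult)
    also have "Py (x + y') = Py x * Py y'"
      using U U' by (simp add: cj_add fps_exp_add_mult)
    finally have gh: "f (g \<otimes>\<^bsub>semi\<^esub> h) k = tr ((Qx x + Px x * Qx y') * (Py x * Py y') * Qy z')" .
    have "f g (h \<otimes>\<^bsub>semi\<^esub> k) = tr (Qx x * Py x * Qy (y' + z'))"
      by (simp add: ghk f_def mult_semi y'_def zz[symmetric] distrib_left)
    also have "Qy (y' + z') = Qy y' + Py y' * Qy z'"
      using U' by (simp add: cj_add fps_expint_add)
    finally have hk: "f g (h \<otimes>\<^bsub>semi\<^esub> k) = tr (Qx x * Py x * (Qy y' + Py y' * Qy z'))" .
    have "f g h = tr (Qx x * Py x * Qy y')"
      by (simp add: ghk f_def y'_def)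
    thus "lact g (f h k) + f g (h \<otimes>\<^bsub>semi\<^esub> k) = f (g \<otimes>\<^bsub>semi\<^esub> h) k + f g h"
      unfolding act gh hk trunc2_add[symmetric]
      by (simp add: algebra_simps del: fps_const_mult fps_const_add flip: trunc2_add)
  qed (auto simp: f_def)
  show "coeff2 (f (0, a) (0, b) - f (0, b) (0, a)) 0 0 \<noteq> 0"
  proof -
    have "coeff2 (f (0, a) (0, b) - f (0, b) (0, a)) 0 0 = of_real (a * cj b - b * cj a)"
      by (simp add: f_def coeff2_trunc2 lift_fps_def fps_expint_def)
    also have "\<dots> \<noteq> 0" unfolding of_real_eq_0_iff using nondeg by simp
    finally show ?thesis .
  qed
qed

end

section \<open>Integers of a real quadratic field\<close>

lemma ipoly_eval:
  fixes x :: "'a :: comm_ring_1"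
  shows "poly (map_poly of_int (p + q)) x = poly (map_poly of_int p) x + poly (map_poly of_int q) x"
    and "poly (map_poly of_int (Polynomial.smult k p)) x = of_int k * poly (map_poly of_int p) x"
    and "poly (map_poly of_int (p * q)) x = poly (map_poly of_int p) x * poly (map_poly of_int q) x"
proof -
  show add: "poly (map_poly of_int (p + q)) x = poly (map_poly of_int p) x + poly (map_poly of_int q) x" for p q
    by (induction p q rule: poly_induct2) (simp_all add: map_poly_pCons algebra_simps)
  show smult: "poly (map_poly of_int (Polynomial.smult k p)) x = of_int k * poly (map_poly of_int p) x" for k p
    by (induction p) (simp_all add: map_poly_pCons algebra_simps)
  show "poly (map_poly of_int (p * q)) x = poly (map_poly of_int p) x * poly (map_poly of_int q) x"
    by (induction p) (simp_all add: map_poly_pCons add smult algebra_simps)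
qed

text \<open>A form of Gauss's lemma: the minimal primitive polynomial of an algebraic integer is monic.\<close>

lemma lead_coeff_primitive_unit:
  fixes x :: "'a :: field_char_0" and p q :: "int poly"
  assumes p: "lead_coeff p = 1" "poly (map_poly of_int p) x = 0"
    and q: "content q = 1" "poly (map_poly of_int q) x = 0"
    and minimal: "\<And>r :: int poly. degree r < degree q \<Longrightarrow> poly (map_poly of_int r) x = 0 \<Longrightarrow> r = 0"
  shows "lead_coeff q dvd 1"
proof -
  have nz: "q \<noteq> 0" using q(1) by auto
  obtain s r where sr: "pseudo_divmod p q = (s, r)" by (cases "pseudo_divmod p q")
  define k where "k = lead_coeff q ^ (Suc (degree p) - degree q)"
  have eq: "Polynomial.smult k p = q * s + r" and r: "r = 0 \<or> degree r < degree q"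
    using pseudo_divmod[OF nz sr] by (simp_all add: k_def)
  have "poly (map_poly of_int r) x = 0"
  proof -
    have "poly (map_poly of_int (Polynomial.smult k p)) x = poly (map_poly of_int (q * s + r)) x"
      by (simp add: eq)
    thus ?thesis using p q by (simp add: ipoly_eval)
  qed
  hence "r = 0" using r minimal by blast
  hence eq: "Polynomial.smult k p = q * s" using eq by simp
  have "content p dvd lead_coeff p" by (rule content_dvd_coeff)
  hence "content p = 1" using p(1) by (metis is_unit_normalize normalize_content)
  \<comment> \<open>Contents multiply and p and q are primitive, so s is divisible by k. Cancelling
    k leaves a factorisation of p, up to sign, in which the leading coefficient of q divides
    1.\<close>
  hence "content s = \<bar>k\<bar>"
    using arg_cong[OF eq, of content] q(1) by (simp add: content_mult)
  hence "Polynomial.smult k p = q * Polynomial.smult \<bar>k\<bar> (primitive_part s)"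
    using eq by (metis content_times_primitive_part)
  hence "lead_coeff (Polynomial.smult k p) = \<bar>k\<bar> * (lead_coeff q * lead_coeff (primitive_part s))"
    by (simp add: lead_coeff_mult mult_ac)
  moreover have "k \<noteq> 0" using nz by (simp add: k_def)
  ultimately have "k * (lead_coeff q * (lead_coeff (primitive_part s) * sgn k)) = k * 1"
    using p(1) abs_sgn[of k] by (simp add: mult_ac)
  hence "lead_coeff q * (lead_coeff (primitive_part s) * sgn k) = 1"
    using \<open>k \<noteq> 0\<close> mult_left_cancel by blast
  thus ?thesis by (metis dvd_triv_left)
qed

locale real_quadratic =
  fixes d :: nat
  assumes sqfree: "squarefree d" and d_gt_1: "d > 1"
begin

abbreviation rt :: real where "rt \<equiv> sqrt (real d)"

lemma rt_pos: "rt > 0" and rt_sq: "rt * rt = of_nat d" and rt_sq': "rt * (rt * x) = of_nat d * x"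
  using d_gt_1 by (simp_all flip: mult.assoc)

lemmas cj_eq = galois_conj_eq[OF sqfree d_gt_1]

lemma quad_unique:
  assumes "of_rat a + of_rat b * rt = of_rat a' + of_rat b' * rt"
  shows "a = a' \<and> b = b'"
proof -
  have "of_rat a - of_rat b * rt = of_rat a' - of_rat b' * rt"
    using arg_cong[OF assms, of "galois_conj d"] by (simp add: cj_eq)
  with assms have "of_rat b * rt = of_rat b' * rt" "(of_rat a :: real) = of_rat a'" by linarith+
  thus ?thesis using rt_pos by simp
qed

lemma quad_eq_0: "of_rat a + of_rat b * rt = 0 \<Longrightarrow> a = 0 \<and> b = 0"
  using quad_unique[of a b 0 0] by simp

text \<open>For irrational x the primitive integral multiple of T^2 - 2 a T + (a^2 - d b^2) is
  minimal for x, hence monic up to sign by Gauss's lemma, and its coefficients are the asserted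
  integers.\<close>

lemma algebraic_int_quad:
  assumes alg: "algebraic_int (of_rat a + of_rat b * rt)"
  shows "2 * a \<in> \<int> \<and> a\<^sup>2 - of_nat d * b\<^sup>2 \<in> \<int>"
proof (cases "b = 0")
  case True
  hence "(of_rat a :: real) \<in> \<int>" using rational_algebraic_int_is_int[OF alg] by simp
  then obtain k where "of_rat a = real_of_int k" by (elim Ints_cases)
  hence "a = of_int k" by (metis of_rat_eq_iff of_rat_of_int_eq)
  thus ?thesis using True by simp
next
  case False
  let ?x = "of_rat a + of_rat b * rt"
  obtain p :: "int poly" where p: "lead_coeff p = 1" "poly (map_poly of_int p) ?x = 0"
    using alg unfolding algebraic_int_altdef_ipoly by blast
  obtain A s B t where ab: "a = of_int A / of_int s" "b = of_int B / of_int t" "s > 0" "t > 0"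
    by (meson quotient_of_div quotient_of_denom_pos surj_pair)
  define N where "N = s * t"
  \<comment> \<open>The polynomial (T - a)^2 - d b^2 multiplied by the square of the common
    denominator N.\<close>
  define q0 where "q0 = [:(A * t)\<^sup>2 - int d * (B * s)\<^sup>2, - 2 * (A * t) * N, N\<^sup>2:]"
  have N: "N > 0" using ab by (simp add: N_def)
  have aN: "of_int N * a = of_int (A * t)" "of_int N * b = of_int (B * s)"
    using ab by (simp_all add: N_def)
  have q0_nz: "q0 \<noteq> 0" using N by (simp add: q0_def)
  define q where "q = primitive_part q0"
  have deg: "degree q = 2" using N by (simp add: q_def q0_def)
  have q1: "content q = 1" using q0_nz by (simp add: q_def)
  have q0_eq: "q0 = Polynomial.smult (content q0) q" by (simp add: q_def)
  have NX: "of_int N * ?x = of_int (A * t) + of_int (B * s) * rt"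
  proof -
    have "of_int N * ?x = of_rat (of_int N * a) + of_rat (of_int N * b) * rt"
      by (simp add: of_rat_mult algebra_simps)
    thus ?thesis unfolding aN by (simp add: of_rat_mult)
  qed
  have "poly (map_poly of_int q0) ?x =
      (of_int N * ?x)\<^sup>2 - 2 * of_int (A * t) * (of_int N * ?x) + (of_int (A * t))\<^sup>2 - of_nat d * (of_int (B * s))\<^sup>2"
    by (simp add: q0_def map_poly_pCons power2_eq_square algebra_simps)
  also have "\<dots> = 0"
    unfolding NX by (simp add: power2_eq_square algebra_simps rt_sq')
  finally have q0_0: "poly (map_poly of_int q0) ?x = 0" .
  have q_0: "poly (map_poly of_int q) ?x = 0"
  proof -
    have "poly (map_poly of_int q0) ?x = of_int (content q0) * poly (map_poly of_int q) ?x"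
      by (subst q0_eq) (simp only: ipoly_eval)
    thus ?thesis using q0_0 q0_nz by simp
  qed
  have "lead_coeff q dvd 1"
  proof (rule lead_coeff_primitive_unit[OF p q1 q_0])
    fix r :: "int poly" assume r: "degree r < degree q" "poly (map_poly of_int r) ?x = 0"
    have "r = [:coeff r 0, coeff r 1:]"
      using r(1) deg by (intro poly_eqI) (auto simp: coeff_pCons coeff_eq_0 split: nat.splits)
    then obtain u v where r_eq: "r = [:u, v:]" by blast
    have "of_rat (of_int u + of_int v * a) + of_rat (of_int v * b) * rt = 0"
      using r(2) by (simp add: r_eq map_poly_pCons of_rat_add of_rat_mult algebra_simps)
    from quad_eq_0[OF this] show "r = 0" using False by (auto simp: r_eq)
  qed
  define w where "w = coeff q 2"
  define u where "u = coeff q 1"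
  define v where "v = coeff q 0"
  have w: "w = 1 \<or> w = - 1" using \<open>lead_coeff q dvd 1\<close> by (simp add: w_def deg zdvd1_eq abs_eq_iff')
  have "q = [:v, u, w:]"
    using deg by (intro poly_eqI)
      (auto simp: coeff_pCons coeff_eq_0 u_def v_def w_def numeral_2_eq_2 split: nat.splits)
  hence "of_rat (of_int v + of_int u * a + of_int w * (a\<^sup>2 + of_nat d * b\<^sup>2)) +
      of_rat (of_int u * b + 2 * of_int w * a * b) * rt = 0"
    using q_0
    by (simp add: map_poly_pCons of_rat_add of_rat_mult of_rat_power power2_eq_square algebra_simps rt_sq')
  from quad_eq_0[OF this] have 1: "of_int v + of_int u * a + of_int w * (a\<^sup>2 + of_nat d * b\<^sup>2) = 0"
    and 2: "(of_int u + 2 * of_int w * a) * b = 0" by (auto simp: algebra_simps)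
  have 3: "of_int u = - 2 * of_int w * a" using 2 False by (simp add: eq_neg_iff_add_eq_0)
  hence 4: "of_int v = of_int w * (a\<^sup>2 - of_nat d * b\<^sup>2)"
    using 1 by (simp add: power2_eq_square algebra_simps)
  from w show ?thesis
  proof
    assume "w = 1"
    hence "2 * a = of_int (- u)" "a\<^sup>2 - of_nat d * b\<^sup>2 = of_int v" using 3 4 by simp_all
    thus ?thesis by (metis Ints_of_int)
  next
    assume "w = - 1"
    hence "2 * a = of_int u" "a\<^sup>2 - of_nat d * b\<^sup>2 = of_int (- v)" using 3 4 by simp_all
    thus ?thesis by (metis Ints_of_int)
  qed
qed

text \<open>For r = p / q in lowest terms q^2 divides d p^2, hence d, and squarefreeness forces q =
  1.\<close>

lemma rat_int_if_squarefree:
  fixes r :: rat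
  assumes "of_nat d * r\<^sup>2 \<in> \<int>"
  shows "r \<in> \<int>"
proof -
  obtain p q where pq: "r = of_int p / of_int q" "q > 0" "coprime p q"
    by (meson quotient_of_div quotient_of_denom_pos quotient_of_coprime surj_pair)
  obtain k where "of_nat d * r\<^sup>2 = of_int k" using assms by (elim Ints_cases)
  hence "(of_int (int d * p\<^sup>2) :: rat) = of_int (k * q\<^sup>2)"
    using pq by (simp add: field_simps)
  hence "int d * p\<^sup>2 = k * q\<^sup>2" by (simp only: of_int_eq_iff)
  hence "q\<^sup>2 dvd int d * p\<^sup>2" by simp
  moreover have "coprime (q\<^sup>2) (p\<^sup>2)" using pq(3) by (simp add: coprime_commute)
  ultimately have "q\<^sup>2 dvd int d" by (simp add: coprime_dvd_mult_left_iff)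
  hence "(nat q)\<^sup>2 dvd d" using pq(2)
    by (metis int_dvd_int_iff int_nat_eq less_imp_le of_nat_power)
  hence "nat q dvd 1" using sqfree squarefreeD by blast
  hence "q = 1" using pq(2) by simp
  thus ?thesis using pq(1) by simp
qed

text \<open>Half-integral coordinates, together with 4 | m^2 - d n^2 (integrality of the norm),
  describe the integers uniformly in the residue of d modulo 4.\<close>

definition qint :: "int \<Rightarrow> int \<Rightarrow> real" where
  "qint m n = (of_int m + of_int n * rt) / 2"

lemma ring_of_integers_iff:
  "x \<in> ring_of_integers d \<longleftrightarrow> (\<exists>m n. x = qint m n \<and> 4 dvd m\<^sup>2 - int d * n\<^sup>2)"
proof
  assume "x \<in> ring_of_integers d"
  then obtain a b where x: "x = of_rat a + of_rat b * rt" and alg: "algebraic_int x"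
    by (auto simp: ring_of_integers_def quad_field_def)
  obtain m k where m: "2 * a = of_int m" and k: "a\<^sup>2 - of_nat d * b\<^sup>2 = of_int k"
    using algebraic_int_quad[OF alg[unfolded x]] by (elim conjE Ints_cases)
  have "of_nat d * (2 * b)\<^sup>2 = (2 * a)\<^sup>2 - 4 * (a\<^sup>2 - of_nat d * b\<^sup>2)"
    by (simp add: power2_eq_square algebra_simps)
  also have "\<dots> = of_int (m\<^sup>2 - 4 * k)" unfolding m k by simp
  finally have db: "of_nat d * (2 * b)\<^sup>2 = of_int (m\<^sup>2 - 4 * k)" .
  have "2 * b \<in> \<int>" by (rule rat_int_if_squarefree) (unfold db, rule Ints_of_int)
  then obtain n where n: "2 * b = of_int n" by (elim Ints_cases)
  have "(of_int (int d * n\<^sup>2) :: rat) = of_int (m\<^sup>2 - 4 * k)" using db unfolding n by (simp only: of_int_mult of_int_of_nat_eq of_int_power)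
  hence "int d * n\<^sup>2 = m\<^sup>2 - 4 * k" by (simp only: of_int_eq_iff)
  hence "m\<^sup>2 - int d * n\<^sup>2 = 4 * k" by simp
  hence "4 dvd m\<^sup>2 - int d * n\<^sup>2" by simp
  moreover have "x = qint m n"
  proof -
    have ab: "a = of_int m / 2" "b = of_int n / 2" using m n by (simp_all add: field_simps)
    show ?thesis unfolding x ab by (simp add: qint_def of_rat_divide add_divide_distrib)
  qed
  ultimately show "\<exists>m n. x = qint m n \<and> 4 dvd m\<^sup>2 - int d * n\<^sup>2" by blast
next
  assume "\<exists>m n. x = qint m n \<and> 4 dvd m\<^sup>2 - int d * n\<^sup>2"
  then obtain m n k where x: "x = qint m n" and k: "m\<^sup>2 - int d * n\<^sup>2 = 4 * k" by (auto elim!: dvdE)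
  have "x = of_rat (of_int m / 2) + of_rat (of_int n / 2) * rt"
    by (simp add: x qint_def of_rat_divide add_divide_distrib)
  hence "x \<in> quad_field d" unfolding quad_field_def by blast
  moreover have "algebraic_int x"
  proof (rule algebraic_int.intros[of "[:of_int k, - of_int m, 1:]"])
    have "4 * real_of_int k = (of_int m)\<^sup>2 - of_nat d * (of_int n)\<^sup>2"
      using arg_cong[OF k, of real_of_int] by simp
    hence "4 * (of_int k + x * (x - of_int m)) = 0"
      unfolding x qint_def by (simp add: power2_eq_square field_simps rt_sq')
    thus "poly [:of_int k, - of_int m, 1:] x = 0" by (simp add: algebra_simps)
  qed (auto simp: coeff_pCons split: nat.splits)
  ultimately show "x \<in> ring_of_integers d" by (simp add: ring_of_integers_def)
qed

lemma cj_qint: "galois_conj d (qint m n) = qint m (- n)"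
  using cj_eq[of "of_int m / 2" "of_int n / 2"]
  by (simp add: qint_def of_rat_divide add_divide_distrib diff_divide_distrib)

lemma qint_add: "qint m n + qint p q = qint (m + p) (n + q)"
  by (simp add: qint_def field_simps)

text \<open>The hypotheses say that m has the parity of d n and p that of d q, so both numerators of
  the product are even. Divisibility by 4 is inherited through multiplicativity of the norm.\<close>

lemma qint_mult:
  assumes "4 dvd m\<^sup>2 - int d * n\<^sup>2" "4 dvd p\<^sup>2 - int d * q\<^sup>2"
  obtains r s where "qint m n * qint p q = qint r s" "qint m (- n) * qint p (- q) = qint r (- s)"
    "4 dvd r\<^sup>2 - int d * s\<^sup>2"
proof -
  have par: "even m \<longleftrightarrow> even d \<or> even n" if "4 dvd m\<^sup>2 - int d * n\<^sup>2" for m n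
  proof -
    have "2 dvd m\<^sup>2 - int d * n\<^sup>2" using that by (rule dvd_trans[rotated]) simp
    thus ?thesis by simp
  qed
  have ev: "even (m * p + int d * (n * q))" "even (m * q + n * p)"
    using par[OF assms(1)] par[OF assms(2)] by auto
  obtain r s where rs: "m * p + int d * (n * q) = 2 * r" "m * q + n * p = 2 * s"
    using ev by (elim evenE)
  have "qint m n * qint p q = (of_int (m * p + int d * (n * q)) + of_int (m * q + n * p) * rt) / 4"
    "qint m (- n) * qint p (- q) = (of_int (m * p + int d * (n * q)) - of_int (m * q + n * p) * rt) / 4"
    by (simp_all add: qint_def field_simps rt_sq')
  hence 1: "qint m n * qint p q = qint r s" "qint m (- n) * qint p (- q) = qint r (- s)"
    unfolding rs by (simp_all add: qint_def)
  have "4 * (r\<^sup>2 - int d * s\<^sup>2) = (2 * r)\<^sup>2 - int d * (2 * s)\<^sup>2" by (simp add: power2_eq_square)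
  also have "\<dots> = (m\<^sup>2 - int d * n\<^sup>2) * (p\<^sup>2 - int d * q\<^sup>2)"
    unfolding rs[symmetric] by (simp add: power2_eq_square algebra_simps)
  finally have "4 * 4 dvd 4 * (r\<^sup>2 - int d * s\<^sup>2)" using assms by (metis mult_dvd_mono)
  hence "4 dvd r\<^sup>2 - int d * s\<^sup>2" by (metis dvd_mult_cancel_left zero_neq_numeral)
  with 1 that show ?thesis by blast
qed

lemma cj_add:
  assumes "x \<in> ring_of_integers d" "y \<in> ring_of_integers d"
  shows "galois_conj d (x + y) = galois_conj d x + galois_conj d y"
  using assms by (auto simp: ring_of_integers_iff cj_qint qint_add)

lemma integers_mult: "x \<in> ring_of_integers d \<Longrightarrow> y \<in> ring_of_integers d \<Longrightarrow> x * y \<in> ring_of_integers d"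
  and cj_mult: "x \<in> ring_of_integers d \<Longrightarrow> y \<in> ring_of_integers d \<Longrightarrow>
    galois_conj d (x * y) = galois_conj d x * galois_conj d y"
proof -
  assume "x \<in> ring_of_integers d" "y \<in> ring_of_integers d"
  then obtain m n p q where xy: "x = qint m n" "y = qint p q"
    and dv: "4 dvd m\<^sup>2 - int d * n\<^sup>2" "4 dvd p\<^sup>2 - int d * q\<^sup>2" by (auto simp: ring_of_integers_iff)
  from dv obtain r s where "qint m n * qint p q = qint r s" "qint m (- n) * qint p (- q) = qint r (- s)"
    "4 dvd r\<^sup>2 - int d * s\<^sup>2" by (rule qint_mult)
  thus "x * y \<in> ring_of_integers d" "galois_conj d (x * y) = galois_conj d x * galois_conj d y"
    by (auto simp: ring_of_integers_iff xy cj_qint)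
qed

lemma cj_1: "galois_conj d 1 = 1" and integers_1: "1 \<in> ring_of_integers d"
proof -
  have 1: "1 = qint 2 0" by (simp add: qint_def)
  show "galois_conj d 1 = 1" using cj_qint[of 2 0] by (simp add: qint_def)
  show "1 \<in> ring_of_integers d" unfolding ring_of_integers_iff using 1 by (intro exI[of _ 2] exI[of _ 0]) simp
qed

text \<open>If an odd n occurs, then m^2 is congruent to d modulo 4 because odd squares are 1 there,
  and \<omega> = (m + \<surd>d) / 2 works; otherwise all coordinates are even and \<omega> =
  \<surd>d.\<close>

lemma integers_basis:
  obtains b where "ring_of_integers d = {of_int m * 1 + of_int n * b | m n. True}"
    "1 * galois_conj d b \<noteq> b * galois_conj d 1"
proof (cases "\<exists>m n. odd n \<and> 4 dvd m\<^sup>2 - int d * n\<^sup>2")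
  case True
  then obtain m n where mn: "odd n" "4 dvd m\<^sup>2 - int d * n\<^sup>2" by blast
  obtain k where n: "n = 2 * k + 1" using mn(1) by (elim oddE)
  have "m\<^sup>2 - int d = (m\<^sup>2 - int d * n\<^sup>2) + 4 * (int d * (k\<^sup>2 + k))"
    by (simp add: n power2_eq_square algebra_simps)
  hence m: "4 dvd m\<^sup>2 - int d" using mn(2) by (metis dvd_add dvd_triv_left)
  show ?thesis
  proof
    show "ring_of_integers d = {of_int i * 1 + of_int j * qint m 1 | i j. True}" (is "_ = ?R")
    proof (intro equalityI subsetI)
      fix x assume "x \<in> ring_of_integers d"
      then obtain p q where x: "x = qint p q" and pq: "4 dvd p\<^sup>2 - int d * q\<^sup>2"
        by (auto simp: ring_of_integers_iff)
      have "(p - q * m) * (p + q * m) = (p\<^sup>2 - int d * q\<^sup>2) - q\<^sup>2 * (m\<^sup>2 - int d)"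
        by (simp add: power2_eq_square algebra_simps)
      hence "4 dvd (p - q * m) * (p + q * m)" using pq m by simp
      hence "2 dvd (p - q * m) * (p + q * m)" by (rule dvd_trans[rotated]) simp
      hence "even (p - q * m)" by auto
      then obtain i where "p - q * m = 2 * i" by (elim evenE)
      hence p: "p = 2 * i + q * m" by simp
      have "x = of_int i * 1 + of_int q * qint m 1" by (simp add: x p qint_def field_simps)
      thus "x \<in> ?R" by blast
    next
      fix x assume "x \<in> ?R"
      then obtain i j where "x = of_int i * 1 + of_int j * qint m 1" by blast
      hence x: "x = qint (2 * i + j * m) j" by (simp add: qint_def field_simps)
      have "(2 * i + j * m)\<^sup>2 - int d * j\<^sup>2 = 4 * (i\<^sup>2 + i * j * m) + j\<^sup>2 * (m\<^sup>2 - int d)"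
        by (simp add: power2_eq_square algebra_simps)
      hence "4 dvd (2 * i + j * m)\<^sup>2 - int d * j\<^sup>2" using m by simp
      thus "x \<in> ring_of_integers d" unfolding ring_of_integers_iff x by blast
    qed
    show "1 * galois_conj d (qint m 1) \<noteq> qint m 1 * galois_conj d 1"
      using rt_pos unfolding cj_1 cj_qint by (simp add: qint_def)
  qed
next
  case False
  show ?thesis
  proof
    show "ring_of_integers d = {of_int i * 1 + of_int j * qint 0 2 | i j. True}" (is "_ = ?R")
    proof (intro equalityI subsetI)
      fix x assume "x \<in> ring_of_integers d"
      then obtain p q where x: "x = qint p q" and pq: "4 dvd p\<^sup>2 - int d * q\<^sup>2"
        by (auto simp: ring_of_integers_iff)
      have "even q" using False pq by blast
      then obtain j where q: "q = 2 * j" by (elim evenE)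
      have "2 dvd p\<^sup>2 - int d * q\<^sup>2" using pq by (rule dvd_trans[rotated]) simp
      hence "even p" by (simp add: q)
      then obtain i where p: "p = 2 * i" by (elim evenE)
      have "x = of_int i * 1 + of_int j * qint 0 2" by (simp add: x p q qint_def field_simps)
      thus "x \<in> ?R" by blast
    next
      fix x assume "x \<in> ?R"
      then obtain i j where "x = of_int i * 1 + of_int j * qint 0 2" by blast
      hence x: "x = qint (2 * i) (2 * j)" by (simp add: qint_def field_simps)
      have "(2 * i)\<^sup>2 - int d * (2 * j)\<^sup>2 = 4 * (i\<^sup>2 - int d * j\<^sup>2)"
        by (simp add: power2_eq_square algebra_simps)
      thus "x \<in> ring_of_integers d" unfolding ring_of_integers_iff x by (metis dvd_triv_left)
    qed
    show "1 * galois_conj d (qint 0 2) \<noteq> qint 0 2 * galois_conj d 1"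
      using rt_pos unfolding cj_1 cj_qint by (simp add: qint_def)
  qed
qed

lemma integer_unit_norm:
  assumes "t \<in> integer_units d"
  shows "\<bar>quad_norm d t\<bar> = 1"
proof -
  have norm_Ints: "quad_norm d x \<in> \<int>" if xO: "x \<in> ring_of_integers d" for x
  proof -
    obtain m n where x: "x = qint m n" and mn: "4 dvd m\<^sup>2 - int d * n\<^sup>2"
      using xO by (auto simp: ring_of_integers_iff)
    obtain k where k: "m\<^sup>2 - int d * n\<^sup>2 = 4 * k" using mn by (elim dvdE)
    have "4 * real_of_int k = (of_int m)\<^sup>2 - of_nat d * (of_int n)\<^sup>2"
      using arg_cong[OF k, of real_of_int] by simp
    hence "quad_norm d x = of_int k"
      unfolding quad_norm_def x cj_qint by (simp add: qint_def power2_eq_square field_simps rt_sq')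
    thus ?thesis by simp
  qed
  have t: "t \<in> ring_of_integers d" "inverse t \<in> ring_of_integers d" "t \<noteq> 0"
    using assms by (auto simp: integer_units_def)
  have "galois_conj d t * galois_conj d (inverse t) = 1"
    using cj_mult[OF t(1,2)] t(3) cj_1 by simp
  hence "quad_norm d t * quad_norm d (inverse t) = 1"
    using t(3) by (simp add: quad_norm_def mult_ac)
  moreover obtain i j where "quad_norm d t = of_int i" "quad_norm d (inverse t) = of_int j"
    using norm_Ints[OF t(1)] norm_Ints[OF t(2)] by (elim Ints_cases)
  ultimately have "quad_norm d t = of_int i" "i * j = 1"
    by (simp_all flip: of_int_mult add: of_int_eq_1_iff)
  thus ?thesis by (auto simp: zmult_eq_1_iff)
qed

end

section \<open>Quotients by the kernel of a linear functional\<close>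

locale module_functional = Module.module class_ring A for A :: "(complex, 'm, 'c) module_scheme" +
  fixes \<phi> :: "'m \<Rightarrow> complex"
  assumes \<phi>_add: "x \<in> carrier A \<Longrightarrow> y \<in> carrier A \<Longrightarrow> \<phi> (x \<oplus>\<^bsub>A\<^esub> y) = \<phi> x + \<phi> y"
    and \<phi>_smult: "x \<in> carrier A \<Longrightarrow> \<phi> (k \<odot>\<^bsub>A\<^esub> x) = k * \<phi> x"
begin

text \<open>Level sets are the cosets of the kernel, so computations in the quotient become
  computations with complex numbers.\<close>

definition level :: "complex \<Rightarrow> 'm set" where
  "level s = {x \<in> carrier A. \<phi> x = s}"

lemma smult_cl [simp]: "x \<in> carrier A \<Longrightarrow> k \<odot>\<^bsub>A\<^esub> x \<in> carrier A"
  by (rule smult_closed) (simp add: class_ring_simps)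

lemma \<phi>_zero: "\<phi> \<zero>\<^bsub>A\<^esub> = 0"
  using \<phi>_add[of "\<zero>\<^bsub>A\<^esub>" "\<zero>\<^bsub>A\<^esub>"] by simp

lemma \<phi>_uminus: "x \<in> carrier A \<Longrightarrow> \<phi> (\<ominus>\<^bsub>A\<^esub> x) = - \<phi> x"
  using \<phi>_add[of "\<ominus>\<^bsub>A\<^esub> x" x] by (simp add: M.l_neg \<phi>_zero eq_neg_iff_add_eq_0)

lemma set_add_level:
  assumes "x \<in> carrier A"
  shows "(\<Union>y\<in>level s. {y \<oplus>\<^bsub>A\<^esub> x}) = level (s + \<phi> x)"
proof (intro equalityI subsetI)
  fix z assume "z \<in> level (s + \<phi> x)"
  hence z: "z \<in> carrier A" "\<phi> z = s + \<phi> x" by (auto simp: level_def)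
  have "z = (z \<oplus>\<^bsub>A\<^esub> \<ominus>\<^bsub>A\<^esub> x) \<oplus>\<^bsub>A\<^esub> x"
    using z assms by (simp add: M.a_assoc M.l_neg)
  moreover have "z \<oplus>\<^bsub>A\<^esub> \<ominus>\<^bsub>A\<^esub> x \<in> level s"
    using z assms by (simp add: level_def \<phi>_add \<phi>_uminus)
  ultimately show "z \<in> (\<Union>y\<in>level s. {y \<oplus>\<^bsub>A\<^esub> x})" by blast
qed (use assms in \<open>auto simp: level_def \<phi>_add\<close>)

lemma coset_level: "x \<in> carrier A \<Longrightarrow> level 0 +>\<^bsub>A\<^esub> x = level (\<phi> x)"
  unfolding a_r_coset_def' using set_add_level[of x 0] by simp

abbreviation Q :: "(complex, 'm set) module" where
  "Q \<equiv> quotient_module A (level 0)"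

lemma carrier_Q: "carrier Q = level ` \<phi> ` carrier A"
  unfolding quotient_module_def A_RCOSETS_def' by (auto simp: coset_level)

lemma quotient_trivial:
  assumes "\<And>x. x \<in> carrier A \<Longrightarrow> \<phi> x = 0"
  shows "carrier Q = {\<zero>\<^bsub>Q\<^esub>}"
proof -
  have "\<phi> ` carrier A = {0}" using assms M.zero_closed by (auto simp: image_iff \<phi>_zero)
  thus ?thesis by (simp add: carrier_Q) (simp add: quotient_module_def)
qed

lemma quotient_dim_1:
  assumes x0: "x0 \<in> carrier A" "\<phi> x0 \<noteq> 0"
  shows "vectorspace.fin_dim class_ring Q \<and> vectorspace.dim class_ring Q = 1"
proof -
  have ex: "\<exists>x\<in>carrier A. \<phi> x = s" for s
    using x0 by (intro bexI[of _ "(s / \<phi> x0) \<odot>\<^bsub>A\<^esub> x0"]) (simp_all add: \<phi>_smult)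
  have carr: "carrier Q = range level"
    unfolding carrier_Q using ex by (metis surj_def image_eqI subsetI subset_antisym subset_UNIV image_mono)
  have zero: "\<zero>\<^bsub>Q\<^esub> = level 0" by (simp add: quotient_module_def)
  have add: "level s \<oplus>\<^bsub>Q\<^esub> level t = level (s + t)" for s t
  proof -
    have "level s \<oplus>\<^bsub>Q\<^esub> level t = (\<Union>x\<in>level t. \<Union>y\<in>level s. {y \<oplus>\<^bsub>A\<^esub> x})"
      by (auto simp: quotient_module_def set_add_def')
    also have "\<dots> = (\<Union>x\<in>level t. level (s + t))"
      by (intro SUP_cong refl, subst set_add_level) (auto simp: level_def)
    also have "\<dots> = level (s + t)" using ex[of t] by (auto simp: level_def)
    finally show ?thesis .
  qed
  have smult: "k \<odot>\<^bsub>Q\<^esub> level s = level (k * s)" for k s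
  proof -
    have "k \<odot>\<^bsub>Q\<^esub> level s = (\<Union>x\<in>level s. level (k * s))"
      unfolding quotient_module_def module.simps
      by (intro SUP_cong refl, subst coset_level) (auto simp: level_def \<phi>_smult)
    also have "\<dots> = level (k * s)" using ex[of s] by (auto simp: level_def)
    finally show ?thesis .
  qed
  \<comment> \<open>By \<open>add\<close> and \<open>smult\<close> the map s \<mapsto>
    \<open>level s\<close> respects the operations, so the module laws reduce to those of the
    complex numbers.\<close>
  have "Module.module class_ring Q"
  proof (rule moduleI)
    show "cring (class_ring :: complex ring)" by (rule R.is_cring)
    show "abelian_group Q"
    proof (rule abelian_groupI)
      show "\<exists>y\<in>carrier Q. y \<oplus>\<^bsub>Q\<^esub> x = \<zero>\<^bsub>Q\<^esub>" if x: "x \<in> carrier Q" for x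
      proof -
        obtain s where "x = level s" using x by (auto simp: carr)
        thus ?thesis by (intro bexI[of _ "level (- s)"]) (simp_all add: carr add zero)
      qed
    qed (auto simp: carr zero add add_ac)
  qed (auto simp: carr add smult class_ring_simps algebra_simps)
  hence "vectorspace class_ring Q" using class_field by (simp add: vectorspace_def)
  then interpret Q: vectorspace class_ring Q .
  have one: "{level 1} \<subseteq> carrier Q" by (auto simp: carr)
  have "level s \<in> Q.span {level 1}" for s
  proof -
    have "s \<odot>\<^bsub>Q\<^esub> level 1 \<in> Q.span {level 1}"
      using Q.span_is_submodule[OF one] Q.in_own_span[OF one]
      by (intro submodule.smult_closed) (auto simp: class_ring_simps)
    thus ?thesis by (simp add: smult)
  qed
  hence gen: "Q.gen_set {level 1}"
    using Q.span_is_subset2[OF one] by (auto simp: carr)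
  moreover have "level 1 \<noteq> \<zero>\<^bsub>Q\<^esub>"
  proof
    assume "level 1 = \<zero>\<^bsub>Q\<^esub>"
    moreover obtain x where "x \<in> level 1" using ex[of 1] by (auto simp: level_def)
    ultimately have "x \<in> level 1 \<inter> level 0" by (simp add: zero)
    thus False by (auto simp: level_def)
  qed
  ultimately have "Q.dim = 1" by (rule Q.dim1I) (use one in auto)
  moreover have "Q.fin_dim" unfolding Q.fin_dim_def using gen one by (metis finite.emptyI finite.insertI)
  ultimately show ?thesis by simp
qed

end

lemma fun_module_module:
  assumes M: "Module.module R M" and Z: "Z \<subseteq> (X \<rightarrow>\<^sub>E carrier M)"
    and zero: "(\<lambda>x\<in>X. \<zero>\<^bsub>M\<^esub>) \<in> Z"
    and add: "\<And>f g. f \<in> Z \<Longrightarrow> g \<in> Z \<Longrightarrow> (\<lambda>x\<in>X. f x \<oplus>\<^bsub>M\<^esub> g x) \<in> Z"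
    and smult: "\<And>k f. k \<in> carrier R \<Longrightarrow> f \<in> Z \<Longrightarrow> (\<lambda>x\<in>X. k \<odot>\<^bsub>M\<^esub> f x) \<in> Z"
  shows "Module.module R ((fun_module X M)\<lparr>carrier := Z\<rparr>)"
proof -
  interpret M: Module.module R M by fact
  have val: "f x \<in> carrier M" if "f \<in> Z" "x \<in> X" for f x using that Z by auto
  have ext: "f = (\<lambda>x\<in>X. f x)" if "f \<in> Z" for f
    using that Z by (auto simp: PiE_def extensional_restrict)
  let ?F = "(fun_module X M)\<lparr>carrier := Z\<rparr>"
  have simps: "carrier ?F = Z" "\<zero>\<^bsub>?F\<^esub> = (\<lambda>x\<in>X. \<zero>\<^bsub>M\<^esub>)"
    "f \<oplus>\<^bsub>?F\<^esub> g = (\<lambda>x\<in>X. f x \<oplus>\<^bsub>M\<^esub> g x)" "k \<odot>\<^bsub>?F\<^esub> f = (\<lambda>x\<in>X. k \<odot>\<^bsub>M\<^esub> f x)" for f g k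
    by (simp_all add: fun_module_def)
  show ?thesis
  proof (rule moduleI)
    show "cring R" by (rule M.R.is_cring)
    show "abelian_group ?F"
    proof (rule abelian_groupI; (unfold simps)?)
      fix f g h assume fgh: "f \<in> Z" "g \<in> Z" "h \<in> Z"
      show "(\<lambda>x\<in>X. (\<lambda>x\<in>X. f x \<oplus>\<^bsub>M\<^esub> g x) x \<oplus>\<^bsub>M\<^esub> h x) =
          (\<lambda>x\<in>X. f x \<oplus>\<^bsub>M\<^esub> (\<lambda>x\<in>X. g x \<oplus>\<^bsub>M\<^esub> h x) x)"
        using fgh by (intro restrict_ext) (simp add: val M.M.a_assoc)
    next
      fix f assume f: "f \<in> Z"
      show "(\<lambda>x\<in>X. (\<lambda>x\<in>X. \<zero>\<^bsub>M\<^esub>) x \<oplus>\<^bsub>M\<^esub> f x) = f"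
        by (subst (2) ext[OF f], intro restrict_ext) (simp add: f val)
      \<comment> \<open>The negative is taken as the multiple by -1, so that closure under scalars
        provides it.\<close>
      show "\<exists>g\<in>Z. (\<lambda>x\<in>X. g x \<oplus>\<^bsub>M\<^esub> f x) = (\<lambda>x\<in>X. \<zero>\<^bsub>M\<^esub>)"
        using f by (intro bexI[of _ "\<lambda>x\<in>X. (\<ominus>\<^bsub>R\<^esub> \<one>\<^bsub>R\<^esub>) \<odot>\<^bsub>M\<^esub> f x"] smult restrict_ext)
          (simp_all add: val M.smult_l_minus M.M.l_neg)
    qed (auto intro!: zero add restrict_ext simp: val M.M.a_comm)
    show "\<one>\<^bsub>R\<^esub> \<odot>\<^bsub>?F\<^esub> f = f" if "f \<in> carrier ?F" for f
      using that unfolding simps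
      by (subst (2) ext, assumption, intro restrict_ext) (simp add: val)
  qed (unfold simps, auto intro!: smult restrict_ext
        simp: val M.smult_l_distr M.smult_r_distr M.smult_assoc1)
qed

section \<open>The parabolic subgroup and its representation\<close>

text \<open>With the lower left entry written as t x, the exponents of t add up to (l - i) + (i - p)
  - p = l - 2 p. It depends on the column alone: the diagonal part acts before the unipotent
  one.\<close>

lemma sym_rep_lower:
  fixes t x :: complex
  assumes g: "g $$ (0,0) = t" "g $$ (0,1) = 0" "g $$ (1,0) = t * x" "g $$ (1,1) = inverse t"
    and t: "t \<noteq> 0" and ip: "i \<le> l" "p \<le> l"
  shows "sym_rep l g $$ (i, p) =
    (if p \<le> i then of_nat (i choose p) * t powi (int l - 2 * int p) * x ^ (i - p) else 0)"
proof -
  have "sym_rep l g $$ (i, p) = t ^ (l - i) * coeff ([:t * x, inverse t:] ^ i) p"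
    using ip by (simp add: sym_rep_def g[unfolded One_nat_def] poly_const_pow)
  also have "\<dots> = (if p \<le> i then of_nat (i choose p) * t powi (int l - 2 * int p) * x ^ (i - p) else 0)"
  proof (cases "p \<le> i")
    case True
    have "t ^ (l - i) * t ^ (i - p) = t ^ (l - p)"
      using True ip by (simp flip: power_add)
    also have "\<dots> = t powi (int l - int p)"
      using ip by (simp add: power_int_def nat_diff_distrib)
    finally have "t ^ (l - i) * t ^ (i - p) * inverse t ^ p = t powi (int l - int p) * t powi (- int p)"
      by (simp add: power_int_minus power_inverse)
    also have "\<dots> = t powi (int l - 2 * int p)"
      using t by (simp flip: power_int_add)
    finally have pw: "t ^ (l - i) * t ^ (i - p) * inverse t ^ p = t powi (int l - 2 * int p)" .
    have "t ^ (l - i) * coeff ([:t * x, inverse t:] ^ i) p =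
        of_nat (i choose p) * (t ^ (l - i) * t ^ (i - p) * inverse t ^ p) * x ^ (i - p)"
      using True by (simp add: coeff_linear_poly_power power_mult_distrib mult_ac)
    thus ?thesis using True by (simp only: pw if_True)
  next
    case False
    have "degree ([:t * x, inverse t:] ^ i) \<le> degree [:t * x, inverse t:] * i"
      by (rule degree_power_le)
    also have "\<dots> \<le> i" by simp
    finally have "degree ([:t * x, inverse t:] ^ i) < p" using False by simp
    thus ?thesis using False by (simp add: coeff_eq_0)
  qed
  finally show ?thesis .
qed

lemma lower_mat_simps [simp]:
  "lower_mat t u \<in> carrier_mat 2 2"
  "dim_row (lower_mat t u) = 2" "dim_col (lower_mat t u) = 2"
  "lower_mat t u $$ (0, 0) = t" "lower_mat t u $$ (0, Suc 0) = 0"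
  "lower_mat t u $$ (Suc 0, 0) = u" "lower_mat t u $$ (Suc 0, Suc 0) = inverse t"
  by (auto simp: lower_mat_def mat_of_rows_list_def numeral_2_eq_2)

lemma mat2_eqI:
  assumes "A \<in> carrier_mat 2 2" "B \<in> carrier_mat 2 2"
    and "A $$ (0,0) = B $$ (0,0)" "A $$ (0,1) = B $$ (0,1)"
      "A $$ (1,0) = B $$ (1,0)" "A $$ (1,1) = B $$ (1,1)"
  shows "A = B"
  using assms by (intro eq_matI) (auto simp: less_2_cases_iff)

lemma lower_mat_mult: "lower_mat t u * lower_mat s v = lower_mat (t * s) (u * s + inverse t * v)"
  by (rule mat2_eqI) (auto simp: scalar_prod_def numeral_2_eq_2)

lemma lower_mat_uminus: "- lower_mat t u = lower_mat (- t) (- u)"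
  by (rule mat2_eqI) auto

lemma det_lower_mat: "t \<noteq> 0 \<Longrightarrow> det (lower_mat t u) = 1"
proof (subst det_lower_triangular[of 2])
  show "lower_mat t u $$ (i, j) = 0" if "i < j" "j < 2" for i j
  proof -
    have "i = 0" "j = Suc 0" using that by linarith+
    thus ?thesis by simp
  qed
  show "lower_mat t u \<in> carrier_mat 2 2" by simp
qed (simp add: diag_mat_def numeral_2_eq_2)

locale quadratic_parabolic = real_quadratic d for d +
  fixes \<epsilon> b :: real and l1 l2 :: nat
  assumes unit: "fundamental_unit d \<epsilon>" and parity: "[l1 = l2] (mod 2)"
    and basis: "ring_of_integers d = {of_int m * 1 + of_int n * b | m n. True}"
    and basis_nondeg: "1 * galois_conj d b \<noteq> b * galois_conj d 1"
begin

abbreviation \<epsilon>' :: real where "\<epsilon>' \<equiv> galois_conj d \<epsilon>"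

abbreviation \<chi>0 :: real where "\<chi>0 \<equiv> \<epsilon> ^ l1 * \<epsilon>' ^ l2"

definition chi :: complex where "chi = of_real \<chi>0"

lemma eps: "\<epsilon> > 1" "\<epsilon> \<in> integer_units d" "\<epsilon> \<in> ring_of_integers d" "inverse \<epsilon> \<in> ring_of_integers d"
  using unit by (auto simp: fundamental_unit_def integer_units_def)

lemma norm_eps: "\<bar>\<epsilon> * \<epsilon>'\<bar> = 1"
  using integer_unit_norm[OF eps(2)] by (simp add: quad_norm_def)

lemma norm_sq: "(\<epsilon> * \<epsilon>')\<^sup>2 = 1"
  using norm_eps by (simp add: abs_square_eq_1)

lemma eps'_nz: "\<epsilon>' \<noteq> 0" using norm_eps by auto

lemma eps'_sq: "\<epsilon>' ^ 2 = inverse (\<epsilon> ^ 2)"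
  using norm_sq eps(1) by (simp add: power_mult_distrib field_simps)

lemma cj_inverse_eps: "galois_conj d (inverse \<epsilon>) = inverse \<epsilon>'"
  using cj_mult[OF eps(3,4)] eps(1) cj_1 eps'_nz by (simp add: field_simps)

lemma eps_powi: "\<epsilon> powi n \<in> ring_of_integers d \<and> galois_conj d (\<epsilon> powi n) = \<epsilon>' powi n"
proof -
  have pow: "x ^ k \<in> ring_of_integers d \<and> galois_conj d (x ^ k) = galois_conj d x ^ k"
    if "x \<in> ring_of_integers d" for x and k :: nat
    by (induction k) (auto simp: integers_1 cj_1 that integers_mult cj_mult)
  show ?thesis
  proof (cases "n \<ge> 0")
    case True
    thus ?thesis using pow[OF eps(3), of "nat n"] by (simp add: power_int_def)
  next
    case False
    thus ?thesis using pow[OF eps(4), of "nat (- n)"] by (simp add: power_int_def cj_inverse_eps)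
  qed
qed

lemma abs_eps': "\<bar>\<epsilon>'\<bar> = inverse \<epsilon>"
  using norm_eps eps(1) by (simp add: abs_mult field_simps)

text \<open>Conjugation by the diagonal matrix of \<epsilon> multiplies the lower left entry by
  \<epsilon>^(-2). The conjugate of this number is \<epsilon>^2 for either sign of the norm, since
  only the squared norm enters.\<close>

sublocale lattice_rep "ring_of_integers d" "galois_conj d" 1 b "inverse (\<epsilon> ^ 2)"
  chi l1 l2
proof
  show "ring_of_integers d = {of_int m * 1 + of_int n * b | m n. True}" by (rule basis)
  show "galois_conj d (x + y) = galois_conj d x + galois_conj d y"
    if "x \<in> ring_of_integers d" "y \<in> ring_of_integers d" for x y
    using that by (rule cj_add)
  show "inverse (\<epsilon> ^ 2) \<noteq> 0" using eps(1) by simp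
  have c: "inverse (\<epsilon> ^ 2) = \<epsilon> powi (- 2)" "\<epsilon> ^ 2 = \<epsilon> powi 2"
    by (simp_all add: power_int_minus)
  show "inverse (\<epsilon> ^ 2) * x \<in> ring_of_integers d" "x / inverse (\<epsilon> ^ 2) \<in> ring_of_integers d"
    if "x \<in> ring_of_integers d" for x
    using that eps_powi[of "- 2"] eps_powi[of 2] integers_mult[of "\<epsilon> powi (- 2)" x] integers_mult[of x "\<epsilon> powi 2"]
    by (simp_all add: power_int_minus divide_inverse)
  show "galois_conj d (inverse (\<epsilon> ^ 2) * x) = galois_conj d x / inverse (\<epsilon> ^ 2)"
    if "x \<in> ring_of_integers d" for x
    using that eps_powi[of "- 2"] cj_mult[of "\<epsilon> powi (- 2)" x] eps'_sq
    by (simp add: power_int_minus divide_inverse mult_ac)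
  show "1 * galois_conj d b \<noteq> b * galois_conj d 1" by (rule basis_nondeg)
  show "chi \<noteq> 0" using eps(1) eps'_nz by (simp add: chi_def)
  have big: "\<epsilon> ^ Suc k \<noteq> 1" for k using eps(1) by (metis less_irrefl one_less_power zero_less_Suc)
  have double: "(\<epsilon> ^ 2) ^ (k + 1) = \<epsilon> ^ k * \<epsilon> ^ (k + 2)" for k
  proof -
    have "2 * (k + 1) = k + (k + 2)" by simp
    thus ?thesis by (metis power_mult power_add)
  qed
  show "chi / of_real (inverse (\<epsilon> ^ 2)) ^ (l2 + 1) \<noteq> 1"
  proof
    assume "chi / of_real (inverse (\<epsilon> ^ 2)) ^ (l2 + 1) = 1"
    hence "complex_of_real (\<chi>0 * (\<epsilon> ^ 2) ^ (l2 + 1)) = of_real 1"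
      by (simp add: chi_def divide_inverse power_inverse)
    hence "\<chi>0 * (\<epsilon> ^ 2) ^ (l2 + 1) = 1" by (simp only: of_real_eq_iff)
    hence "\<bar>\<chi>0 * (\<epsilon> ^ 2) ^ (l2 + 1)\<bar> = 1" by simp
    hence "\<epsilon> ^ l1 * inverse (\<epsilon> ^ l2) * (\<epsilon> ^ 2) ^ (l2 + 1) = 1"
      using eps(1) by (simp add: abs_mult power_abs abs_eps' power_inverse)
    moreover have "\<epsilon> ^ l1 * inverse (\<epsilon> ^ l2) * (\<epsilon> ^ 2) ^ (l2 + 1) = \<epsilon> ^ Suc (l1 + l2 + 1)"
      unfolding double using eps(1) by (simp add: power_add)
    ultimately show False using big by metis
  qed
  show "chi * of_real (inverse (\<epsilon> ^ 2)) ^ (l1 + 1) \<noteq> 1"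
  proof
    assume "chi * of_real (inverse (\<epsilon> ^ 2)) ^ (l1 + 1) = 1"
    hence "complex_of_real (\<chi>0 * inverse (\<epsilon> ^ 2) ^ (l1 + 1)) = of_real 1" by (simp add: chi_def)
    hence "\<chi>0 * inverse (\<epsilon> ^ 2) ^ (l1 + 1) = 1" by (simp only: of_real_eq_iff)
    hence "\<bar>\<chi>0 * inverse (\<epsilon> ^ 2) ^ (l1 + 1)\<bar> = 1" by simp
    hence "\<epsilon> ^ l1 * inverse (\<epsilon> ^ l2) * inverse ((\<epsilon> ^ 2) ^ (l1 + 1)) = 1"
      using eps(1) by (simp add: abs_mult power_abs abs_eps' power_inverse)
    hence "inverse (\<epsilon> ^ l2 * \<epsilon> ^ (l1 + 2)) = 1"
      unfolding double using eps(1) by (simp add: field_simps)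
    hence "\<epsilon> ^ l2 * \<epsilon> ^ (l1 + 2) = 1" by (simp only: inverse_eq_1_iff)
    hence "\<epsilon> ^ Suc (l1 + l2 + 1) = 1" by (simp add: power_add mult_ac)
    thus False using big by blast
  qed
qed

text \<open>Absolute values give \<epsilon>^l1 = \<epsilon>^l2, hence equal degrees; the character
  is then a power of the norm.\<close>

lemma chi_eq_1_iff: "chi = 1 \<longleftrightarrow> l1 = l2 \<and> quad_norm d \<epsilon> ^ l1 = 1"
proof
  assume "chi = 1"
  hence chi: "\<chi>0 = 1" unfolding chi_def by (simp only: of_real_eq_1_iff)
  hence "\<bar>\<chi>0\<bar> = 1" by simp
  hence "\<epsilon> ^ l1 = \<epsilon> ^ l2" using eps(1) by (simp add: abs_mult power_abs abs_eps' field_simps)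
  hence "l1 = l2" using eps(1) by (simp add: power_inject_exp)
  thus "l1 = l2 \<and> quad_norm d \<epsilon> ^ l1 = 1" using chi by (simp add: quad_norm_def power_mult_distrib)
next
  assume "l1 = l2 \<and> quad_norm d \<epsilon> ^ l1 = 1"
  hence "\<chi>0 = 1" by (auto simp: quad_norm_def power_mult_distrib)
  thus "chi = 1" unfolding chi_def by (simp only: of_real_1)
qed

text \<open>The diagonal weights of the two symmetric tensors match those of \<open>tor\<close>,
  because the inverse square of \<epsilon>' is the inverse of \<epsilon>^(-2).\<close>

lemma weight:
  "(\<epsilon> powi n) powi (int l1 - 2 * int p) * (\<epsilon>' powi n) powi (int l2 - 2 * int q) =
   \<chi>0 powi n * (inverse (\<epsilon> ^ 2) powi n) ^ p * (inverse (\<epsilon> ^ 2) powi (- n)) ^ q"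
proof -
  define t where "t = \<epsilon> powi n"
  define t' where "t' = \<epsilon>' powi n"
  have nz: "t \<noteq> 0" "t' \<noteq> 0" using eps(1) eps'_nz by (simp_all add: t_def t'_def)
  have pw: "z powi (int l - 2 * int k) = z ^ l * inverse (z ^ 2) ^ k" if "z \<noteq> 0" for z :: real and l k
  proof -
    have "z powi (2 * int k) = (z ^ 2) ^ k"
      by (simp add: power_int_mult)
    thus ?thesis using that by (simp add: power_int_diff divide_inverse power_inverse)
  qed
  have sw: "(x ^ k) powi n = (x powi n) ^ k" for x :: real and k
    unfolding power_int_power power_int_power' by (simp only: mult.commute)
  have c1: "inverse (\<epsilon> ^ 2) powi n = inverse (t ^ 2)"
    by (simp add: t_def power_int_inverse sw)
  have "inverse (\<epsilon> ^ 2) powi (- n) = (\<epsilon> ^ 2) powi n" by (simp add: power_int_minus power_int_inverse)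
  also have "\<dots> = inverse (\<epsilon>' ^ 2) powi n" by (simp add: eps'_sq)
  also have "\<dots> = inverse (t' ^ 2)" by (simp add: t'_def power_int_inverse sw)
  finally have c2: "inverse (\<epsilon> ^ 2) powi (- n) = inverse (t' ^ 2)" .
  have "\<chi>0 powi n = t ^ l1 * t' ^ l2" by (simp add: power_int_mult_distrib sw t_def t'_def)
  thus ?thesis unfolding c1 c2 t_def[symmetric] t'_def[symmetric] pw[OF nz(1)] pw[OF nz(2)]
    by (simp add: mult_ac)
qed

text \<open>The product of the unipotent matrix with entry x and the diagonal matrix of
  \<epsilon>^n; this order makes the group law that of \<open>semi\<close>.\<close>

definition gmat :: "int \<times> real \<Rightarrow> real mat" where
  "gmat = (\<lambda>(n, x). lower_mat (\<epsilon> powi n) (\<epsilon> powi n * x))"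

definition gcls :: "int \<times> real \<Rightarrow> real mat set" where
  "gcls g = {gmat g, - gmat g}"

lemma gmat_carrier [simp]: "gmat g \<in> carrier_mat 2 2" "dim_row (gmat g) = 2" "dim_col (gmat g) = 2"
  by (cases g; simp add: gmat_def)+

section \<open>Identification of P with the semidirect product\<close>

lemma gmat_SL2:
  assumes "g \<in> carrier semi"
  shows "gmat g \<in> carrier (SL2 d)"
proof -
  obtain n x where g: "g = (n, x)" and x: "x \<in> ring_of_integers d"
    using assms by (auto simp: carrier_semi)
  have nz: "\<epsilon> powi n \<noteq> 0" using eps(1) by simp
  have "inverse (\<epsilon> powi n) \<in> ring_of_integers d"
    using eps_powi[of "- n"] by (simp add: power_int_minus)
  moreover have "\<epsilon> powi n \<in> ring_of_integers d" "\<epsilon> powi n * x \<in> ring_of_integers d"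
    using eps_powi x integers_mult by auto
  moreover have "0 \<in> ring_of_integers d" by simp
  ultimately have "gmat g $$ (i, j) \<in> ring_of_integers d" if "i < 2" "j < 2" for i j
    using that by (auto simp: g gmat_def less_2_cases_iff)
  hence "elements_mat (gmat g) \<subseteq> ring_of_integers d"
    using gmat_carrier[of g] by (auto dest!: elements_matD)
  thus ?thesis using nz by (simp add: SL2_def g gmat_def det_lower_mat)
qed

lemma gmat_mult:
  assumes "g \<in> carrier semi" "h \<in> carrier semi"
  shows "gmat g * gmat h = gmat (g \<otimes>\<^bsub>semi\<^esub> h)"
proof -
  obtain n x m y where gh: "g = (n, x)" "h = (m, y)" by (cases g; cases h)
  define t where "t = \<epsilon> powi n"
  have nz: "t \<noteq> 0" using eps(1) by (simp add: t_def)
  have c: "inverse (\<epsilon> ^ 2) powi n = inverse (t * t)"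
    by (simp add: t_def power_int_inverse power_int_mult_distrib power2_eq_square)
  have add: "\<epsilon> powi (n + m) = t * \<epsilon> powi m" using eps(1) by (simp add: power_int_add t_def)
  have u: "t * x * \<epsilon> powi m + inverse t * (\<epsilon> powi m * y) = t * \<epsilon> powi m * (x + inverse (t * t) * y)"
    using nz by (simp add: field_simps)
  show ?thesis
    unfolding gh gmat_def mult_semi prod.case lower_mat_mult c add t_def[symmetric] u ..
qed

lemma gcls_coset: "{1\<^sub>m 2, - 1\<^sub>m 2} #>\<^bsub>SL2 d\<^esub> A = {A, - A}" if "A \<in> carrier_mat 2 2"
  using that by (auto simp: r_coset_def SL2_def)

lemma carrier_parabolic: "carrier (parabolic d) = gcls ` carrier semi"
proof (intro equalityI subsetI)
  fix X assume "X \<in> carrier (parabolic d)"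
  then obtain t u where X: "X = {lower_mat t u, - lower_mat t u}"
    and t: "t \<in> integer_units d" and u: "u \<in> ring_of_integers d"
    by (auto simp: parabolic_def gcls_coset)
  obtain n where n: "t = \<epsilon> powi n \<or> t = - (\<epsilon> powi n)"
    using unit t by (auto simp: fundamental_unit_def)
  define x where "x = \<epsilon> powi (- n) * u"
  have x: "x \<in> ring_of_integers d" using eps_powi u integers_mult by (auto simp: x_def)
  have ux: "\<epsilon> powi n * x = u" using eps(1) by (simp add: x_def power_int_minus)
  from n show "X \<in> gcls ` carrier semi"
  proof
    assume "t = \<epsilon> powi n"
    hence "X = gcls (n, x)" by (simp add: X gcls_def gmat_def ux)
    thus ?thesis using x by (auto simp: carrier_semi)
  next
    assume "t = - (\<epsilon> powi n)"
    \<comment> \<open>The sign of the unit is absorbed by the coset; changing the representative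
      also negates the lower left entry.\<close>
    hence "X = gcls (n, - x)" by (auto simp: X gcls_def gmat_def ux lower_mat_uminus)
    thus ?thesis using x by (auto simp: carrier_semi)
  qed
next
  fix X assume "X \<in> gcls ` carrier semi"
  then obtain n x where X: "X = gcls (n, x)" and x: "x \<in> ring_of_integers d"
    by (auto simp: carrier_semi)
  have "\<epsilon> powi n \<in> integer_units d"
    using eps_powi[of n] eps_powi[of "- n"] eps(1) by (simp add: integer_units_def power_int_minus)
  moreover have "\<epsilon> powi n * x \<in> ring_of_integers d" using eps_powi x integers_mult by auto
  moreover have "X = {1\<^sub>m 2, - 1\<^sub>m 2} #>\<^bsub>SL2 d\<^esub> lower_mat (\<epsilon> powi n) (\<epsilon> powi n * x)"
    by (simp add: X gcls_def gmat_def gcls_coset)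
  ultimately show "X \<in> carrier (parabolic d)" by (auto simp: parabolic_def)
qed

lemma mult_parabolic:
  assumes "g \<in> carrier semi" "h \<in> carrier semi"
  shows "gcls g \<otimes>\<^bsub>parabolic d\<^esub> gcls h = gcls (g \<otimes>\<^bsub>semi\<^esub> h)"
proof -
  have "gcls g \<otimes>\<^bsub>parabolic d\<^esub> gcls h = (\<Union>A\<in>gcls g. \<Union>B\<in>gcls h. {A * B})"
    by (simp add: parabolic_def PSL2_def FactGroup_def set_mult_def SL2_def)
  also have "\<dots> = gcls (g \<otimes>\<^bsub>semi\<^esub> h)"
    by (auto simp: gcls_def gmat_mult[OF assms])
  finally show ?thesis .
qed

text \<open>Positivity of the powers of \<epsilon> singles out one of the two signs in a
  coset.\<close>

lemma inj_gcls: "inj_on gcls (carrier semi)"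
proof (rule inj_onI)
  fix g h assume eq: "gcls g = gcls h"
  obtain n x m y where gh: "g = (n, x)" "h = (m, y)" by (cases g; cases h)
  have pos: "\<epsilon> powi n > 0" "\<epsilon> powi m > 0" using eps(1) by simp_all
  have "gmat g = gmat h \<or> gmat g = - gmat h" using eq by (auto simp: gcls_def)
  moreover have "gmat g \<noteq> - gmat h"
  proof
    assume "gmat g = - gmat h"
    hence "gmat g $$ (0, 0) = (- gmat h) $$ (0, 0)" by simp
    thus False using pos by (simp add: gh gmat_def lower_mat_uminus)
  qed
  ultimately have "gmat g = gmat h" by blast
  hence e: "gmat g $$ (0, 0) = gmat h $$ (0, 0)" "gmat g $$ (1, 0) = gmat h $$ (1, 0)" by simp_all
  hence "\<epsilon> powi n = \<epsilon> powi m" by (simp add: gh gmat_def)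
  hence "n = m" using eps(1) by (metis linorder_neqE power_int_strict_increasing less_irrefl)
  thus "g = h" using e eps(1) by (simp add: gh gmat_def)
qed

subsection \<open>Matrices as truncated power series\<close>

text \<open>The binomial coefficient (i choose p) times p! / i! is 1 / (i - p)!, so these
  denominators turn a unipotent symmetric tensor into multiplication by an exponential
  series.\<close>

definition ser :: "complex mat \<Rightarrow> complex fps fps" where
  "ser v = Abs_fps (\<lambda>i. Abs_fps (\<lambda>j. if i \<le> l1 \<and> j \<le> l2 then v $$ (i, j) / (fact i * fact j) else 0))"

definition unser :: "complex fps fps \<Rightarrow> complex mat" where
  "unser w = mat (l1 + 1) (l2 + 1) (\<lambda>(i, j). coeff2 w i j * (fact i * fact j))"

abbreviation T :: "(complex, complex mat) module" where "T \<equiv> tensor_space l1 l2"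

lemma carrier_T: "carrier T = carrier_mat (l1 + 1) (l2 + 1)"
  and add_T: "v \<oplus>\<^bsub>T\<^esub> w = v + w" and zero_T: "\<zero>\<^bsub>T\<^esub> = 0\<^sub>m (l1 + 1) (l2 + 1)"
  and smult_T: "k \<odot>\<^bsub>T\<^esub> v = k \<cdot>\<^sub>m v"
  by (simp_all add: tensor_space_def module_mat_simps)

lemma vectorspace_T: "vectorspace class_ring T"
  unfolding tensor_space_def by (rule matrix_vs)

sublocale T: vectorspace class_ring T by (rule vectorspace_T)

lemma coeff2_ser: "coeff2 (ser v) i j = (if i \<le> l1 \<and> j \<le> l2 then v $$ (i, j) / (fact i * fact j) else 0)"
  by (simp add: ser_def)

lemma ser_box [simp]: "ser v \<in> box l1 l2"
  by (simp add: box_iff coeff2_ser)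

lemma unser_carrier [simp]: "unser w \<in> carrier T"
  by (simp add: unser_def carrier_T)

lemma ser_unser: "w \<in> box l1 l2 \<Longrightarrow> ser (unser w) = w"
  by (rule coeff2_eqI) (auto simp: coeff2_ser unser_def box_iff)

lemma unser_ser: "v \<in> carrier T \<Longrightarrow> unser (ser v) = v"
  by (rule eq_matI) (auto simp: coeff2_ser unser_def carrier_T)

lemma ser_inject: "v \<in> carrier T \<Longrightarrow> w \<in> carrier T \<Longrightarrow> ser v = ser w \<longleftrightarrow> v = w"
  by (metis unser_ser)

lemma ser_add: "v \<in> carrier T \<Longrightarrow> w \<in> carrier T \<Longrightarrow> ser (v \<oplus>\<^bsub>T\<^esub> w) = ser v + ser w"
  by (rule coeff2_eqI) (auto simp: coeff2_ser carrier_T add_T add_divide_distrib)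

lemma ser_smult: "v \<in> carrier T \<Longrightarrow> ser (k \<odot>\<^bsub>T\<^esub> v) = const2 k * ser v"
  by (rule coeff2_eqI) (auto simp: coeff2_ser carrier_T smult_T)

lemma ser_zero: "ser \<zero>\<^bsub>T\<^esub> = 0"
  by (rule coeff2_eqI) (auto simp: coeff2_ser zero_T)

lemma ser_minus:
  assumes "v \<in> carrier T" "w \<in> carrier T"
  shows "ser (v \<ominus>\<^bsub>T\<^esub> w) = ser v - ser w"
proof -
  have "(v \<ominus>\<^bsub>T\<^esub> w) \<oplus>\<^bsub>T\<^esub> w = v"
    using assms by (simp add: T.M.minus_eq T.M.a_assoc T.M.l_neg)
  hence "ser v = ser (v \<ominus>\<^bsub>T\<^esub> w) + ser w"
    using assms ser_add[of "v \<ominus>\<^bsub>T\<^esub> w" w] by simp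
  thus ?thesis by simp
qed

text \<open>Both symmetric tensors are lower triangular, so the matrix product is a sum over p \<le>
  i and q \<le> j; after the rescaling it is the Cauchy product with \<open>lexp x\<close>.\<close>

lemma SL2_act_gmat:
  assumes g: "g \<in> carrier semi" and v: "v \<in> carrier T"
  shows "ser (SL2_act d l1 l2 (gmat g) v) = lact g (ser v)"
proof -
  obtain n x where nx: "g = (n, x)" and x: "x \<in> ring_of_integers d"
    using g by (auto simp: carrier_semi)
  define t where "t = \<epsilon> powi n"
  define t' where "t' = \<epsilon>' powi n"
  define x' where "x' = galois_conj d x"
  have nz: "t \<noteq> 0" "t' \<noteq> 0" using eps(1) eps'_nz by (simp_all add: t_def t'_def)
  define A where "A = sym_rep l1 (map_mat of_real (gmat g))"
  define B where "B = sym_rep l2 (map_mat (of_real \<circ> galois_conj d) (gmat g))"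
  have cj: "galois_conj d t = t'" "galois_conj d (t * x) = t' * x'" "galois_conj d (inverse t) = inverse t'"
    using eps_powi[of n] eps_powi[of "- n"] x
    by (simp_all add: t_def t'_def x'_def cj_mult power_int_minus)
  have A: "A $$ (i, p) = (if p \<le> i then of_nat (i choose p) * of_real t powi (int l1 - 2 * int p) * of_real x ^ (i - p) else 0)"
    if "i \<le> l1" "p \<le> l1" for i p
    unfolding A_def using nz that by (intro sym_rep_lower) (simp_all add: nx gmat_def t_def)
  have B: "B $$ (j, q) = (if q \<le> j then of_nat (j choose q) * of_real t' powi (int l2 - 2 * int q) * of_real x' ^ (j - q) else 0)"
    if "j \<le> l2" "q \<le> l2" for j q
    unfolding B_def using nz that cj
    by (intro sym_rep_lower) (simp_all add: nx gmat_def t_def[symmetric])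
  have AB: "A \<in> carrier_mat (l1 + 1) (l1 + 1)" "B \<in> carrier_mat (l2 + 1) (l2 + 1)"
    by (simp_all add: A_def B_def sym_rep_def)
  have v': "v \<in> carrier_mat (l1 + 1) (l2 + 1)" using v by (simp add: carrier_T)
  have act: "SL2_act d l1 l2 (gmat g) v = A * v * transpose_mat B"
    by (simp add: SL2_act_def tensor_map_def A_def B_def)
  have "coeff2 (ser (SL2_act d l1 l2 (gmat g) v)) i j = coeff2 (lact g (ser v)) i j" for i j
  proof (cases "i \<le> l1 \<and> j \<le> l2")
    case True
    hence ij: "i \<le> l1" "j \<le> l2" by auto
    have "(A * v * transpose_mat B) $$ (i, j) = (\<Sum>p\<le>l1. \<Sum>q\<le>l2. A $$ (i, p) * v $$ (p, q) * B $$ (j, q))"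
      using AB v' ij
      by (simp add: scalar_prod_def atLeast0LessThan lessThan_Suc_atMost sum_distrib_left mult.assoc)
    also have "\<dots> = (\<Sum>p\<le>i. \<Sum>q\<le>l2. A $$ (i, p) * v $$ (p, q) * B $$ (j, q))"
      using ij A by (intro sum.mono_neutral_right) auto
    also have "\<dots> = (\<Sum>p\<le>i. \<Sum>q\<le>j. A $$ (i, p) * v $$ (p, q) * B $$ (j, q))"
      using ij B by (intro sum.cong refl sum.mono_neutral_right) auto
    finally have "coeff2 (ser (SL2_act d l1 l2 (gmat g) v)) i j =
        (\<Sum>p\<le>i. \<Sum>q\<le>j. A $$ (i, p) * v $$ (p, q) * B $$ (j, q)) / (fact i * fact j)"
      using ij by (simp add: coeff2_ser act)
    also have "\<dots> = (\<Sum>p\<le>i. \<Sum>q\<le>j. coeff2 (tor n (ser v)) p q * coeff2 (lexp x) (i - p) (j - q))"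
      unfolding sum_divide_distrib
    proof (intro sum.cong refl)
      fix p q assume "p \<in> {..i}" "q \<in> {..j}"
      hence pq: "p \<le> i" "q \<le> j" "p \<le> l1" "q \<le> l2" using ij by auto
      define w :: complex where
        "w = of_real t powi (int l1 - 2 * int p) * of_real t' powi (int l2 - 2 * int q)"
      have "w = of_real (t powi (int l1 - 2 * int p) * t' powi (int l2 - 2 * int q))"
        by (simp add: w_def)
      hence w: "w = chi powi n * of_real (inverse (\<epsilon> ^ 2) powi n) ^ p *
          of_real (inverse (\<epsilon> ^ 2) powi (- n)) ^ q"
        unfolding t_def t'_def weight chi_def by simp
      have tor: "coeff2 (tor n (ser v)) p q = w * (v $$ (p, q) / (fact p * fact q))"
        unfolding tor_def w using pq by (simp add: coeff2_scale2 coeff2_ser)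
      have bin: "of_nat (k choose r) = (fact k / (fact r * fact (k - r)) :: complex)" if "r \<le> k" for k r
        using that by (rule binomial_fact)
      have "A $$ (i, p) * v $$ (p, q) * B $$ (j, q) / (fact i * fact j) =
          w * (v $$ (p, q) / (fact p * fact q)) *
          (of_real x ^ (i - p) / fact (i - p) * (of_real x' ^ (j - q) / fact (j - q)))"
        using pq ij by (simp add: A B bin w_def field_simps)
      also have "\<dots> = coeff2 (tor n (ser v)) p q * coeff2 (lexp x) (i - p) (j - q)"
        by (simp only: tor lexp_def coeff2_exp2 x'_def)
      finally show "A $$ (i, p) * v $$ (p, q) * B $$ (j, q) / (fact i * fact j) =
          coeff2 (tor n (ser v)) p q * coeff2 (lexp x) (i - p) (j - q)" .
    qed
    also have "\<dots> = coeff2 (lact g (ser v)) i j"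
      using ij by (simp only: nx lact_def prod.case coeff2_trunc2 coeff2_mult mult.commute[of "lexp x"]) simp
    finally show ?thesis .
  next
    case False
    thus ?thesis by (simp only: nx lact_def prod.case coeff2_trunc2 coeff2_ser if_False)
  qed
  thus ?thesis by (rule coeff2_eqI)
qed

lemma SL2_act_carrier:
  assumes "v \<in> carrier T"
  shows "SL2_act d l1 l2 A v \<in> carrier T"
proof -
  have "sym_rep l X \<in> carrier_mat (l + 1) (l + 1)" for l X by (simp add: sym_rep_def)
  thus ?thesis
    using assms unfolding SL2_act_def tensor_map_def carrier_T
    by (intro mult_carrier_mat[of _ _ "l2 + 1"] mult_carrier_mat[of _ _ "l1 + 1"]) auto
qed

lemma PSL2_act_gcls:
  assumes "g \<in> carrier semi" "v \<in> carrier T"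
  shows "PSL2_act d l1 l2 (gcls g) v = SL2_act d l1 l2 (gmat g) v"
proof -
  have "(SOME A. A \<in> gcls g) \<in> gcls g" by (rule someI[of _ "gmat g"]) (simp add: gcls_def)
  hence "(SOME A. A \<in> gcls g) = gmat g \<or> (SOME A. A \<in> gcls g) = - gmat g" by (simp add: gcls_def)
  thus ?thesis
    using SL2_act_uminus[OF sqfree d_gt_1 parity gmat_SL2[OF assms(1)] assms(2)]
    by (auto simp: PSL2_act_def)
qed

lemma PSL2_act_carrier: "v \<in> carrier T \<Longrightarrow> PSL2_act d l1 l2 X v \<in> carrier T"
  by (simp add: PSL2_act_def SL2_act_carrier)

lemma ser_act: "g \<in> carrier semi \<Longrightarrow> v \<in> carrier T \<Longrightarrow> ser (PSL2_act d l1 l2 (gcls g) v) = lact g (ser v)"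
  by (simp add: PSL2_act_gcls SL2_act_gmat)

subsection \<open>Comparison of cochains\<close>

abbreviation P :: "real mat set monoid" where "P \<equiv> parabolic d"
abbreviation pact :: "real mat set \<Rightarrow> complex mat \<Rightarrow> complex mat" where "pact \<equiv> PSL2_act d l1 l2"
abbreviation "C2 \<equiv> carrier P \<times> carrier P"

definition cochain :: "(real mat set \<times> real mat set \<Rightarrow> complex mat) \<Rightarrow> int \<times> real \<Rightarrow> int \<times> real \<Rightarrow> complex fps fps" where
  "cochain f g h = ser (f (gcls g, gcls h))"

lemma cochain_box [simp]: "cochain f g h \<in> box l1 l2"
  by (simp add: cochain_def)

lemma gcls_P [simp]: "g \<in> carrier semi \<Longrightarrow> gcls g \<in> carrier P"
  by (simp add: carrier_parabolic)

lemma P_gcls: "X \<in> carrier P \<Longrightarrow> \<exists>g\<in>carrier semi. X = gcls g"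
  by (auto simp: carrier_parabolic)

lemma cocycles2_iff:
  "f \<in> cocycles2 P T pact \<longleftrightarrow> f \<in> C2 \<rightarrow>\<^sub>E carrier T \<and> rep.cocycle (cochain f)"
proof (cases "f \<in> C2 \<rightarrow>\<^sub>E carrier T")
  case True
  have cl: "f (gcls g, gcls h) \<in> carrier T" if "g \<in> carrier semi" "h \<in> carrier semi" for g h
    using True that by auto
  let ?D = "\<lambda>g h k. pact (gcls g) (f (gcls h, gcls k)) \<ominus>\<^bsub>T\<^esub> f (gcls g \<otimes>\<^bsub>P\<^esub> gcls h, gcls k)
      \<oplus>\<^bsub>T\<^esub> f (gcls g, gcls h \<otimes>\<^bsub>P\<^esub> gcls k) \<ominus>\<^bsub>T\<^esub> f (gcls g, gcls h)"
  have D: "?D g h k = \<zero>\<^bsub>T\<^esub> \<longleftrightarrow>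
      lact g (cochain f h k) + cochain f g (h \<otimes>\<^bsub>semi\<^esub> k) = cochain f (g \<otimes>\<^bsub>semi\<^esub> h) k + cochain f g h"
    if ghk: "g \<in> carrier semi" "h \<in> carrier semi" "k \<in> carrier semi" for g h k
  proof -
    note cls = cl[OF ghk(1,2)] cl[OF ghk(2,3)] cl[OF rep.m_closed[OF ghk(1,2)] ghk(3)]
      cl[OF ghk(1) rep.m_closed[OF ghk(2,3)]]
    have "?D g h k = \<zero>\<^bsub>T\<^esub> \<longleftrightarrow> ser (?D g h k) = 0"
      using cls ghk by (subst ser_zero[symmetric], subst ser_inject) (auto simp: mult_parabolic PSL2_act_carrier)
    also have "ser (?D g h k) = lact g (cochain f h k) - cochain f (g \<otimes>\<^bsub>semi\<^esub> h) k
        + cochain f g (h \<otimes>\<^bsub>semi\<^esub> k) - cochain f g h"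
      using cls ghk by (simp add: mult_parabolic ser_minus ser_add ser_act PSL2_act_carrier cochain_def)
    finally show ?thesis by (simp add: algebra_simps)
  qed
  have "coboundary2 P T pact f = (\<lambda>x \<in> carrier P \<times> carrier P \<times> carrier P. \<zero>\<^bsub>T\<^esub>) \<longleftrightarrow>
      (\<forall>g\<in>carrier semi. \<forall>h\<in>carrier semi. \<forall>k\<in>carrier semi. ?D g h k = \<zero>\<^bsub>T\<^esub>)"
  proof
    assume eq: "coboundary2 P T pact f = (\<lambda>x \<in> carrier P \<times> carrier P \<times> carrier P. \<zero>\<^bsub>T\<^esub>)"
    show "\<forall>g\<in>carrier semi. \<forall>h\<in>carrier semi. \<forall>k\<in>carrier semi. ?D g h k = \<zero>\<^bsub>T\<^esub>"
    proof (intro ballI)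
      fix g h k assume "g \<in> carrier semi" "h \<in> carrier semi" "k \<in> carrier semi"
      thus "?D g h k = \<zero>\<^bsub>T\<^esub>"
        using fun_cong[OF eq, of "(gcls g, gcls h, gcls k)"] by (simp add: coboundary2_def)
    qed
  next
    assume "\<forall>g\<in>carrier semi. \<forall>h\<in>carrier semi. \<forall>k\<in>carrier semi. ?D g h k = \<zero>\<^bsub>T\<^esub>"
    thus "coboundary2 P T pact f = (\<lambda>x \<in> carrier P \<times> carrier P \<times> carrier P. \<zero>\<^bsub>T\<^esub>)"
      unfolding coboundary2_def by (intro restrict_ext) (auto dest!: P_gcls)
  qed
  also have "\<dots> \<longleftrightarrow> rep.cocycle (cochain f)"
    unfolding rep.cocycle_def using D by simp
  finally show ?thesis using True by (simp add: cocycles2_def)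
qed (simp add: cocycles2_def)

lemma coboundaries2_iff:
  "f \<in> coboundaries2 P T pact \<longleftrightarrow> f \<in> C2 \<rightarrow>\<^sub>E carrier T \<and> rep.coboundary (cochain f)"
proof
  assume "f \<in> coboundaries2 P T pact"
  then obtain K where K: "K \<in> carrier P \<rightarrow>\<^sub>E carrier T" and f: "f = coboundary1 P T pact K"
    by (auto simp: coboundaries2_def)
  have cl: "K (gcls g) \<in> carrier T" if "g \<in> carrier semi" for g
    using K that by auto
  have f_eq: "f (gcls g, gcls h) = pact (gcls g) (K (gcls h)) \<ominus>\<^bsub>T\<^esub> K (gcls (g \<otimes>\<^bsub>semi\<^esub> h)) \<oplus>\<^bsub>T\<^esub> K (gcls g)"
    if "g \<in> carrier semi" "h \<in> carrier semi" for g h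
    using that by (simp add: f coboundary1_def mult_parabolic)
  have "f \<in> C2 \<rightarrow>\<^sub>E carrier T"
  proof (rule PiE_I)
    fix X assume "X \<in> C2"
    then obtain g h where "X = (gcls g, gcls h)" "g \<in> carrier semi" "h \<in> carrier semi"
      by (auto dest!: P_gcls)
    thus "f X \<in> carrier T" by (simp add: f_eq cl PSL2_act_carrier)
  qed (simp add: f coboundary1_def)
  moreover have "rep.coboundary (cochain f)"
    unfolding rep.coboundary_def
  proof (intro exI[of _ "\<lambda>g. ser (K (gcls g))"] conjI ballI)
    fix g h assume gh: "g \<in> carrier semi" "h \<in> carrier semi"
    show "cochain f g h = lact g (ser (K (gcls h))) - ser (K (gcls (g \<otimes>\<^bsub>semi\<^esub> h))) + ser (K (gcls g))"
      using gh cl[OF gh(1)] cl[OF gh(2)] cl[OF rep.m_closed[OF gh]]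
      by (simp add: cochain_def f_eq ser_add ser_minus ser_act PSL2_act_carrier)
  qed simp
  ultimately show "f \<in> C2 \<rightarrow>\<^sub>E carrier T \<and> rep.coboundary (cochain f)" by blast
next
  assume "f \<in> C2 \<rightarrow>\<^sub>E carrier T \<and> rep.coboundary (cochain f)"
  then obtain F where f: "f \<in> C2 \<rightarrow>\<^sub>E carrier T" and F: "\<forall>g\<in>carrier semi. F g \<in> box l1 l2"
    "\<forall>g\<in>carrier semi. \<forall>h\<in>carrier semi. cochain f g h = lact g (F h) - F (g \<otimes>\<^bsub>semi\<^esub> h) + F g"
    unfolding rep.coboundary_def by blast
  \<comment> \<open>\<open>F\<close> lives on the semidirect product; injectivity of
    \<open>gcls\<close> lets it be read as a cochain on P.\<close>
  define K where "K = (\<lambda>X\<in>carrier P. unser (F (inv_into (carrier semi) gcls X)))"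
  have K: "K (gcls g) = unser (F g)" if "g \<in> carrier semi" for g
    using that by (simp add: K_def inv_into_f_f[OF inj_gcls])
  have "f = coboundary1 P T pact K"
  proof (rule ext)
    fix X show "f X = coboundary1 P T pact K X"
    proof (cases "X \<in> C2")
      case True
      then obtain g h where X: "X = (gcls g, gcls h)" and gh: "g \<in> carrier semi" "h \<in> carrier semi"
        by (auto dest!: P_gcls)
      have eq: "coboundary1 P T pact K X =
          pact (gcls g) (unser (F h)) \<ominus>\<^bsub>T\<^esub> unser (F (g \<otimes>\<^bsub>semi\<^esub> h)) \<oplus>\<^bsub>T\<^esub> unser (F g)"
        using gh by (simp add: coboundary1_def X mult_parabolic K)
      have "ser (coboundary1 P T pact K X) = cochain f g h"
        unfolding eq using gh F
        by (simp add: ser_add ser_minus ser_act PSL2_act_carrier ser_unser)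
      hence "ser (f X) = ser (coboundary1 P T pact K X)" by (simp add: cochain_def X)
      moreover have "f X \<in> carrier T" using f True by auto
      moreover have "coboundary1 P T pact K X \<in> carrier T"
        unfolding eq by (simp add: PSL2_act_carrier)
      ultimately show ?thesis by (simp add: ser_inject)
    next
      case False
      thus ?thesis by (simp add: coboundary1_def PiE_arb[OF f])
    qed
  qed
  moreover have "K \<in> carrier P \<rightarrow>\<^sub>E carrier T" by (auto simp: K_def)
  ultimately show "f \<in> coboundaries2 P T pact" by (auto simp: coboundaries2_def)
qed

definition invt :: "(real mat set \<times> real mat set \<Rightarrow> complex mat) \<Rightarrow> complex" where
  "invt f = coeff2 (cochain f (0, 1) (0, b) - cochain f (0, b) (0, 1)) 0 0"

lemma cocycle_cong:
  assumes "\<And>g h. g \<in> carrier semi \<Longrightarrow> h \<in> carrier semi \<Longrightarrow> f g h = f' g h"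
  shows "rep.cocycle f \<longleftrightarrow> rep.cocycle f'"
  unfolding rep.cocycle_def using assms by simp

section \<open>The module of cocycles and its invariant\<close>

abbreviation "cocycle_module \<equiv> (fun_module C2 T)\<lparr>carrier := cocycles2 P T pact\<rparr>"

lemma cochain_add:
  assumes "f \<in> cocycles2 P T pact" "f' \<in> cocycles2 P T pact" "g \<in> carrier semi" "h \<in> carrier semi"
  shows "cochain (\<lambda>x\<in>C2. f x \<oplus>\<^bsub>T\<^esub> f' x) g h = cochain f g h + cochain f' g h"
proof -
  have "f (gcls g, gcls h) \<in> carrier T" "f' (gcls g, gcls h) \<in> carrier T"
    using assms by (auto simp: cocycles2_def)
  thus ?thesis using assms(3,4) by (simp add: cochain_def ser_add)
qed

lemma cochain_smult:
  assumes "f \<in> cocycles2 P T pact" "g \<in> carrier semi" "h \<in> carrier semi"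
  shows "cochain (\<lambda>x\<in>C2. k \<odot>\<^bsub>T\<^esub> f x) g h = const2 k * cochain f g h"
proof -
  have "f (gcls g, gcls h) \<in> carrier T"
    using assms by (auto simp: cocycles2_def)
  thus ?thesis using assms(2,3) by (simp add: cochain_def ser_smult)
qed

lemma const2_box: "v \<in> box l1 l2 \<Longrightarrow> const2 k * v \<in> box l1 l2"
  by (simp add: box_iff)

lemma module_cocycles: "Module.module class_ring cocycle_module"
proof (rule fun_module_module)
  show "Module.module class_ring T" by (rule T.module_axioms)
  show "cocycles2 P T pact \<subseteq> (C2 \<rightarrow>\<^sub>E carrier T)" by (auto simp: cocycles2_def)
  show "(\<lambda>x\<in>C2. \<zero>\<^bsub>T\<^esub>) \<in> cocycles2 P T pact"
    unfolding cocycles2_iff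
  proof
    have "rep.cocycle (\<lambda>g h. 0)"
      using rep.act_0 by (simp add: rep.cocycle_def)
    thus "rep.cocycle (cochain (\<lambda>x\<in>C2. \<zero>\<^bsub>T\<^esub>))"
      by (rule cocycle_cong[THEN iffD1, rotated]) (simp add: cochain_def ser_zero)
  qed auto
  show "(\<lambda>x\<in>C2. f x \<oplus>\<^bsub>T\<^esub> f' x) \<in> cocycles2 P T pact"
    if f: "f \<in> cocycles2 P T pact" "f' \<in> cocycles2 P T pact" for f f'
    unfolding cocycles2_iff
  proof
    have c: "rep.cocycle (cochain f)" "rep.cocycle (cochain f')" using f by (simp_all add: cocycles2_iff)
    have "rep.cocycle (\<lambda>g h. cochain f g h + cochain f' g h)"
      using c by (rule rep.cocycle_add)
    thus "rep.cocycle (cochain (\<lambda>x\<in>C2. f x \<oplus>\<^bsub>T\<^esub> f' x))"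
      by (rule cocycle_cong[THEN iffD1, rotated]) (simp add: cochain_add f)
  qed (use f in \<open>auto simp: cocycles2_def\<close>)
  show "(\<lambda>x\<in>C2. k \<odot>\<^bsub>T\<^esub> f x) \<in> cocycles2 P T pact"
    if f: "f \<in> cocycles2 P T pact" for k f
    unfolding cocycles2_iff
  proof
    have c: "rep.cocycle (cochain f)" using f by (simp add: cocycles2_iff)
    have "rep.cocycle (\<lambda>g h. const2 k * cochain f g h)"
      using c unfolding rep.cocycle_def lact_const2 distrib_left[symmetric] by (simp add: const2_box)
    thus "rep.cocycle (cochain (\<lambda>x\<in>C2. k \<odot>\<^bsub>T\<^esub> f x))"
      by (rule cocycle_cong[THEN iffD1, rotated]) (simp add: cochain_smult f)
  qed (use f in \<open>auto simp: cocycles2_def class_ring_simps\<close>)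
qed

lemma semi_base [simp]: "(0, 1) \<in> carrier semi" "(0, b) \<in> carrier semi"
  by (simp_all add: carrier_semi)

lemma functional_invt: "module_functional cocycle_module invt"
proof -
  interpret A: Module.module class_ring cocycle_module by (rule module_cocycles)
  show ?thesis
  proof
    show "invt (f \<oplus>\<^bsub>cocycle_module\<^esub> f') = invt f + invt f'"
      if "f \<in> carrier cocycle_module" "f' \<in> carrier cocycle_module" for f f'
      using that cochain_add[of f f' "(0, 1)" "(0, b)"] cochain_add[of f f' "(0, b)" "(0, 1)"]
      by (simp add: fun_module_def invt_def)
    show "invt (k \<odot>\<^bsub>cocycle_module\<^esub> f) = k * invt f" if "f \<in> carrier cocycle_module" for k f
      using that cochain_smult[of f "(0, 1)" "(0, b)" k] cochain_smult[of f "(0, b)" "(0, 1)" k]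
      by (simp add: fun_module_def invt_def algebra_simps)
  qed
qed

text \<open>Coboundaries are the kernel of a single functional, so the cohomology embeds in the
  complex line, and it remains to see whether \<open>invt\<close> vanishes identically.\<close>

lemma coboundaries2_eq: "coboundaries2 P T pact = {f \<in> cocycles2 P T pact. invt f = 0}"
proof (intro equalityI subsetI)
  fix f assume "f \<in> coboundaries2 P T pact"
  hence f: "f \<in> C2 \<rightarrow>\<^sub>E carrier T" "rep.coboundary (cochain f)" by (simp_all add: coboundaries2_iff)
  have "rep.cocycle (cochain f)" using f(2) by (rule rep.coboundary_cocycle)
  thus "f \<in> {f \<in> cocycles2 P T pact. invt f = 0}"
    using f coboundary_invariant[OF f(2)] by (simp add: cocycles2_iff invt_def)
next
  fix f assume "f \<in> {f \<in> cocycles2 P T pact. invt f = 0}"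
  thus "f \<in> coboundaries2 P T pact"
    using cocycle_coboundary[of "cochain f"] by (simp add: cocycles2_iff coboundaries2_iff invt_def)
qed

lemma H2_parabolic_eq:
  "H2_parabolic d l1 l2 = quotient_module cocycle_module (module_functional.level cocycle_module invt 0)"
  unfolding H2_parabolic_def cohomology2_def module_functional.level_def[OF functional_invt]
    coboundaries2_eq by simp

lemma H2_trivial:
  assumes "\<not> (l1 = l2 \<and> quad_norm d \<epsilon> ^ l1 = 1)"
  shows "carrier (H2_parabolic d l1 l2) = {\<zero>\<^bsub>H2_parabolic d l1 l2\<^esub>}"
  unfolding H2_parabolic_eq
proof (rule module_functional.quotient_trivial[OF functional_invt])
  fix f assume "f \<in> carrier cocycle_module"
  hence "rep.cocycle (cochain f)" by (simp add: cocycles2_iff)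
  thus "invt f = 0"
    unfolding invt_def by (rule cocycle_invariant) (use assms chi_eq_1_iff in blast)
qed

lemma H2_dim_1:
  assumes "l1 = l2 \<and> quad_norm d \<epsilon> ^ l1 = 1"
  shows "vectorspace.fin_dim class_ring (H2_parabolic d l1 l2) \<and>
    vectorspace.dim class_ring (H2_parabolic d l1 l2) = 1"
proof -
  have "chi = 1" using assms chi_eq_1_iff by blast
  then obtain F where F: "rep.cocycle F" "coeff2 (F (0, 1) (0, b) - F (0, b) (0, 1)) 0 0 \<noteq> 0"
    by (rule cocycle_exists)
  let ?i = "inv_into (carrier semi) gcls"
  define f where "f = (\<lambda>(X, Y)\<in>C2. unser (F (?i X) (?i Y)))"
  have eq: "cochain f g h = F g h" if "g \<in> carrier semi" "h \<in> carrier semi" for g h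
    using that rep.cocycle_closed[OF F(1) that]
    by (simp add: cochain_def f_def inv_into_f_f[OF inj_gcls] ser_unser)
  have "rep.cocycle (cochain f)"
    using F(1) by (rule cocycle_cong[THEN iffD1, rotated]) (simp add: eq)
  moreover have "f \<in> C2 \<rightarrow>\<^sub>E carrier T" by (auto simp: f_def)
  ultimately have "f \<in> carrier cocycle_module" by (simp add: cocycles2_iff)
  moreover have "invt f \<noteq> 0" unfolding invt_def using F(2) by (simp add: eq)
  ultimately show ?thesis
    unfolding H2_parabolic_eq by (rule module_functional.quotient_dim_1[OF functional_invt])
qed

end

theorem theorem3p9:
  fixes d l1 l2 :: nat and \<epsilon> :: real
  assumes "squarefree d" and "d > 1"
    and "fundamental_unit d \<epsilon>"
    and "l1 \<ge> l2" and "[l1 = l2] (mod 2)"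
  shows "(\<not> (l1 = l2 \<and> quad_norm d \<epsilon> ^ l1 = 1) \<longrightarrow>
            carrier (H2_parabolic d l1 l2) = {\<zero>\<^bsub>H2_parabolic d l1 l2\<^esub>}) \<and>
         (l1 = l2 \<and> quad_norm d \<epsilon> ^ l1 = 1 \<longrightarrow>
            vectorspace.fin_dim class_ring (H2_parabolic d l1 l2) \<and>
            vectorspace.dim class_ring (H2_parabolic d l1 l2) = 1)"
proof -
  interpret real_quadratic d using assms(1,2) by unfold_locales
  obtain b where "ring_of_integers d = {of_int m * 1 + of_int n * b | m n. True}"
    "1 * galois_conj d b \<noteq> b * galois_conj d 1"
    by (rule integers_basis)
  then interpret quadratic_parabolic d \<epsilon> b l1 l2 using assms(3,5) by unfold_locales
  show ?thesis using H2_trivial H2_dim_1 by blast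
qed

end
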